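(* Let $n\ge1$, let $M$ be a smooth oriented $n$-manifold, $(f,\xi)$, $f:M\to\mathbb{R}^{n+1}$, a non-degenerate equiaffine immersion with conormal map $\nu:M\to(\mathbb{R}^{n+1})^*$, and suppose that the immersion $\sigma^+=(\xi,\nu):M\to\mathbb{S}^{n,n+1}$ is non-degenerate. Then $\bar\sigma:=\pi_+\circ\sigma^+:M\to\mathbb{H}^n_\tau$ is a Lagrangian immersion, i.e. $\bar\sigma^*\boldsymbol\omega\equiv0$, and its induced metric coincides with $\bar h=h(S(\cdot),\cdot)$. Moreover, if $\sigma^+$ is maximal, the same holds for $\bar\sigma$.
   Context: Everything is smooth. $D$ is the flat connection on $\mathbb{R}^{n+1}$. Affine immersions. Let $f:M\to\mathbb{R}^{n+1}$ be an immersion with a vector field $\xi:M\to\mathbb{R}^{n+1}$ such that $\mathbb{R}^{n+1}=f_*(T_pM)\oplus\mathbb{R}\xi_p$ for all $p$. Write $D_Xf_*Y=f_*(\nabla_XY)+h(X,Y)\xi$ and $D_X\xi=-f_*(SX)+\tau(X)\xi$. $(f,\xi)$ is equiaffine if $\tau=0$, and non-degenerate if $h$ is non-degenerate; $S$ is the affine shape operator. The conormal map $\nu$ is defined by $\nu_p(\xi_p)=1$, $\nu_p(f_*X)=0$ for $X\in T_pM$. Pseudosphere. $V=\mathbb{R}^{n+1}\oplus(\mathbb{R}^{n+1})^*$ with $\hat{\mathbf g}((v,\alpha),(w,\beta))=\tfrac12(\alpha(w)+\beta(v))$. $\mathbb{S}^{n,n+1}=\{(v,\alpha)\in V:\alpha(v)=1\}$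 with the restricted metric $g$ of signature $(n,n+1)$. At $z=(v,\alpha)$ let $\mathcal{H}_z=\{(w,\beta):\alpha(w)=0=\beta(v)\}\subset T_z\mathbb{S}^{n,n+1}$ (the $g$-orthogonal complement of $(v,-\alpha)$) and $\phi(w,\beta)=(w,-\beta)$ on $\mathcal{H}_z$. Para-complex hyperbolic space. $\mathbb{R}$ acts freely and properly by isometries on $\mathbb{S}^{n,n+1}$ via $t\cdot(v,\alpha)=(e^tv,e^{-t}\alpha)$; $\pi_+:\mathbb{S}^{n,n+1}\to\mathbb{H}^n_\tau:=\mathbb{S}^{n,n+1}/\mathbb{R}$ is the quotient principal $\mathbb{R}$-bundle. $\mathbb{H}^n_\tau$ carries the metric $\mathbf g$ of signature $(n,n)$ and symplectic form $\boldsymbol\omega$ corresponding to $g|_{\mathcal H}$ and $g(\cdot,\phi\cdot)|_{\mathcal H}$ under the isomorphisms $d\pi_+:\mathcal{H}_z\to T_{\pi_+(z)}\mathbb{H}^n_\tau$. An immersion into a pseudo-Riemannian manifold is non-degenerate if its induced metric is non-degenerate (for $\sigma^+$ this is equivalent to $\det S\ne0$), and then maximal if its mean curvature (trace of the second fundamental form with respect to the induced metric) vanishes identically. *)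

theory Defs
  imports "HOL-Analysis.Analysis"
begin

section \<open>Smooth manifolds\<close>

text \<open>
  Both predicates below are only used for open \<open>S\<close>. Mixed directional derivatives of all orders
  exist as Frechet derivatives; in finite dimension this is the usual \<open>C\<close>-infinity.
\<close>

primrec Ck_on :: "nat \<Rightarrow> 'a::real_normed_vector set \<Rightarrow> ('a \<Rightarrow> 'b::real_normed_vector) \<Rightarrow> bool" where
  "Ck_on 0 S f \<longleftrightarrow> continuous_on S f"
| "Ck_on (Suc k) S f \<longleftrightarrow> (\<forall>x\<in>S. f differentiable (at x)) \<and>
     (\<forall>v. Ck_on k S (\<lambda>x. frechet_derivative f (at x) v))"

definition smooth_on :: "'a::real_normed_vector set \<Rightarrow> ('a \<Rightarrow> 'b::real_normed_vector) \<Rightarrow> bool" where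
  "smooth_on S f \<longleftrightarrow> (\<forall>k. Ck_on k S f)"

text \<open>A chart is a pair (domain, coordinate map); its map is only relevant on its domain.\<close>

type_synonym ('m, 'e) chart = "'m set \<times> ('m \<Rightarrow> 'e)"

record ('m, 'e) manifold =
  mtop :: "'m topology"
  atlas :: "('m, 'e) chart set"

abbreviation points :: "('m, 'e) manifold \<Rightarrow> 'm set" where
  "points M \<equiv> topspace (mtop M)"

definition chart_inv :: "('m, 'e) chart \<Rightarrow> 'e \<Rightarrow> 'm" where
  "chart_inv c = inv_into (fst c) (snd c)"

definition is_chart :: "'m topology \<Rightarrow> ('m, 'e::real_normed_vector) chart \<Rightarrow> bool" where
  "is_chart T c \<longleftrightarrow> openin T (fst c) \<and> open (snd c ` fst c) \<and>
     homeomorphic_map (subtopology T (fst c)) (top_of_set (snd c ` fst c)) (snd c)"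

definition smooth_manifold :: "('m, 'e::real_normed_vector) manifold \<Rightarrow> bool" where
  "smooth_manifold M \<longleftrightarrow>
     Hausdorff_space (mtop M) \<and> second_countable (mtop M) \<and>
     (\<forall>c\<in>atlas M. is_chart (mtop M) c) \<and>
     (\<Union>c\<in>atlas M. fst c) = points M \<and>
     (\<forall>c\<in>atlas M. \<forall>d\<in>atlas M. smooth_on (snd c ` (fst c \<inter> fst d)) (snd d \<circ> chart_inv c))"

definition charts_at :: "('m, 'e) manifold \<Rightarrow> 'm \<Rightarrow> ('m, 'e) chart set" where
  "charts_at M p = {c \<in> atlas M. p \<in> fst c}"

definition chart_at :: "('m, 'e) manifold \<Rightarrow> 'm \<Rightarrow> ('m, 'e) chart" where
  "chart_at M p = (SOME c. c \<in> charts_at M p)"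

definition dtransition ::
    "('m, 'e::real_normed_vector) chart \<Rightarrow> ('m, 'e) chart \<Rightarrow> 'm \<Rightarrow> 'e \<Rightarrow> 'e" where
  "dtransition c d p = frechet_derivative (snd d \<circ> chart_inv c) (at (snd c p))"

text \<open>
  The atlas is not required to be maximal; an oriented manifold is one whose atlas consists of
  positively related charts.
\<close>

definition oriented :: "('m, real ^ 'n) manifold \<Rightarrow> bool" where
  "oriented M \<longleftrightarrow>
     (\<forall>p\<in>points M. \<forall>c\<in>charts_at M p. \<forall>d\<in>charts_at M p. det (matrix (dtransition c d p)) > 0)"

text \<open>
  A tangent vector at \<open>p\<close> is the family of its coordinate vectors in the charts around \<open>p\<close>, with
  the usual transformation rule (and the value 0 at all other charts, so that equality of tangent
  vectors is equality of functions).
\<close>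

type_synonym ('m, 'e) tvec = "('m, 'e) chart \<Rightarrow> 'e"

definition tangent_space :: "('m, 'e::real_normed_vector) manifold \<Rightarrow> 'm \<Rightarrow> ('m, 'e) tvec set" where
  "tangent_space M p = {X.
     (\<forall>c\<in>charts_at M p. \<forall>d\<in>charts_at M p. X d = dtransition c d p (X c)) \<and>
     (\<forall>c. c \<notin> charts_at M p \<longrightarrow> X c = 0)}"

definition coord_vec ::
    "('m, 'e::real_normed_vector) manifold \<Rightarrow> ('m, 'e) chart \<Rightarrow> 'm \<Rightarrow> 'e \<Rightarrow> ('m, 'e) tvec" where
  "coord_vec M c p u = (\<lambda>d. if d \<in> charts_at M p then dtransition c d p u else 0)"

definition vector_field ::
    "('m, 'e::real_normed_vector) manifold \<Rightarrow> 'm set \<Rightarrow> ('m \<Rightarrow> ('m, 'e) tvec) \<Rightarrow> bool" where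
  "vector_field M U Y \<longleftrightarrow> (\<forall>q\<in>U. Y q \<in> tangent_space M q) \<and>
     (\<forall>c\<in>atlas M. smooth_on (snd c ` (U \<inter> fst c)) (\<lambda>y. Y (chart_inv c y) c))"

text \<open>Smooth maps into a vector space and their differentials (with values in that vector space).\<close>

definition smooth_vmap ::
    "('m, 'e::real_normed_vector) manifold \<Rightarrow> ('m \<Rightarrow> 'v::real_normed_vector) \<Rightarrow> bool" where
  "smooth_vmap M f \<longleftrightarrow> (\<forall>c\<in>atlas M. smooth_on (snd c ` fst c) (f \<circ> chart_inv c))"

definition vdifferential ::
    "('m, 'e::real_normed_vector) manifold \<Rightarrow> ('m \<Rightarrow> 'v::real_normed_vector) \<Rightarrow>
      'm \<Rightarrow> ('m, 'e) tvec \<Rightarrow> 'v" where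
  "vdifferential M f p X =
     (let c = chart_at M p in frechet_derivative (f \<circ> chart_inv c) (at (snd c p)) (X c))"

definition smooth_map ::
    "('m, 'e::real_normed_vector) manifold \<Rightarrow> ('p, 'd::real_normed_vector) manifold \<Rightarrow>
      ('m \<Rightarrow> 'p) \<Rightarrow> bool" where
  "smooth_map M N F \<longleftrightarrow> continuous_map (mtop M) (mtop N) F \<and>
     (\<forall>c\<in>atlas M. \<forall>d\<in>atlas N.
        smooth_on (snd c ` (fst c \<inter> F -` fst d)) (snd d \<circ> F \<circ> chart_inv c))"

definition differential ::
    "('m, 'e::real_normed_vector) manifold \<Rightarrow> ('p, 'd::real_normed_vector) manifold \<Rightarrow>
      ('m \<Rightarrow> 'p) \<Rightarrow> 'm \<Rightarrow> ('m, 'e) tvec \<Rightarrow> ('p, 'd) tvec" where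
  "differential M N F p X =
     (\<lambda>d. if d \<in> charts_at N (F p) then vdifferential M (snd d \<circ> F) p X else 0)"

definition immersion ::
    "('m, 'e::real_normed_vector) manifold \<Rightarrow> ('p, 'd::real_normed_vector) manifold \<Rightarrow>
      ('m \<Rightarrow> 'p) \<Rightarrow> bool" where
  "immersion M N F \<longleftrightarrow> smooth_map M N F \<and>
     (\<forall>p\<in>points M. inj_on (differential M N F p) (tangent_space M p))"


section \<open>Immersions into pseudo-Riemannian manifolds\<close>

text \<open>A (0,2)-tensor field: a bilinear form on each tangent space.\<close>

type_synonym ('m, 'e) tensor2 = "'m \<Rightarrow> ('m, 'e) tvec \<Rightarrow> ('m, 'e) tvec \<Rightarrow> real"

definition pullback ::
    "('m, 'e::real_normed_vector) manifold \<Rightarrow> ('p, 'd::real_normed_vector) manifold \<Rightarrow>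
      ('p, 'd) tensor2 \<Rightarrow> ('m \<Rightarrow> 'p) \<Rightarrow> ('m, 'e) tensor2" where
  "pullback M N g F p X Y = g (F p) (differential M N F p X) (differential M N F p Y)"

definition nondegenerate :: "('m, 'e::real_normed_vector) manifold \<Rightarrow> ('m, 'e) tensor2 \<Rightarrow> bool" where
  "nondegenerate M b \<longleftrightarrow> (\<forall>p\<in>points M. \<forall>X\<in>tangent_space M p.
     (\<forall>Y\<in>tangent_space M p. b p X Y = 0) \<longrightarrow> X = (\<lambda>_. 0))"

definition nondegenerate_immersion ::
    "('m, 'e::real_normed_vector) manifold \<Rightarrow> ('p, 'd::real_normed_vector) manifold \<Rightarrow>
      ('p, 'd) tensor2 \<Rightarrow> ('m \<Rightarrow> 'p) \<Rightarrow> bool" where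
  "nondegenerate_immersion M N g F \<longleftrightarrow> immersion M N F \<and> nondegenerate M (pullback M N g F)"

definition metric_coeff ::
    "('p, 'd::real_normed_vector) manifold \<Rightarrow> ('p, 'd) tensor2 \<Rightarrow> ('p, 'd) chart \<Rightarrow>
      'd \<Rightarrow> 'd \<Rightarrow> 'd \<Rightarrow> real" where
  "metric_coeff N g d y u w =
     (let q = chart_inv d y in g q (coord_vec N d q u) (coord_vec N d q w))"

text \<open>
  The Levi-Civita connection in the chart \<open>d\<close>: \<open>christoffel N g d y u w\<close> is the coordinate vector
  of the covariant derivative of the constant field \<open>w\<close> in direction \<open>u\<close>, given by Koszul's formula.
\<close>

definition christoffel ::
    "('p, 'd::real_normed_vector) manifold \<Rightarrow> ('p, 'd) tensor2 \<Rightarrow> ('p, 'd) chart \<Rightarrow>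
      'd \<Rightarrow> 'd \<Rightarrow> 'd \<Rightarrow> 'd" where
  "christoffel N g d y u w = (THE z. \<forall>x. 2 * metric_coeff N g d y z x =
       frechet_derivative (\<lambda>y'. metric_coeff N g d y' w x) (at y) u
     + frechet_derivative (\<lambda>y'. metric_coeff N g d y' u x) (at y) w
     - frechet_derivative (\<lambda>y'. metric_coeff N g d y' u w) (at y) x)"

text \<open>
  Levi-Civita covariant derivative, in direction \<open>X\<close> at \<open>p\<close>, of a vector field \<open>V\<close> along
  \<open>F : M \<rightarrow> N\<close> (that is, \<open>V q\<close> is tangent to \<open>N\<close> at \<open>F q\<close>).
\<close>

definition covariant_derivative ::
    "('m, 'e::real_normed_vector) manifold \<Rightarrow> ('p, 'd::real_normed_vector) manifold \<Rightarrow>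
      ('p, 'd) tensor2 \<Rightarrow> ('m \<Rightarrow> 'p) \<Rightarrow> ('m \<Rightarrow> ('p, 'd) tvec) \<Rightarrow> 'm \<Rightarrow> ('m, 'e) tvec \<Rightarrow>
      ('p, 'd) tvec" where
  "covariant_derivative M N g F V p X =
     (\<lambda>d. if d \<in> charts_at N (F p)
          then vdifferential M (\<lambda>q. V q d) p X
             + christoffel N g d (snd d (F p)) (differential M N F p X d) (V p d)
          else 0)"

definition normal_part ::
    "('m, 'e::real_normed_vector) manifold \<Rightarrow> ('p, 'd::real_normed_vector) manifold \<Rightarrow>
      ('p, 'd) tensor2 \<Rightarrow> ('m \<Rightarrow> 'p) \<Rightarrow> 'm \<Rightarrow> ('p, 'd) tvec \<Rightarrow> ('p, 'd) tvec" where
  "normal_part M N g F p W = (THE W'. W' \<in> tangent_space N (F p) \<and>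
     (\<forall>Z\<in>tangent_space M p. g (F p) W' (differential M N F p Z) = 0) \<and>
     (\<exists>Z\<in>tangent_space M p. W = (\<lambda>d. differential M N F p Z d + W' d)))"

text \<open>
  The vector \<open>Y\<close> is extended to a vector field near \<open>p\<close>, with constant coefficients in a chart; the
  result does not depend on the extension.
\<close>

definition second_fundamental_form ::
    "('m, 'e::real_normed_vector) manifold \<Rightarrow> ('p, 'd::real_normed_vector) manifold \<Rightarrow>
      ('p, 'd) tensor2 \<Rightarrow> ('m \<Rightarrow> 'p) \<Rightarrow> 'm \<Rightarrow> ('m, 'e) tvec \<Rightarrow> ('m, 'e) tvec \<Rightarrow> ('p, 'd) tvec" where
  "second_fundamental_form M N g F p X Y =
     (let c = chart_at M p; Y' = (\<lambda>q. coord_vec M c q (Y c)) in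
      normal_part M N g F p
        (covariant_derivative M N g F (\<lambda>q. differential M N F q (Y' q)) p X))"

definition mean_curvature ::
    "('m, real ^ 'n) manifold \<Rightarrow> ('p, 'd::real_normed_vector) manifold \<Rightarrow>
      ('p, 'd) tensor2 \<Rightarrow> ('m \<Rightarrow> 'p) \<Rightarrow> 'm \<Rightarrow> ('p, 'd) tvec" where
  "mean_curvature M N g F p =
     (let E = (\<lambda>i. coord_vec M (chart_at M p) p (axis i 1));
          G = (\<chi> i j. pullback M N g F p (E i) (E j)) in
      (\<lambda>d. \<Sum>i\<in>UNIV. \<Sum>j\<in>UNIV.
        (matrix_inv G $ i $ j) *\<^sub>R second_fundamental_form M N g F p (E i) (E j) d))"

definition maximal_immersion ::
    "('m, real ^ 'n) manifold \<Rightarrow> ('p, 'd::real_normed_vector) manifold \<Rightarrow>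
      ('p, 'd) tensor2 \<Rightarrow> ('m \<Rightarrow> 'p) \<Rightarrow> bool" where
  "maximal_immersion M N g F \<longleftrightarrow> nondegenerate_immersion M N g F \<and>
     (\<forall>p\<in>points M. mean_curvature M N g F p = (\<lambda>_. 0))"

definition lagrangian_immersion ::
    "('m, 'e::real_normed_vector) manifold \<Rightarrow> ('p, 'd::real_normed_vector) manifold \<Rightarrow>
      ('p, 'd) tensor2 \<Rightarrow> ('m \<Rightarrow> 'p) \<Rightarrow> bool" where
  "lagrangian_immersion M N \<omega> F \<longleftrightarrow> immersion M N F \<and>
     (\<forall>p\<in>points M. \<forall>X\<in>tangent_space M p. \<forall>Y\<in>tangent_space M p. pullback M N \<omega> F p X Y = 0)"


section \<open>Affine immersions\<close>

text \<open>\<open>n+1\<close>-dimensional space, where \<open>n = CARD('n)\<close>, and its dual.\<close>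

type_synonym 'n aff = "(real, 'n option) vec"
type_synonym 'n aff_dual = "'n aff \<Rightarrow>\<^sub>L real"

definition affine_immersion ::
    "('m, real ^ 'n) manifold \<Rightarrow> ('m \<Rightarrow> 'n::finite aff) \<Rightarrow> ('m \<Rightarrow> 'n aff) \<Rightarrow> bool" where
  "affine_immersion M f \<xi> \<longleftrightarrow> smooth_vmap M f \<and> smooth_vmap M \<xi> \<and>
     (\<forall>p\<in>points M. inj_on (vdifferential M f p) (tangent_space M p) \<and>
        bij_betw (\<lambda>(Z, a). vdifferential M f p Z + a *\<^sub>R \<xi> p)
          (tangent_space M p \<times> (UNIV :: real set)) UNIV)"

text \<open>
  The defining equations of the induced connection \<open>nabla\<close>, the affine fundamental form \<open>h\<close>, the
  affine shape operator \<open>S\<close> and the transversal form \<open>\<tau>\<close>. By the direct sum decomposition required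
  in \<open>affine_immersion\<close>, they determine these objects uniquely on tangent vectors and local
  vector fields. Here \<open>nabla p X Y\<close> is the derivative in direction \<open>X\<close> at \<open>p\<close> of the field \<open>Y\<close>,
  and the flat derivative is the differential of a vector-valued function.
\<close>

definition structure_equations ::
    "('m, real ^ 'n) manifold \<Rightarrow> ('m \<Rightarrow> 'n::finite aff) \<Rightarrow> ('m \<Rightarrow> 'n aff) \<Rightarrow>
      ('m \<Rightarrow> ('m, real ^ 'n) tvec \<Rightarrow> ('m \<Rightarrow> ('m, real ^ 'n) tvec) \<Rightarrow> ('m, real ^ 'n) tvec) \<Rightarrow>
      ('m, real ^ 'n) tensor2 \<Rightarrow>
      ('m \<Rightarrow> ('m, real ^ 'n) tvec \<Rightarrow> ('m, real ^ 'n) tvec) \<Rightarrow>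
      ('m \<Rightarrow> ('m, real ^ 'n) tvec \<Rightarrow> real) \<Rightarrow> bool" where
  "structure_equations M f \<xi> nabla h S \<tau> \<longleftrightarrow>
     (\<forall>U Y. openin (mtop M) U \<and> vector_field M U Y \<longrightarrow>
        (\<forall>p\<in>U. \<forall>X\<in>tangent_space M p.
           nabla p X Y \<in> tangent_space M p \<and>
           vdifferential M (\<lambda>q. vdifferential M f q (Y q)) p X =
             vdifferential M f p (nabla p X Y) + h p X (Y p) *\<^sub>R \<xi> p)) \<and>
     (\<forall>p\<in>points M. \<forall>X\<in>tangent_space M p.
        S p X \<in> tangent_space M p \<and>
        vdifferential M \<xi> p X = - vdifferential M f p (S p X) + \<tau> p X *\<^sub>R \<xi> p)"

definition equiaffine :: "('m, real ^ 'n) manifold \<Rightarrow> ('m \<Rightarrow> ('m, real ^ 'n) tvec \<Rightarrow> real) \<Rightarrow> bool" where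
  "equiaffine M \<tau> \<longleftrightarrow> (\<forall>p\<in>points M. \<forall>X\<in>tangent_space M p. \<tau> p X = 0)"

definition conormal_map ::
    "('m, real ^ 'n) manifold \<Rightarrow> ('m \<Rightarrow> 'n::finite aff) \<Rightarrow> ('m \<Rightarrow> 'n aff) \<Rightarrow>
      ('m \<Rightarrow> 'n aff_dual) \<Rightarrow> bool" where
  "conormal_map M f \<xi> \<nu> \<longleftrightarrow> (\<forall>p\<in>points M. blinfun_apply (\<nu> p) (\<xi> p) = 1 \<and>
     (\<forall>X\<in>tangent_space M p. blinfun_apply (\<nu> p) (vdifferential M f p X) = 0))"


section \<open>The pseudosphere and para-complex hyperbolic space\<close>

type_synonym 'n para = "'n aff \<times> 'n aff_dual"

fun ghat :: "'n::finite para \<Rightarrow> 'n para \<Rightarrow> real" where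
  "ghat (v, \<alpha>) (w, \<beta>) = (blinfun_apply \<alpha> w + blinfun_apply \<beta> v) / 2"

definition sphere_set :: "'n::finite para set" where
  "sphere_set = {(v, \<alpha>). blinfun_apply \<alpha> v = 1}"

text \<open>
  The structure of an embedded submanifold: the charts are the inverses of all smooth regular
  parametrisations of open subsets.
\<close>

definition pseudosphere :: "('n::finite para, (real ^ 'n) \<times> (real ^ 'n) \<times> real) manifold" where
  "pseudosphere = \<lparr> mtop = top_of_set sphere_set,
     atlas = {c. is_chart (top_of_set sphere_set) c \<and>
        smooth_on (snd c ` fst c) (chart_inv c) \<and>
        (\<forall>y\<in>snd c ` fst c. inj (frechet_derivative (chart_inv c) (at y)))} \<rparr>"

text \<open>The identification of abstract tangent vectors of the pseudosphere with vectors of the ambient space.\<close>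

definition ambient ::
    "'n::finite para \<Rightarrow> ('n para, (real ^ 'n) \<times> (real ^ 'n) \<times> real) tvec \<Rightarrow> 'n para" where
  "ambient z X = vdifferential pseudosphere (\<lambda>x. x) z X"

definition sphere_metric :: "('n::finite para, (real ^ 'n) \<times> (real ^ 'n) \<times> real) tensor2" where
  "sphere_metric z X Y = ghat (ambient z X) (ambient z Y)"

fun horizontal :: "'n::finite para \<Rightarrow> 'n para set" where
  "horizontal (v, \<alpha>) = {(w, \<beta>). blinfun_apply \<alpha> w = 0 \<and> blinfun_apply \<beta> v = 0}"

fun para_phi :: "'n::finite para \<Rightarrow> 'n para" where
  "para_phi (w, \<beta>) = (w, - \<beta>)"

fun action :: "real \<Rightarrow> 'n::finite para \<Rightarrow> 'n para" where
  "action t (v, \<alpha>) = (exp t *\<^sub>R v, exp (- t) *\<^sub>R \<alpha>)"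

definition proj_plus :: "'n::finite para \<Rightarrow> 'n para set" where
  "proj_plus z = range (\<lambda>t. action t z)"

definition quotient_topology :: "'a topology \<Rightarrow> ('a \<Rightarrow> 'b) \<Rightarrow> 'b topology" where
  "quotient_topology T \<pi> =
     topology (\<lambda>U. U \<subseteq> \<pi> ` topspace T \<and> openin T {x \<in> topspace T. \<pi> x \<in> U})"

lemma openin_quotient_topology:
  "openin (quotient_topology T \<pi>) U \<longleftrightarrow>
     U \<subseteq> \<pi> ` topspace T \<and> openin T {x \<in> topspace T. \<pi> x \<in> U}"
proof -
  have "istopology (\<lambda>U. U \<subseteq> \<pi> ` topspace T \<and> openin T {x \<in> topspace T. \<pi> x \<in> U})"
    unfolding istopology_def
  proof (intro conjI allI impI)
    fix A B
    assume "A \<subseteq> \<pi> ` topspace T \<and> openin T {x \<in> topspace T. \<pi> x \<in> A}"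
      and "B \<subseteq> \<pi> ` topspace T \<and> openin T {x \<in> topspace T. \<pi> x \<in> B}"
    moreover have "{x \<in> topspace T. \<pi> x \<in> A \<inter> B} =
        {x \<in> topspace T. \<pi> x \<in> A} \<inter> {x \<in> topspace T. \<pi> x \<in> B}" by auto
    ultimately show "A \<inter> B \<subseteq> \<pi> ` topspace T" "openin T {x \<in> topspace T. \<pi> x \<in> A \<inter> B}"
      by auto
  next
    fix K
    assume K: "\<forall>A\<in>K. A \<subseteq> \<pi> ` topspace T \<and> openin T {x \<in> topspace T. \<pi> x \<in> A}"
    then show "\<Union>K \<subseteq> \<pi> ` topspace T" by auto
    have "{x \<in> topspace T. \<pi> x \<in> \<Union>K} = (\<Union>A\<in>K. {x \<in> topspace T. \<pi> x \<in> A})" by auto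
    then show "openin T {x \<in> topspace T. \<pi> x \<in> \<Union>K}" using K by auto
  qed
  then show ?thesis by (simp add: quotient_topology_def)
qed

lemma topspace_quotient_topology: "topspace (quotient_topology T \<pi>) = \<pi> ` topspace T"
proof
  show "topspace (quotient_topology T \<pi>) \<subseteq> \<pi> ` topspace T"
    using openin_topspace[of "quotient_topology T \<pi>"] by (simp only: openin_quotient_topology)
  have "{x \<in> topspace T. \<pi> x \<in> \<pi> ` topspace T} = topspace T" by auto
  then have "openin (quotient_topology T \<pi>) (\<pi> ` topspace T)"
    by (simp add: openin_quotient_topology)
  then show "\<pi> ` topspace T \<subseteq> topspace (quotient_topology T \<pi>)" by (rule openin_subset)
qed

lemma quotient_map_quotient_topology: "quotient_map T (quotient_topology T \<pi>) \<pi>"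
  unfolding quotient_map_def topspace_quotient_topology openin_quotient_topology by auto

text \<open>
  The points are the orbits. The charts are those for which the quotient projection becomes a
  smooth submersion; this is the unique smooth structure of the quotient manifold.
\<close>

definition para_hyperbolic :: "('n::finite para set, (real ^ 'n) \<times> (real ^ 'n)) manifold" where
  "para_hyperbolic = \<lparr> mtop = quotient_topology (top_of_set sphere_set) proj_plus,
     atlas = {d. is_chart (quotient_topology (top_of_set sphere_set) proj_plus) d \<and>
        (\<forall>c\<in>atlas (pseudosphere :: ('n para, (real ^ 'n) \<times> (real ^ 'n) \<times> real) manifold).
           let W = snd c ` (fst c \<inter> proj_plus -` fst d);
               r = snd d \<circ> proj_plus \<circ> chart_inv c in
           smooth_on W r \<and> (\<forall>y\<in>W. surj (frechet_derivative r (at y))))} \<rparr>"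

definition horizontal_lift ::
    "'n::finite para \<Rightarrow> ('n para set, (real ^ 'n) \<times> (real ^ 'n)) tvec \<Rightarrow> 'n para" where
  "horizontal_lift z Z = (THE x. x \<in> horizontal z \<and>
     (\<exists>X\<in>tangent_space pseudosphere z.
        ambient z X = x \<and> differential pseudosphere para_hyperbolic proj_plus z X = Z))"

text \<open>
  The forms on the quotient do not depend on the chosen point of the orbit, as the action preserves
  all the data involved.
\<close>

lemma ghat_action: "ghat (action t x) (action t y) = ghat x y"
  by (cases x; cases y)
    (simp add: blinfun.scaleR_left blinfun.scaleR_right flip: exp_add mult.assoc)

lemma horizontal_action: "action t x \<in> horizontal (action t z) \<longleftrightarrow> x \<in> horizontal z"
  by (cases x; cases z) (simp add: blinfun.scaleR_left blinfun.scaleR_right)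

lemma para_phi_action: "para_phi (action t x) = action t (para_phi x)"
  by (cases x) simp

definition hyperbolic_metric :: "('n::finite para set, (real ^ 'n) \<times> (real ^ 'n)) tensor2" where
  "hyperbolic_metric q Z W =
     (let z = (SOME z. z \<in> q) in ghat (horizontal_lift z Z) (horizontal_lift z W))"

definition hyperbolic_symplectic :: "('n::finite para set, (real ^ 'n) \<times> (real ^ 'n)) tensor2" where
  "hyperbolic_symplectic q Z W =
     (let z = (SOME z. z \<in> q) in ghat (horizontal_lift z Z) (para_phi (horizontal_lift z W)))"

end

theory Submission
  imports Defs
begin

text \<open>
  Write \<open>\<sigma> = (\<xi>, \<nu>)\<close>. Differentiating \<open>\<nu>(\<xi>) = 1\<close> and using \<open>\<nu>(d\<xi>) = 0\<close> (equiaffinity) shows that \<open>\<sigma>\<close> is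
  horizontal. Differentiating \<open>\<nu>(d\<xi>) = 0\<close> shows that \<open>d\<nu>(X)(d\<xi>(Y))\<close> is symmetric, which is the Lagrangian
  condition; differentiating \<open>\<nu>(df) = 0\<close> identifies this symmetric form with \<open>h(S X, Y)\<close>.

  For maximality, both second fundamental forms are expressed through the second derivative \<open>B\<close> of \<open>\<sigma>\<close> in the
  ambient vector space: the covariant derivative is the tangential part of \<open>B\<close> on the pseudosphere, and the
  projection of the horizontal part of \<open>B\<close> on the quotient. The two parts differ by a vertical vector, so the
  second fundamental form of the projection is the projection of that of \<open>\<sigma>\<close>, and so is its trace.
  On the quotient, the Christoffel symbols at a point are computed with a local section of the projection that
  is horizontal at that point.
\<close>

section \<open>Calculus of smooth functions\<close>

text \<open>Both atlases are specified by a property of their charts, not by a list, so their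
  compatibility is itself a claim. It rests on the smoothness of inverse maps and on one explicit
  chart around each point in which the projection merely forgets a coordinate. The horizontal
  distribution is not integrable, its curvature being a multiple of the symplectic form, so no
  section is horizontal on a whole neighbourhood. Horizontality at one point is enough: the metric
  of the quotient then differs from the pull-back of \<open>ghat\<close> by the square of a 1-form
  vanishing at that point, and Koszul's formula contains only first derivatives of the metric. A
  second mismatch remains. The section composed with the coordinates of the projected map does not
  return \<sigma> but \<sigma> moved along orbits by a variable amount. Since both maps are
  horizontal at the point in question, this amount is stationary there, and the second derivatives
  differ only by vectors that the horizontal projection kills.\<close>

abbreviation fderiv ::
    "('a::real_normed_vector \<Rightarrow> 'b::real_normed_vector) \<Rightarrow> 'a \<Rightarrow> 'a \<Rightarrow> 'b" where
  "fderiv f x \<equiv> frechet_derivative f (at x)"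

lemma frechet_derivative_eqI:
  "(f has_derivative f') (at x) \<Longrightarrow> fderiv f x = f'"
  using frechet_derivative_at by metis

lemma differentiable_has_derivative:
  "f differentiable (at x) \<Longrightarrow> (f has_derivative fderiv f x) (at x)"
  by (simp add: frechet_derivative_works)

lemma has_derivative_at_cong:
  assumes "open S" "x \<in> S" "\<And>y. y \<in> S \<Longrightarrow> f y = g y"
  shows "(f has_derivative f') (at x) \<longleftrightarrow> (g has_derivative f') (at x)"
  using has_derivative_transform_within_open[OF _ assms(1,2), of f f' UNIV g]
    has_derivative_transform_within_open[OF _ assms(1,2), of g f' UNIV f] assms(3) by auto

lemma differentiable_at_cong:
  assumes "open S" "x \<in> S" "\<And>y. y \<in> S \<Longrightarrow> f y = g y"
  shows "f differentiable (at x) \<longleftrightarrow> g differentiable (at x)"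
  using has_derivative_at_cong[OF assms] by (simp add: differentiable_def)

lemma frechet_derivative_at_cong:
  assumes "open S" "x \<in> S" "\<And>y. y \<in> S \<Longrightarrow> f y = g y"
  shows "fderiv f x = fderiv g x"
  using has_derivative_at_cong[OF assms] by (simp add: frechet_derivative_def)

section \<open>Locality and closure properties of C^k maps\<close>

lemma Ck_on_cong:
  assumes "open S" "Ck_on k S f" "\<And>x. x \<in> S \<Longrightarrow> f x = g x"
  shows "Ck_on k S g"
  using assms(2,3)
proof (induction k arbitrary: f g)
  case 0
  then show ?case using continuous_on_cong by fastforce
next
  case (Suc k)
  have "fderiv g x = fderiv f x" if "x \<in> S" for x
    using frechet_derivative_at_cong[OF assms(1) that] Suc.prems(2) by metis
  moreover have "g differentiable (at x)" if "x \<in> S" for x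
    using differentiable_at_cong[OF assms(1) that, of f g] Suc.prems that by simp
  ultimately show ?case
    using Suc.prems(1) by (auto intro: Suc.IH)
qed

lemma Ck_on_subset: "Ck_on k S f \<Longrightarrow> T \<subseteq> S \<Longrightarrow> Ck_on k T f"
  by (induction k arbitrary: f) (auto intro: continuous_on_subset)

text \<open>\<open>Ck_on\<close> takes its derivatives at a point in the full space, never within
  \<open>S\<close>, so every order is decided near each point and \<open>S\<close> may be
  arbitrary.\<close>

lemma Ck_on_local:
  assumes "\<And>x. x \<in> S \<Longrightarrow> \<exists>T. open T \<and> x \<in> T \<and> Ck_on k T f"
  shows "Ck_on k S f"
  using assms
proof (induction k arbitrary: f)
  case 0
  have "isCont f x" if "x \<in> S" for x
    using 0[OF that] by (auto simp: continuous_on_eq_continuous_at)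
  then show ?case by (simp add: continuous_at_imp_continuous_on)
next
  case (Suc k)
  have "Ck_on k S (\<lambda>x. fderiv f x v)" for v
  proof (rule Suc.IH)
    fix x assume "x \<in> S"
    from Suc.prems[OF this]
    show "\<exists>T. open T \<and> x \<in> T \<and> Ck_on k T (\<lambda>x. fderiv f x v)" by auto
  qed
  moreover have "f differentiable (at x)" if "x \<in> S" for x
    using Suc.prems[OF that] by auto
  ultimately show ?case by simp
qed

lemma Ck_on_SucD: "Ck_on (Suc k) S f \<Longrightarrow> Ck_on k S f"
proof (induction k arbitrary: f)
  case 0
  then show ?case
    by (auto intro!: continuous_at_imp_continuous_on differentiable_imp_continuous_within)
next
  case (Suc k)
  from Suc.prems have d: "\<forall>x\<in>S. f differentiable (at x)"
    and "Ck_on (Suc k) S (\<lambda>x. fderiv f x v)" for v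
    by simp_all
  with Suc.IH have "Ck_on k S (\<lambda>x. fderiv f x v)" for v by blast
  with d show ?case by simp
qed

lemma Ck_on_const: "Ck_on k S (\<lambda>x. c)"
  by (induction k arbitrary: c) auto

lemma Ck_on_add:
  assumes "open S" "Ck_on k S f" "Ck_on k S g"
  shows "Ck_on k S (\<lambda>x. f x + g x)"
  using assms(2,3)
proof (induction k arbitrary: f g)
  case 0
  then show ?case by (simp add: continuous_on_add)
next
  case (Suc k)
  have *: "fderiv f x v + fderiv g x v =
      fderiv (\<lambda>x. f x + g x) x v" if "x \<in> S" for x v
    using Suc.prems that
    by (simp add: frechet_derivative_eqI[OF has_derivative_add[OF differentiable_has_derivative
        differentiable_has_derivative]])
  have "Ck_on k S (\<lambda>x. fderiv (\<lambda>x. f x + g x) x v)" for v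
    using Suc.prems by (intro Ck_on_cong[OF assms(1) Suc.IH *]) auto
  with Suc.prems show ?case by simp
qed

lemma Ck_on_bounded_linear:
  assumes L: "bounded_linear L" and "open S" "Ck_on k S f"
  shows "Ck_on k S (\<lambda>x. L (f x))"
  using assms(3)
proof (induction k arbitrary: f)
  case 0
  then show ?case using bounded_linear.continuous_on[OF L] by auto
next
  case (Suc k)
  have d: "((\<lambda>x. L (f x)) has_derivative (\<lambda>v. L (fderiv f x v))) (at x)"
    if "x \<in> S" for x
    using Suc.prems that by (intro bounded_linear.has_derivative[OF L differentiable_has_derivative]) auto
  have "Ck_on k S (\<lambda>x. fderiv (\<lambda>x. L (f x)) x v)" for v
    using Suc.prems frechet_derivative_eqI[OF d]
    by (intro Ck_on_cong[OF assms(2) Suc.IH[of "\<lambda>x. fderiv f x v"]]) auto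
  with d show ?case by (auto simp: differentiable_def)
qed

lemma Ck_on_bounded_bilinear:
  assumes B: "bounded_bilinear B" and "open S" "Ck_on k S f" "Ck_on k S g"
  shows "Ck_on k S (\<lambda>x. B (f x) (g x))"
  using assms(3,4)
proof (induction k arbitrary: f g)
  case 0
  then show ?case using bounded_bilinear.continuous_on[OF B] by auto
next
  case (Suc k)
  have d: "((\<lambda>x. B (f x) (g x)) has_derivative
      (\<lambda>v. B (f x) (fderiv g x v) + B (fderiv f x v) (g x))) (at x)"
    if "x \<in> S" for x
    using Suc.prems that
    by (intro bounded_bilinear.FDERIV[OF B differentiable_has_derivative differentiable_has_derivative]) auto
  have "Ck_on k S (\<lambda>x. fderiv (\<lambda>x. B (f x) (g x)) x v)" for v
  proof (rule Ck_on_cong[OF assms(2)])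
    show "Ck_on k S (\<lambda>x. B (f x) (fderiv g x v) + B (fderiv f x v) (g x))"
      using Suc.prems Ck_on_SucD[OF Suc.prems(1)] Ck_on_SucD[OF Suc.prems(2)]
      by (intro Ck_on_add[OF assms(2)] Suc.IH) auto
  qed (simp add: frechet_derivative_eqI[OF d])
  with d show ?case by (auto simp: differentiable_def)
qed

lemma Ck_on_linear: "bounded_linear L \<Longrightarrow> Ck_on k S L"
proof (cases k)
  case (Suc k')
  assume L: "bounded_linear L"
  have "fderiv L x = L" for x
    by (rule frechet_derivative_eqI) (rule bounded_linear_imp_has_derivative[OF L])
  then show ?thesis
    using Suc bounded_linear_imp_differentiable[OF L] by (simp add: Ck_on_const)
qed (simp add: linear_continuous_on)

lemma Ck_on_sum:
  assumes "open S" "\<And>i. i \<in> I \<Longrightarrow> Ck_on k S (f i)"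
  shows "Ck_on k S (\<lambda>x. \<Sum>i\<in>I. f i x)"
proof (cases "finite I")
  case True
  then show ?thesis using assms(2)
    by (induction I) (auto intro!: Ck_on_const Ck_on_add[OF assms(1)])
qed (simp add: Ck_on_const)

text \<open>\<open>Ck_on\<close> controls derivatives in fixed directions only. The basis turns a
  direction that moves with the point into finitely many fixed ones with moving coefficients; this
  is why the chain rule below asks for a Euclidean space.\<close>

lemma linear_frechet_derivative_expand:
  fixes f :: "'a::euclidean_space \<Rightarrow> 'b::real_normed_vector"
  assumes "f differentiable (at x)"
  shows "fderiv f x v = (\<Sum>b\<in>Basis. (v \<bullet> b) *\<^sub>R fderiv f x b)"
proof -
  have "linear (fderiv f x)"
    using assms by (rule linear_frechet_derivative)
  then show ?thesis
    by (subst euclidean_representation[of v, symmetric]) (simp add: linear_sum linear_scale)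
qed

text \<open>The derivative of the composite is a finite sum of coordinates of
  \<open>fderiv g\<close> times functions \<open>fderiv f _ b\<close> composed with
  \<open>g\<close>, all of one order less. The induction therefore ranges over all \<open>f\<close>
  while \<open>g\<close> stays the same.\<close>

lemma Ck_on_compose:
  fixes f :: "'b::euclidean_space \<Rightarrow> 'c::real_normed_vector"
    and g :: "'a::real_normed_vector \<Rightarrow> 'b"
  assumes S: "open S" and T: "open T" and gS: "\<And>x. x \<in> S \<Longrightarrow> g x \<in> T"
    and "Ck_on k S g" "Ck_on k T f"
  shows "Ck_on k S (\<lambda>x. f (g x))"
  using assms(4,5)
proof (induction k arbitrary: f)
  case 0
  then show ?case using gS by (auto intro: continuous_on_compose2)
next
  case (Suc k)
  have d: "((\<lambda>x. f (g x)) has_derivative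
      (\<lambda>v. fderiv f (g x) (fderiv g x v))) (at x)"
    if "x \<in> S" for x
    using Suc.prems that gS
    by (intro has_derivative_compose[OF differentiable_has_derivative differentiable_has_derivative]) auto
  have "Ck_on k S (\<lambda>x. fderiv (\<lambda>x. f (g x)) x v)" for v
  proof (rule Ck_on_cong[OF S])
    show "Ck_on k S (\<lambda>x. \<Sum>b\<in>Basis. (fderiv g x v \<bullet> b) *\<^sub>R fderiv f (g x) b)"
      using Suc.prems Ck_on_SucD[OF Suc.prems(1)]
      by (intro Ck_on_sum[OF S] Ck_on_bounded_bilinear[OF bounded_bilinear_scaleR S]
          Ck_on_bounded_linear[OF bounded_linear_inner_left S] Suc.IH) auto
    show "(\<Sum>b\<in>Basis. (fderiv g x v \<bullet> b) *\<^sub>R fderiv f (g x) b) =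
        fderiv (\<lambda>x. f (g x)) x v" if "x \<in> S" for x
      using Suc.prems that gS
      by (simp add: frechet_derivative_eqI[OF d] flip: linear_frechet_derivative_expand)
  qed
  with d show ?case by (auto simp: differentiable_def)
qed

text \<open>The derivative contains the reciprocal again, but only to the order that the induction
  hypothesis supplies.\<close>

lemma Ck_on_inverse:
  fixes f :: "'a::real_normed_vector \<Rightarrow> real"
  assumes S: "open S" and "Ck_on k S f" and nz: "\<And>x. x \<in> S \<Longrightarrow> f x \<noteq> 0"
  shows "Ck_on k S (\<lambda>x. inverse (f x))"
  using assms(2)
proof (induction k)
  case 0
  then show ?case using nz by (auto intro: continuous_on_inverse)
next
  case (Suc k)
  have d: "((\<lambda>x. inverse (f x)) has_derivative
      (\<lambda>v. - 1 * (inverse (f x) * fderiv f x v * inverse (f x)))) (at x)"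
    if "x \<in> S" for x
    using Suc.prems that nz
    by (auto intro!: Deriv.has_derivative_inverse[THEN has_derivative_eq_rhs] differentiable_has_derivative)
  have "Ck_on k S (\<lambda>x. fderiv (\<lambda>x. inverse (f x)) x v)" for v
  proof (rule Ck_on_cong[OF S])
    show "Ck_on k S (\<lambda>x. - (inverse (f x) * fderiv f x v * inverse (f x)))"
      using Suc.prems Suc.IH[OF Ck_on_SucD[OF Suc.prems]]
      by (intro Ck_on_bounded_linear[OF bounded_linear_minus[OF bounded_linear_ident] S]
          Ck_on_bounded_bilinear[OF bounded_bilinear_mult S]) auto
  qed (simp add: frechet_derivative_eqI[OF d])
  with d show ?case by (auto simp: differentiable_def)
qed

text \<open>The logarithm disappears after one derivative and leaves the reciprocal already treated,
  so a case distinction replaces the induction.\<close>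

lemma Ck_on_ln:
  fixes f :: "'a::real_normed_vector \<Rightarrow> real"
  assumes S: "open S" and "Ck_on k S f" and pos: "\<And>x. x \<in> S \<Longrightarrow> f x > 0"
  shows "Ck_on k S (\<lambda>x. ln (f x))"
  using assms(2)
proof (cases k)
  case 0
  then show ?thesis using assms(2) pos by (force intro: continuous_on_ln)
next
  case (Suc k')
  have d: "((\<lambda>x. ln (f x)) has_derivative
      (\<lambda>v. fderiv f x v * inverse (f x))) (at x)"
    if "x \<in> S" for x
    using assms(2) that pos Suc
    by (auto intro!: has_derivative_ln[THEN has_derivative_eq_rhs] differentiable_has_derivative)
  have f: "Ck_on k' S f" "\<And>v. Ck_on k' S (\<lambda>x. fderiv f x v)"
    using assms(2) Suc by (auto intro: Ck_on_SucD)
  have nz: "f x \<noteq> 0" if "x \<in> S" for x using pos[OF that] by simp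
  have "Ck_on k' S (\<lambda>x. fderiv (\<lambda>x. ln (f x)) x v)" for v
  proof (rule Ck_on_cong[OF S])
    show "Ck_on k' S (\<lambda>x. fderiv f x v * inverse (f x))"
      by (intro Ck_on_bounded_bilinear[OF bounded_bilinear_mult S] Ck_on_inverse[OF S] f nz)
  qed (simp add: frechet_derivative_eqI[OF d])
  with d Suc show ?thesis by (auto simp: differentiable_def)
qed

lemma Ck_on_exp:
  fixes f :: "'a::real_normed_vector \<Rightarrow> real"
  assumes S: "open S" and "Ck_on k S f"
  shows "Ck_on k S (\<lambda>x. exp (f x))"
  using assms(2)
proof (induction k)
  case 0
  then show ?case by (auto intro: continuous_on_exp)
next
  case (Suc k)
  have d: "((\<lambda>x. exp (f x)) has_derivative
      (\<lambda>v. fderiv f x v * exp (f x))) (at x)"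
    if "x \<in> S" for x
    using Suc.prems that
    by (auto intro!: has_derivative_exp[THEN has_derivative_eq_rhs] differentiable_has_derivative)
  have "Ck_on k S (\<lambda>x. fderiv (\<lambda>x. exp (f x)) x v)" for v
    by (rule Ck_on_cong[OF S])
      (use Suc Ck_on_SucD[OF Suc.prems] in \<open>auto simp: frechet_derivative_eqI[OF d]
        intro!: Ck_on_bounded_bilinear[OF bounded_bilinear_mult S]\<close>)
  with d show ?case by (auto simp: differentiable_def)
qed

section \<open>The same closure properties for C-infinity maps\<close>

lemma smooth_on_cong: "open S \<Longrightarrow> smooth_on S f \<Longrightarrow> (\<And>x. x \<in> S \<Longrightarrow> f x = g x) \<Longrightarrow> smooth_on S g"
  unfolding smooth_on_def using Ck_on_cong by blast

lemma smooth_on_subset: "smooth_on S f \<Longrightarrow> T \<subseteq> S \<Longrightarrow> smooth_on T f"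
  unfolding smooth_on_def using Ck_on_subset by blast

lemma smooth_on_local:
  "(\<And>x. x \<in> S \<Longrightarrow> \<exists>T. open T \<and> x \<in> T \<and> smooth_on T f) \<Longrightarrow> smooth_on S f"
  unfolding smooth_on_def by (meson Ck_on_local)

lemma smooth_on_const: "smooth_on S (\<lambda>x. c)"
  by (simp add: smooth_on_def Ck_on_const)

lemma smooth_on_add:
  "open S \<Longrightarrow> smooth_on S f \<Longrightarrow> smooth_on S g \<Longrightarrow> smooth_on S (\<lambda>x. f x + g x)"
  by (simp add: smooth_on_def Ck_on_add)

lemma smooth_on_bounded_linear:
  "bounded_linear L \<Longrightarrow> open S \<Longrightarrow> smooth_on S f \<Longrightarrow> smooth_on S (\<lambda>x. L (f x))"
  by (simp add: smooth_on_def Ck_on_bounded_linear)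

lemma smooth_on_bounded_bilinear:
  "bounded_bilinear B \<Longrightarrow> open S \<Longrightarrow> smooth_on S f \<Longrightarrow> smooth_on S g \<Longrightarrow> smooth_on S (\<lambda>x. B (f x) (g x))"
  by (simp add: smooth_on_def Ck_on_bounded_bilinear)

lemma smooth_on_linear: "bounded_linear L \<Longrightarrow> smooth_on S L"
  by (simp add: smooth_on_def Ck_on_linear)

lemma smooth_on_compose:
  fixes f :: "'b::euclidean_space \<Rightarrow> 'c::real_normed_vector"
  assumes "open S" "open T" "\<And>x. x \<in> S \<Longrightarrow> g x \<in> T" "smooth_on S g" "smooth_on T f"
  shows "smooth_on S (\<lambda>x. f (g x))"
  using assms unfolding smooth_on_def using Ck_on_compose by blast

lemma smooth_on_inverse_real:
  fixes f :: "'a::real_normed_vector \<Rightarrow> real"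
  shows "open S \<Longrightarrow> smooth_on S f \<Longrightarrow> (\<And>x. x \<in> S \<Longrightarrow> f x \<noteq> 0) \<Longrightarrow> smooth_on S (\<lambda>x. inverse (f x))"
  by (simp add: smooth_on_def Ck_on_inverse)

lemma smooth_on_ln:
  fixes f :: "'a::real_normed_vector \<Rightarrow> real"
  shows "open S \<Longrightarrow> smooth_on S f \<Longrightarrow> (\<And>x. x \<in> S \<Longrightarrow> f x > 0) \<Longrightarrow> smooth_on S (\<lambda>x. ln (f x))"
  by (simp add: smooth_on_def Ck_on_ln)

lemma smooth_on_exp:
  fixes f :: "'a::real_normed_vector \<Rightarrow> real"
  shows "open S \<Longrightarrow> smooth_on S f \<Longrightarrow> smooth_on S (\<lambda>x. exp (f x))"
  by (simp add: smooth_on_def Ck_on_exp)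

lemma smooth_on_Pair:
  fixes f :: "'a::real_normed_vector \<Rightarrow> 'b::real_normed_vector"
    and g :: "'a::real_normed_vector \<Rightarrow> 'c::real_normed_vector"
  assumes S: "open S" and "smooth_on S f" "smooth_on S g"
  shows "smooth_on S (\<lambda>x. (f x, g x))"
proof -
  have "bounded_linear (\<lambda>y. (y, 0) :: 'b \<times> 'c)" "bounded_linear (\<lambda>y. (0, y) :: 'b \<times> 'c)"
    by (intro bounded_linear_Pair bounded_linear_ident bounded_linear_zero)+
  from smooth_on_add[OF S smooth_on_bounded_linear[OF this(1) S assms(2)]
      smooth_on_bounded_linear[OF this(2) S assms(3)]]
  show ?thesis by simp
qed

lemma smooth_on_fst: "open S \<Longrightarrow> smooth_on S f \<Longrightarrow> smooth_on S (\<lambda>x. fst (f x))"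
  by (rule smooth_on_bounded_linear[OF bounded_linear_fst])

lemma smooth_on_snd: "open S \<Longrightarrow> smooth_on S f \<Longrightarrow> smooth_on S (\<lambda>x. snd (f x))"
  by (rule smooth_on_bounded_linear[OF bounded_linear_snd])

lemma smooth_on_mult:
  fixes f g :: "'a::real_normed_vector \<Rightarrow> real"
  shows "open S \<Longrightarrow> smooth_on S f \<Longrightarrow> smooth_on S g \<Longrightarrow> smooth_on S (\<lambda>x. f x * g x)"
  by (rule smooth_on_bounded_bilinear[OF bounded_bilinear_mult])

lemma smooth_on_scaleR:
  "open S \<Longrightarrow> smooth_on S f \<Longrightarrow> smooth_on S g \<Longrightarrow> smooth_on S (\<lambda>x. f x *\<^sub>R g x)"
  by (rule smooth_on_bounded_bilinear[OF bounded_bilinear_scaleR])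

lemma smooth_on_minus: "open S \<Longrightarrow> smooth_on S f \<Longrightarrow> smooth_on S (\<lambda>x. - f x)"
  by (rule smooth_on_bounded_linear[OF bounded_linear_minus[OF bounded_linear_ident]])

lemma smooth_on_diff:
  "open S \<Longrightarrow> smooth_on S f \<Longrightarrow> smooth_on S g \<Longrightarrow> smooth_on S (\<lambda>x. f x - g x)"
  using smooth_on_add[OF _ _ smooth_on_minus, of S f g] by simp

lemma smooth_on_differentiable: "smooth_on S f \<Longrightarrow> x \<in> S \<Longrightarrow> f differentiable (at x)"
  unfolding smooth_on_def by (drule spec[of _ "Suc 0"]) simp

lemma smooth_on_derivative:
  "smooth_on S f \<Longrightarrow> smooth_on S (\<lambda>x. fderiv f x v)"
  unfolding smooth_on_def
proof
  fix k assume "\<forall>k. Ck_on k S f"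
  then have "Ck_on (Suc k) S f" ..
  then show "Ck_on k S (\<lambda>x. fderiv f x v)" by simp
qed

lemma smooth_on_continuous: "smooth_on S f \<Longrightarrow> continuous_on S f"
  unfolding smooth_on_def by (drule spec[of _ 0]) simp

lemma smooth_on_has_derivative:
  "smooth_on S f \<Longrightarrow> x \<in> S \<Longrightarrow> (f has_derivative fderiv f x) (at x)"
  by (rule differentiable_has_derivative[OF smooth_on_differentiable])

text \<open>This is the tangent map, with base point and vector both varying. It serves for
  derivatives of inverse maps and for transition functions acting on vector fields.\<close>

lemma Ck_on_derivative_apply:
  fixes f :: "'a::euclidean_space \<Rightarrow> 'b::real_normed_vector"
  assumes T: "open T" and S: "open S" and f: "smooth_on S f"
    and g: "Ck_on k T g" "\<And>y. y \<in> T \<Longrightarrow> g y \<in> S" and w: "Ck_on k T w"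
  shows "Ck_on k T (\<lambda>y. fderiv f (g y) (w y))"
proof (rule Ck_on_cong[OF T])
  have "Ck_on k S (\<lambda>x. fderiv f x v)" for v
    using smooth_on_derivative[OF f] by (simp add: smooth_on_def)
  then show "Ck_on k T (\<lambda>y. \<Sum>b\<in>Basis. (w y \<bullet> b) *\<^sub>R fderiv f (g y) b)"
    by (intro Ck_on_sum[OF T] Ck_on_bounded_bilinear[OF bounded_bilinear_scaleR T]
        Ck_on_bounded_linear[OF bounded_linear_inner_left T w]
        Ck_on_compose[OF T S _ g(1)] g(2))
qed (metis f g(2) linear_frechet_derivative_expand smooth_on_differentiable)

lemma smooth_on_derivative_apply:
  fixes f :: "'a::euclidean_space \<Rightarrow> 'b::real_normed_vector"
  assumes "open T" "open S" "smooth_on S f" "smooth_on T g" "\<And>y. y \<in> T \<Longrightarrow> g y \<in> S" "smooth_on T w"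
  shows "smooth_on T (\<lambda>y. fderiv f (g y) (w y))"
  using assms Ck_on_derivative_apply[of T S f] by (simp add: smooth_on_def)

lemma frechet_derivative_compose_at:
  assumes "g differentiable (at x)" "f differentiable (at (g x))"
  shows "fderiv (\<lambda>x. f (g x)) x =
      (\<lambda>v. fderiv f (g x) (fderiv g x v))"
  by (intro frechet_derivative_eqI
      has_derivative_compose[OF differentiable_has_derivative differentiable_has_derivative] assms)

section \<open>Symmetry of second derivatives\<close>

text \<open>The mean value inequality in direction \<open>u\<close>, applied to the increment of
  \<open>f\<close> in direction \<open>v\<close>, reduces the second difference to values of
  \<open>fderiv f _ u\<close> at two points near \<open>x\<close>, where differentiability at the
  single point \<open>x\<close> gives the estimate.\<close>

lemma second_difference_bound:
  fixes f :: "'a::real_normed_vector \<Rightarrow> 'b::real_normed_vector"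
  assumes S: "open S" "x \<in> S" and f: "\<And>y. y \<in> S \<Longrightarrow> f differentiable (at y)"
    and D: "((\<lambda>y. fderiv f y u) has_derivative D) (at x)" and e: "e > 0"
  shows "\<exists>d>0. \<forall>h. 0 < h \<and> h < d \<longrightarrow>
    norm (f (x + h *\<^sub>R u + h *\<^sub>R v) - f (x + h *\<^sub>R u) - f (x + h *\<^sub>R v) + f x - (h * h) *\<^sub>R D v)
      \<le> e * (h * h)"
proof -
  \<comment> \<open>The two points are at distance at most \<open>h * (norm u + norm v)\<close> and
    \<open>h * norm u\<close> from \<open>x\<close>, so their errors add up to a multiple of
    \<open>2 * norm u + norm v\<close>; the 1 keeps \<open>K\<close> positive for zero
    vectors.\<close>
  define K where "K = 2 * norm u + norm v + 1"
  have K: "K > 0" by (simp add: K_def add_nonneg_pos)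
  interpret D: bounded_linear D using D by (rule has_derivative_bounded_linear)
  obtain r where r: "r > 0" "ball x r \<subseteq> S" using S openE by blast
  have "e / K > 0" using e K by simp
  then obtain d where d: "d > 0" and dist: "\<And>y. norm (y - x) < d \<Longrightarrow>
      norm (fderiv f y u - fderiv f x u - D (y - x)) \<le> e / K * norm (y - x)"
    using D unfolding has_derivative_at_alt by meson
  \<comment> \<open>Division by \<open>K\<close> keeps both points inside the ball contained in
    \<open>S\<close> and inside the range \<open>d\<close> of the estimate.\<close>
  define d' where "d' = min d r / K"
  have "norm (f (x + h *\<^sub>R u + h *\<^sub>R v) - f (x + h *\<^sub>R u) - f (x + h *\<^sub>R v) + f x - (h * h) *\<^sub>R D v)
      \<le> e * (h * h)" if h: "0 < h" "h < d'" for h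
  proof -
    have hK: "h * K < min d r" using h K by (simp add: d'_def field_simps)
    \<comment> \<open>The increment \<open>F h - F 0\<close> is the second difference minus
      \<open>h * h\<close> times \<open>D v\<close>; its integrand is what the fact \<open>G\<close>
      bounds.\<close>
    define F where "F = (\<lambda>s. f (x + s *\<^sub>R u + h *\<^sub>R v) - f (x + s *\<^sub>R u) - s *\<^sub>R h *\<^sub>R D v)"
    define G where "G = (\<lambda>y. fderiv f y u)"
    have nb: "norm (s *\<^sub>R u + h *\<^sub>R v) \<le> h * (norm u + norm v)" "norm (s *\<^sub>R u) \<le> h * norm u"
      if "s \<in> {0..h}" for s
    proof -
      show *: "norm (s *\<^sub>R u) \<le> h * norm u" using that by (auto intro: mult_right_mono)
      show "norm (s *\<^sub>R u + h *\<^sub>R v) \<le> h * (norm u + norm v)"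
        using norm_triangle_ineq[of "s *\<^sub>R u" "h *\<^sub>R v"] * h by (simp add: distrib_left)
    qed
    have le: "h * (norm u + norm v) < min d r" "h * norm u < min d r"
    proof -
      have "h * (norm u + norm v) \<le> h * K" "h * norm u \<le> h * K"
        using h by (auto simp: K_def intro!: mult_left_mono add_nonneg_nonneg)
      with hK show "h * (norm u + norm v) < min d r" "h * norm u < min d r" by linarith+
    qed
    have F: "(F has_derivative (\<lambda>t. t *\<^sub>R (G (x + s *\<^sub>R u + h *\<^sub>R v) - G (x + s *\<^sub>R u) - h *\<^sub>R D v)))
        (at s within {0..h})" if s: "s \<in> {0..h}" for s
    proof -
      have "dist x (x + (s *\<^sub>R u + h *\<^sub>R v)) < r" "dist x (x + s *\<^sub>R u) < r"
        using nb[OF s] le unfolding dist_norm add_diff_cancel_left' norm_minus_commute[of x]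
        by linarith+
      then have in_S: "x + s *\<^sub>R u + h *\<^sub>R v \<in> S" "x + s *\<^sub>R u \<in> S"
        using r(2) by (auto simp: add.assoc)
      have lin: "linear (fderiv f y)" if "y \<in> S" for y
        using f[OF that] linear_frechet_derivative by blast
      have "((\<lambda>s. f (x + s *\<^sub>R u + h *\<^sub>R v)) has_derivative
          (\<lambda>t. fderiv f (x + s *\<^sub>R u + h *\<^sub>R v) (t *\<^sub>R u))) (at s within {0..h})"
        by (rule has_derivative_compose[where f = "\<lambda>s. x + s *\<^sub>R u + h *\<^sub>R v" and g = f])
          (use differentiable_has_derivative[OF f[OF in_S(1)]] in \<open>auto intro!: derivative_eq_intros\<close>)
      moreover have "((\<lambda>s. f (x + s *\<^sub>R u)) has_derivative
          (\<lambda>t. fderiv f (x + s *\<^sub>R u) (t *\<^sub>R u))) (at s within {0..h})"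
        by (rule has_derivative_compose[where f = "\<lambda>s. x + s *\<^sub>R u" and g = f])
          (use differentiable_has_derivative[OF f[OF in_S(2)]] in \<open>auto intro!: derivative_eq_intros\<close>)
      ultimately show ?thesis
        unfolding F_def G_def linear_scale[OF lin[OF in_S(1)]] linear_scale[OF lin[OF in_S(2)]]
        by (auto intro!: derivative_eq_intros simp: algebra_simps)
    qed
    have alg: "q * (h * (a + b)) + q * (h * a) = q * h * (2 * a + b)" for q a b :: real by algebra
    have G: "norm (G (x + s *\<^sub>R u + h *\<^sub>R v) - G (x + s *\<^sub>R u) - h *\<^sub>R D v) \<le> e * h"
      if s: "s \<in> {0..h}" for s
    proof -
      have "norm (G (x + s *\<^sub>R u + h *\<^sub>R v) - G x - D (s *\<^sub>R u + h *\<^sub>R v)) \<le> e / K * norm (s *\<^sub>R u + h *\<^sub>R v)"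
        using dist[of "x + s *\<^sub>R u + h *\<^sub>R v"] nb[OF s] le by (simp add: G_def add.assoc)
      also have "\<dots> \<le> e / K * (h * (norm u + norm v))"
        using nb[OF s] e K by (intro mult_left_mono) auto
      finally have 1: "norm (G (x + s *\<^sub>R u + h *\<^sub>R v) - G x - D (s *\<^sub>R u + h *\<^sub>R v)) \<le> e / K * (h * (norm u + norm v))" .
      have "norm (G (x + s *\<^sub>R u) - G x - D (s *\<^sub>R u)) \<le> e / K * norm (s *\<^sub>R u)"
        using dist[of "x + s *\<^sub>R u"] nb[OF s] le by (simp add: G_def)
      also have "\<dots> \<le> e / K * (h * norm u)"
        using nb[OF s] e K by (intro mult_left_mono) auto
      finally have 2: "norm (G (x + s *\<^sub>R u) - G x - D (s *\<^sub>R u)) \<le> e / K * (h * norm u)" .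
      have "norm (G (x + s *\<^sub>R u + h *\<^sub>R v) - G (x + s *\<^sub>R u) - h *\<^sub>R D v)
          = norm ((G (x + s *\<^sub>R u + h *\<^sub>R v) - G x - D (s *\<^sub>R u + h *\<^sub>R v)) - (G (x + s *\<^sub>R u) - G x - D (s *\<^sub>R u)))"
        by (simp add: D.add D.scaleR algebra_simps)
      also have "\<dots> \<le> e / K * (h * (norm u + norm v)) + e / K * (h * norm u)"
        by (rule order_trans[OF norm_triangle_ineq4 add_mono[OF 1 2]])
      also have "\<dots> = e / K * h * (2 * norm u + norm v)" by (rule alg)
      also have "\<dots> \<le> e / K * h * K" using e h K by (intro mult_left_mono) (auto simp: K_def)
      also have "\<dots> = e * h" using K by simp
      finally show ?thesis .
    qed
    have "norm (F h - F 0) \<le> (e * h) * norm (h - 0)"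
    proof (rule differentiable_bound[OF _ F])
      fix s assume s: "s \<in> {0..h}"
      show "onorm (\<lambda>t. t *\<^sub>R (G (x + s *\<^sub>R u + h *\<^sub>R v) - G (x + s *\<^sub>R u) - h *\<^sub>R D v)) \<le> e * h"
        using G[OF s] e h
        by (intro onorm_bound) (auto simp: mult.commute[of "e * h"] intro!: mult_left_mono)
    qed (use h in auto)
    then show ?thesis using h by (simp add: F_def algebra_simps)
  qed
  moreover have "d' > 0" using d r K by (simp add: d'_def)
  ultimately show ?thesis by blast
qed

text \<open>The second difference is symmetric in \<open>u\<close> and \<open>v\<close>, and it is
  approximated both by \<open>h * h\<close> times \<open>A v\<close> and by \<open>h * h\<close>
  times \<open>B u\<close>.\<close>

lemma second_derivative_symmetric:
  fixes f :: "'a::real_normed_vector \<Rightarrow> 'b::real_normed_vector"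
  assumes S: "open S" "x \<in> S" and f: "\<And>y. y \<in> S \<Longrightarrow> f differentiable (at y)"
    and A: "((\<lambda>y. fderiv f y u) has_derivative A) (at x)"
    and B: "((\<lambda>y. fderiv f y v) has_derivative B) (at x)"
  shows "A v = B u"
proof (rule ccontr)
  assume "A v \<noteq> B u"
  \<comment> \<open>Two errors of size \<open>e\<close> cannot bridge a gap of
    \<open>3 * e\<close>.\<close>
  define e where "e = norm (A v - B u) / 3"
  have e: "e > 0" using \<open>A v \<noteq> B u\<close> by (simp add: e_def)
  from second_difference_bound[OF S f A e, of v] second_difference_bound[OF S f B e, of u]
  obtain c d where "c > 0" "d > 0" and cd: "\<And>h. 0 < h \<Longrightarrow> h < c \<Longrightarrow>
    norm (f (x + h *\<^sub>R u + h *\<^sub>R v) - f (x + h *\<^sub>R u) - f (x + h *\<^sub>R v) + f x - (h * h) *\<^sub>R A v) \<le> e * (h * h)"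
    "\<And>h. 0 < h \<Longrightarrow> h < d \<Longrightarrow>
    norm (f (x + h *\<^sub>R v + h *\<^sub>R u) - f (x + h *\<^sub>R v) - f (x + h *\<^sub>R u) + f x - (h * h) *\<^sub>R B u) \<le> e * (h * h)"
    by blast
  define h where "h = min c d / 2"
  have h: "h > 0" "h < c" "h < d" using \<open>c > 0\<close> \<open>d > 0\<close> by (auto simp: h_def)
  let ?Q = "f (x + h *\<^sub>R u + h *\<^sub>R v) - f (x + h *\<^sub>R u) - f (x + h *\<^sub>R v) + f x"
  have Q: "f (x + h *\<^sub>R v + h *\<^sub>R u) - f (x + h *\<^sub>R v) - f (x + h *\<^sub>R u) + f x = ?Q"
    by (simp add: add.commute add.left_commute)
  have "norm ((?Q - (h * h) *\<^sub>R B u) - (?Q - (h * h) *\<^sub>R A v)) \<le> e * (h * h) + e * (h * h)"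
    using order_trans[OF norm_triangle_ineq4 add_mono[OF cd(2)[OF h(1,3)] cd(1)[OF h(1,2)]]]
    unfolding Q .
  also have "(?Q - (h * h) *\<^sub>R B u) - (?Q - (h * h) *\<^sub>R A v) = (h * h) *\<^sub>R (A v - B u)"
    by (simp add: algebra_simps)
  finally have "(h * h) * norm (A v - B u) \<le> (h * h) * (2 * e)" by (simp add: algebra_simps flip: scaleR_diff_right)
  then have "norm (A v - B u) \<le> 2 * e" using h by simp
  then show False using e by (simp add: e_def)
qed

lemma smooth_second_derivative_symmetric:
  assumes "open S" "smooth_on S f" "x \<in> S"
  shows "fderiv (\<lambda>y. fderiv f y u) x v =
      fderiv (\<lambda>y. fderiv f y v) x u"
  using second_derivative_symmetric[OF assms(1,3) smooth_on_differentiable[OF assms(2)]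
      smooth_on_has_derivative[OF smooth_on_derivative[OF assms(2)] assms(3)]
      smooth_on_has_derivative[OF smooth_on_derivative[OF assms(2)] assms(3)]] .

section \<open>Smoothness of inverse maps\<close>

text \<open>Invariance of domain makes the image of \<open>U\<close> open and \<open>g\<close>
  continuous on it. Source and target being the same space, a left inverse of the injective
  derivative is two-sided.\<close>

lemma has_derivative_inverse_map:
  fixes f g :: "'a::euclidean_space \<Rightarrow> 'a"
  assumes U: "open U" and f: "smooth_on U f" and gf: "\<And>x. x \<in> U \<Longrightarrow> g (f x) = x"
    and inj: "inj (fderiv f x)" and x: "x \<in> U"
  shows "(g has_derivative inv (fderiv f x)) (at (f x))"
proof -
  have injf: "inj_on f U" using gf by (metis inj_onI)
  have cont: "continuous_on U f" by (rule smooth_on_continuous[OF f])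
  have lin: "linear (fderiv f x)"
    by (rule linear_frechet_derivative[OF smooth_on_differentiable[OF f x]])
  obtain f' where f': "linear f'" "f' \<circ> fderiv f x = id"
    using linear_injective_left_inverse[OF lin inj] by blast
  have "inv (fderiv f x) = f'"
    using f'(2) linear_injective_imp_surjective[OF lin inj]
    by (metis surj_iff comp_assoc id_comp comp_id)
  then show ?thesis
    using has_derivative_inverse_dieudonne[OF U invariance_of_domain[OF cont U injf] cont
        continuous_on_inverse_open[OF U cont] gf x smooth_on_has_derivative[OF f x]] f' gf
    by (simp add: linear_conv_bounded_linear)
qed

text \<open>A bootstrap: the derivative of \<open>g\<close> is \<open>G y\<close>, the inverse of
  \<open>fderiv f (g y)\<close>, and differentiating \<open>fderiv f (g y) (G y v) = v\<close>
  expresses the derivative of \<open>G\<close> through \<open>g\<close>, \<open>G\<close> and second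
  derivatives of \<open>f\<close>. So \<open>g\<close> and \<open>G\<close> gain orders together,
  once \<open>G\<close> is known to be differentiable at all.\<close>

lemma smooth_on_inverse_map:
  fixes f g :: "'a::euclidean_space \<Rightarrow> 'a"
  assumes U: "open U" and f: "smooth_on U f" and gf: "\<And>x. x \<in> U \<Longrightarrow> g (f x) = x"
    and inj: "\<And>x. x \<in> U \<Longrightarrow> inj (fderiv f x)"
  shows "smooth_on (f ` U) g"
proof -
  let ?V = "f ` U"
  let ?D = "\<lambda>x. fderiv f x"
  define G where "G = (\<lambda>y. inv (?D (g y)))"
  have V: "open ?V"
    using invariance_of_domain[OF smooth_on_continuous[OF f] U] gf by (metis inj_onI)
  have gU: "g y \<in> U" "f (g y) = y" if "y \<in> ?V" for y using that gf by auto
  have g_deriv: "(g has_derivative G y) (at y)" if "y \<in> ?V" for y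
    using has_derivative_inverse_map[OF U f gf inj[OF gU(1)[OF that]] gU(1)[OF that]] gU[OF that]
    by (simp add: G_def)
  have linD: "linear (?D x)" if "x \<in> U" for x
    by (rule linear_frechet_derivative[OF smooth_on_differentiable[OF f that]])
  have surjD: "surj (?D x)" if "x \<in> U" for x
    by (rule linear_injective_imp_surjective[OF linD[OF that] inj[OF that] refl])
  have DG: "?D (g y) (G y v) = v" if "y \<in> ?V" for y v
    using surjD[OF gU(1)[OF that]] by (simp add: G_def surj_f_inv_f)
  have GD: "G y (?D (g y) v) = v" if "y \<in> ?V" for y v
    using inj[OF gU(1)[OF that]] by (simp add: G_def)
  \<comment> \<open>The tangent map of \<open>f\<close> is again smooth with injective derivative; the second component of its
    inverse is the derivative of \<open>g\<close>, which is therefore differentiable.\<close>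
  define F where "F = (\<lambda>p. (f (fst p), ?D (fst p) (snd p)))"
  have UU: "open (U \<times> (UNIV :: 'a set))" using U by (simp add: open_Times)
  have F: "smooth_on (U \<times> UNIV) F"
    unfolding F_def
    by (intro smooth_on_Pair[OF UU] smooth_on_compose[OF UU U _ _ f] smooth_on_derivative_apply[OF UU U f]
        smooth_on_linear bounded_linear_fst bounded_linear_snd) auto
  \<comment> \<open>The derivative of the tangent map is block triangular with \<open>?D x\<close>
    twice on the diagonal; the off-diagonal block is never computed.\<close>
  have injF: "inj (fderiv F (x, w))" if x: "x \<in> U" for x w
  proof -
    have xw: "(x, w) \<in> U \<times> UNIV" using x by simp
    have dF: "(F has_derivative fderiv F (x, w)) (at (x, w))"
      by (rule smooth_on_has_derivative[OF F xw])
    have "((\<lambda>p. fst (F p)) has_derivative (\<lambda>q. fst (fderiv F (x, w) q))) (at (x, w))"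
      by (intro has_derivative_fst dF)
    moreover have "((\<lambda>p. fst (F p)) has_derivative (\<lambda>q. ?D x (fst q))) (at (x, w))"
      unfolding F_def fst_conv
      by (rule has_derivative_compose[where f = fst and g = f])
        (use smooth_on_has_derivative[OF f x] in \<open>auto intro: derivative_intros\<close>)
    ultimately have 1: "fst (fderiv F (x, w) q) = ?D x (fst q)" for q
      by (rule fun_cong[OF has_derivative_unique])
    have "((\<lambda>b. F (x, w + b)) has_derivative (\<lambda>b. fderiv F (x, w) (0, b))) (at 0)"
      by (rule has_derivative_compose[where g = F and f = "\<lambda>b. (x, w + b)"])
        (use dF in \<open>auto intro!: derivative_eq_intros\<close>)
    moreover have "((\<lambda>b. F (x, w + b)) has_derivative (\<lambda>b. (0, ?D x b))) (at 0)"
      using linD[OF x]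
      by (auto simp: F_def linear_add linear_conv_bounded_linear
          intro!: derivative_eq_intros has_derivative_Pair bounded_linear_imp_has_derivative)
    ultimately have 2: "fderiv F (x, w) (0, b) = (0, ?D x b)" for b
      by (rule fun_cong[OF has_derivative_unique])
    have "q = 0" if "fderiv F (x, w) q = 0" for q
    proof -
      have "fst q = 0" using 1[of q] that inj[OF x] linD[OF x]
        by (metis fst_zero linear_injective_0)
      moreover from this have "snd q = 0" using 2[of "snd q"] that inj[OF x] linD[OF x]
        by (metis linear_injective_0 prod.collapse snd_conv snd_zero)
      ultimately show ?thesis by (simp add: prod_eq_iff)
    qed
    then show ?thesis
      using linear_injective_0[OF linear_frechet_derivative[OF smooth_on_differentiable[OF F xw]]] by blast
  qed
  define K where "K = (\<lambda>(y, v). (g y, G y v))"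
  have KF: "K (F p) = p" if "p \<in> U \<times> UNIV" for p
    using that GD[of "f (fst p)" "snd p"] by (auto simp: K_def F_def gf)
  have G_diff: "(\<lambda>y. G y v) differentiable (at y)" if y: "y \<in> ?V" for y v
  proof -
    have "(K has_derivative inv (fderiv F (g y, G y v))) (at (F (g y, G y v)))"
      using gU(1)[OF y] by (intro has_derivative_inverse_map[OF UU F KF injF]) auto
    then have "K differentiable (at (y, v))"
      using gU[OF y] DG[OF y] by (auto simp: F_def differentiable_def)
    then obtain K' where "(K has_derivative K') (at (y, v))" by (auto simp: differentiable_def)
    then have "((\<lambda>y. snd (K (y, v))) has_derivative (\<lambda>w. snd (K' (w, 0)))) (at y)"
      by (intro has_derivative_snd has_derivative_compose[where f = "\<lambda>y. (y, v)" and g = K])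
        (auto intro!: derivative_eq_intros)
    then show ?thesis by (auto simp: K_def differentiable_def)
  qed
  \<comment> \<open>The second derivative of \<open>f\<close> at \<open>g y\<close> in the
    directions \<open>G y w\<close> and \<open>G y v\<close>: the contribution of the moving base
    point when \<open>?D (g z) (G z v) = v\<close> is differentiated.\<close>
  define H where "H = (\<lambda>v w y. \<Sum>b\<in>Basis. (G y v \<bullet> b) *\<^sub>R
      fderiv (\<lambda>x. ?D x b) (g y) (G y w))"
  have G_deriv: "fderiv (\<lambda>y. G y v) y w = - (\<Sum>c\<in>Basis. (H v w y \<bullet> c) *\<^sub>R G y c)"
    if y: "y \<in> ?V" for y v w
  proof -
    let ?G' = "fderiv (\<lambda>y. G y v) y"
    have expand: "v = (\<Sum>b\<in>Basis. (G z v \<bullet> b) *\<^sub>R ?D (g z) b)" if "z \<in> ?V" for z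
      using DG[OF that, of v] linear_frechet_derivative_expand[OF smooth_on_differentiable[OF f gU(1)[OF that]]]
      by metis
    have "((\<lambda>z. \<Sum>b\<in>Basis. (G z v \<bullet> b) *\<^sub>R ?D (g z) b) has_derivative
        (\<lambda>w. \<Sum>b\<in>Basis. (G y v \<bullet> b) *\<^sub>R fderiv (\<lambda>x. ?D x b) (g y) (G y w)
          + (?G' w \<bullet> b) *\<^sub>R ?D (g y) b)) (at y)"
      by (intro has_derivative_sum has_derivative_scaleR has_derivative_inner_left
          differentiable_has_derivative[OF G_diff[OF y]]
          has_derivative_compose[OF g_deriv[OF y] smooth_on_has_derivative[OF smooth_on_derivative[OF f] gU(1)[OF y]]])
    moreover have "((\<lambda>z. \<Sum>b\<in>Basis. (G z v \<bullet> b) *\<^sub>R ?D (g z) b) has_derivative (\<lambda>w. 0)) (at y)"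
      using has_derivative_at_cong[OF V y, of "\<lambda>z. v" "\<lambda>z. \<Sum>b\<in>Basis. (G z v \<bullet> b) *\<^sub>R ?D (g z) b" "\<lambda>w. 0"]
        expand by simp
    ultimately have "(\<Sum>b\<in>Basis. (G y v \<bullet> b) *\<^sub>R fderiv (\<lambda>x. ?D x b) (g y) (G y w)
          + (?G' w \<bullet> b) *\<^sub>R ?D (g y) b) = 0"
      by (rule fun_cong[OF has_derivative_unique])
    then have "H v w y + ?D (g y) (?G' w) = 0"
      by (simp add: H_def sum.distrib
          flip: linear_frechet_derivative_expand[OF smooth_on_differentiable[OF f gU(1)[OF y]]])
    then have "?D (g y) (?G' w) = ?D (g y) (- G y (H v w y))"
      using DG[OF y] linear_neg[OF linD[OF gU(1)[OF y]]] by (metis add_eq_0_iff)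
    then have "?G' w = - G y (H v w y)"
      using inj[OF gU(1)[OF y]] by (simp add: inj_eq)
    moreover have "linear (G y)"
      using g_deriv[OF y] has_derivative_linear by blast
    then have "G y (H v w y) = (\<Sum>c\<in>Basis. (H v w y \<bullet> c) *\<^sub>R G y c)"
      by (subst euclidean_representation[of "H v w y", symmetric]) (simp add: linear_sum linear_scale)
    ultimately show ?thesis by simp
  qed
  have "Ck_on k ?V g \<and> (\<forall>v. Ck_on k ?V (\<lambda>y. G y v))" for k
  proof (induction k)
    case 0
    show ?case
      using differentiableI[OF g_deriv] G_diff
      by (auto intro!: continuous_at_imp_continuous_on differentiable_imp_continuous_within)
  next
    case (Suc k)
    have "Ck_on (Suc k) ?V g"
    proof -
      have "Ck_on k ?V (\<lambda>y. fderiv g y v)" for v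
        by (rule Ck_on_cong[OF V, of k "\<lambda>y. G y v"])
          (use Suc frechet_derivative_eqI[OF g_deriv] in auto)
      then show ?thesis using g_deriv by (auto simp: differentiable_def)
    qed
    moreover have "Ck_on (Suc k) ?V (\<lambda>y. G y v)" for v
    proof -
      have "Ck_on k ?V (H v w)" for w
        unfolding H_def using Suc gU(1)
        by (intro Ck_on_sum[OF V] Ck_on_bounded_bilinear[OF bounded_bilinear_scaleR V]
            Ck_on_bounded_linear[OF bounded_linear_inner_left V]
            Ck_on_derivative_apply[OF V U smooth_on_derivative[OF f]]) auto
      then have "Ck_on k ?V (\<lambda>y. - (\<Sum>c\<in>Basis. (H v w y \<bullet> c) *\<^sub>R G y c))" for w
        using Suc
        by (intro Ck_on_bounded_linear[OF bounded_linear_minus[OF bounded_linear_ident] V] Ck_on_sum[OF V]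
            Ck_on_bounded_bilinear[OF bounded_bilinear_scaleR V]
            Ck_on_bounded_linear[OF bounded_linear_inner_left V]) auto
      then have "Ck_on k ?V (\<lambda>y. fderiv (\<lambda>y. G y v) y w)" for w
        by (rule Ck_on_cong[OF V]) (simp add: G_deriv)
      then show ?thesis using G_diff by simp
    qed
    ultimately show ?case by blast
  qed
  then show ?thesis by (simp add: smooth_on_def)
qed

section \<open>Charts and tangent vectors\<close>

text \<open>The part of \<open>smooth_manifold\<close> that concerns the charts. It is established
  for the pseudosphere and for the quotient too, so one calculus serves all three manifolds.\<close>

definition smooth_atlas :: "('m, 'e::real_normed_vector) manifold \<Rightarrow> bool" where
  "smooth_atlas M \<longleftrightarrow> (\<forall>c\<in>atlas M. is_chart (mtop M) c) \<and> (\<Union>c\<in>atlas M. fst c) = points M \<and>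
     (\<forall>c\<in>atlas M. \<forall>d\<in>atlas M. smooth_on (snd c ` (fst c \<inter> fst d)) (snd d \<circ> chart_inv c))"

lemma smooth_manifold_imp_smooth_atlas: "smooth_manifold M \<Longrightarrow> smooth_atlas M"
  by (simp add: smooth_manifold_def smooth_atlas_def)

context
  fixes T :: "'m topology" and c :: "('m, 'e::real_normed_vector) chart"
  assumes c: "is_chart T c"
begin

lemma chart_domain_subset: "fst c \<subseteq> topspace T"
  using c openin_subset by (auto simp: is_chart_def)

lemma chart_inj: "inj_on (snd c) (fst c)"
  using c chart_domain_subset
  by (auto simp: is_chart_def homeomorphic_eq_everything_map topspace_subtopology Int_absorb1)

lemma chart_inv_left: "p \<in> fst c \<Longrightarrow> chart_inv c (snd c p) = p"
  unfolding chart_inv_def using chart_inj by simp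

lemma chart_inv_right: "y \<in> snd c ` fst c \<Longrightarrow> snd c (chart_inv c y) = y"
  unfolding chart_inv_def by (rule f_inv_into_f)

lemma chart_inv_in: "y \<in> snd c ` fst c \<Longrightarrow> chart_inv c y \<in> fst c"
  unfolding chart_inv_def by (rule inv_into_into)

lemma open_chart_range: "open (snd c ` fst c)"
  using c by (simp add: is_chart_def)

lemma open_chart_image:
  assumes "openin T U"
  shows "open (snd c ` (fst c \<inter> U))"
proof -
  have "open_map (subtopology T (fst c)) (top_of_set (snd c ` fst c)) (snd c)"
    using c homeomorphic_imp_open_map by (auto simp: is_chart_def)
  moreover have "openin (subtopology T (fst c)) (fst c \<inter> U)"
    using assms by (rule openin_subtopology_Int2)
  ultimately have "openin (top_of_set (snd c ` fst c)) (snd c ` (fst c \<inter> U))"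
    by (simp add: open_map_def)
  then show ?thesis using open_chart_range openin_open_trans by blast
qed

end

lemma is_chartI:
  assumes "openin T U" "open (\<kappa> ` U)" "continuous_map (subtopology T U) euclidean \<kappa>"
    and "continuous_map (top_of_set (\<kappa> ` U)) T \<phi>" "\<And>p. p \<in> U \<Longrightarrow> \<phi> (\<kappa> p) = p"
  shows "is_chart T (U, \<kappa>)"
proof -
  have U: "topspace T \<inter> U = U" using openin_subset[OF assms(1)] by auto
  have "homeomorphic_maps (subtopology T U) (top_of_set (\<kappa> ` U)) \<kappa> \<phi>"
    using assms(3-5) U
    by (auto simp: homeomorphic_maps_def continuous_map_in_subtopology)
  then show ?thesis
    using assms(1,2) by (auto simp: is_chart_def homeomorphic_map_maps)
qed

lemma chart_at_in_charts_at:
  assumes "smooth_atlas M" "p \<in> points M"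
  shows "chart_at M p \<in> charts_at M p"
proof -
  have "p \<in> (\<Union>c\<in>atlas M. fst c)" using assms by (simp add: smooth_atlas_def)
  then have "\<exists>c. c \<in> charts_at M p" by (auto simp: charts_at_def)
  then show ?thesis unfolding chart_at_def by (rule someI_ex)
qed

lemma charts_atD:
  assumes "smooth_atlas M" "c \<in> charts_at M p"
  shows "c \<in> atlas M" "is_chart (mtop M) c" "p \<in> fst c" "p \<in> points M" "snd c p \<in> snd c ` fst c"
  using assms by (auto simp: smooth_atlas_def charts_at_def)

section \<open>Tangent vectors and derivatives of functions in a chart\<close>

context
  fixes M :: "('m, 'e::euclidean_space) manifold"
  assumes M: "smooth_atlas M"
begin

lemma atlas_chart: "c \<in> atlas M \<Longrightarrow> is_chart (mtop M) c"
  using M by (simp add: smooth_atlas_def)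

lemma transition_smooth:
  assumes "c \<in> atlas M" "d \<in> atlas M"
  shows "open (snd c ` (fst c \<inter> fst d))" "smooth_on (snd c ` (fst c \<inter> fst d)) (snd d \<circ> chart_inv c)"
proof -
  show "open (snd c ` (fst c \<inter> fst d))"
    using open_chart_image[OF atlas_chart[OF assms(1)]] atlas_chart[OF assms(2)]
    by (auto simp: is_chart_def)
  show "smooth_on (snd c ` (fst c \<inter> fst d)) (snd d \<circ> chart_inv c)"
    using M assms by (auto simp: smooth_atlas_def)
qed

lemma transition_has_derivative:
  assumes "c \<in> charts_at M p" "d \<in> charts_at M p"
  shows "((snd d \<circ> chart_inv c) has_derivative dtransition c d p) (at (snd c p))"
  unfolding dtransition_def
  using transition_smooth(2)[of c d] assms
  by (intro smooth_on_has_derivative) (auto simp: charts_at_def)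

lemma has_derivative_change_chart:
  assumes c: "c \<in> charts_at M p" and d: "d \<in> charts_at M p"
    and F: "((F \<circ> chart_inv c) has_derivative F') (at (snd c p))"
  shows "((F \<circ> chart_inv d) has_derivative (\<lambda>v. F' (dtransition d c p v))) (at (snd d p))"
proof -
  note c' = charts_atD[OF M c] and d' = charts_atD[OF M d]
  have "((\<lambda>y. (F \<circ> chart_inv c) ((snd c \<circ> chart_inv d) y)) has_derivative
      (\<lambda>v. F' (dtransition d c p v))) (at (snd d p))"
    using F c' d' by (intro has_derivative_compose[OF transition_has_derivative[OF d c]])
      (simp add: chart_inv_left comp_def)
  then show ?thesis
  proof (rule has_derivative_transform_within_open)
    show "open (snd d ` (fst d \<inter> fst c))" using transition_smooth c' d' by blast
    show "snd d p \<in> snd d ` (fst d \<inter> fst c)" using c' d' by auto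
  qed (use c' d' in \<open>auto simp: chart_inv_left\<close>)
qed

lemma dtransition_trans:
  assumes c: "c \<in> charts_at M p" and d: "d \<in> charts_at M p" and e: "e \<in> charts_at M p"
  shows "dtransition d e p (dtransition c d p v) = dtransition c e p v"
  using has_derivative_unique[OF has_derivative_change_chart[OF d c transition_has_derivative[OF d e]]
      transition_has_derivative[OF c e]] by (rule fun_cong)

lemma dtransition_same:
  assumes c: "c \<in> charts_at M p"
  shows "dtransition c c p v = v"
proof -
  note c' = charts_atD[OF M c]
  have "((\<lambda>y. y) has_derivative dtransition c c p) (at (snd c p))"
    by (rule has_derivative_transform_within_open[OF transition_has_derivative[OF c c]
          open_chart_range[OF c'(2)] c'(5)]) (simp add: chart_inv_right[OF c'(2)])
  then show ?thesis using has_derivative_unique[OF has_derivative_ident] by metis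
qed

lemma linear_dtransition:
  assumes "c \<in> charts_at M p" "d \<in> charts_at M p"
  shows "linear (dtransition c d p)"
  using has_derivative_linear[OF transition_has_derivative[OF assms]] .

lemma tangent_spaceI:
  "(\<And>c d. c \<in> charts_at M p \<Longrightarrow> d \<in> charts_at M p \<Longrightarrow> X d = dtransition c d p (X c)) \<Longrightarrow>
    (\<And>c. c \<notin> charts_at M p \<Longrightarrow> X c = 0) \<Longrightarrow> X \<in> tangent_space M p"
  unfolding tangent_space_def by blast

lemma tangent_transition:
  "X \<in> tangent_space M p \<Longrightarrow> c \<in> charts_at M p \<Longrightarrow> d \<in> charts_at M p \<Longrightarrow> X d = dtransition c d p (X c)"
  unfolding tangent_space_def by blast

lemma tangent_outside: "X \<in> tangent_space M p \<Longrightarrow> c \<notin> charts_at M p \<Longrightarrow> X c = 0"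
  unfolding tangent_space_def by blast

lemma coord_vec_tangent: "c \<in> charts_at M p \<Longrightarrow> coord_vec M c p u \<in> tangent_space M p"
  by (rule tangent_spaceI) (simp_all add: coord_vec_def dtransition_trans)

lemma coord_vec_same: "c \<in> charts_at M p \<Longrightarrow> coord_vec M c p u c = u"
  by (simp add: coord_vec_def dtransition_same)

lemma tangent_eqI:
  assumes "X \<in> tangent_space M p" "Y \<in> tangent_space M p" "c \<in> charts_at M p" "X c = Y c"
  shows "X = Y"
proof
  fix d show "X d = Y d"
    using assms(4) tangent_transition[OF assms(1,3), of d] tangent_transition[OF assms(2,3), of d]
      tangent_outside[OF assms(1), of d] tangent_outside[OF assms(2), of d]
    by (cases "d \<in> charts_at M p") auto
qed

lemma coord_vec_of_tangent:
  assumes "X \<in> tangent_space M p" "c \<in> charts_at M p"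
  shows "coord_vec M c p (X c) = X"
  by (rule tangent_eqI[OF coord_vec_tangent[OF assms(2)] assms coord_vec_same[OF assms(2)]])

lemma tangent_zero: "(\<lambda>_. 0) \<in> tangent_space M p"
  by (rule tangent_spaceI) (simp_all add: linear_0[OF linear_dtransition])

lemma tangent_add:
  assumes "X \<in> tangent_space M p" "Y \<in> tangent_space M p"
  shows "(\<lambda>d. X d + Y d) \<in> tangent_space M p"
proof (rule tangent_spaceI)
  fix c d assume cd: "c \<in> charts_at M p" "d \<in> charts_at M p"
  show "X d + Y d = dtransition c d p (X c + Y c)"
    unfolding linear_add[OF linear_dtransition[OF cd]]
    by (intro arg_cong2[where f = "(+)"] tangent_transition assms cd)
qed (simp add: tangent_outside[OF assms(1)] tangent_outside[OF assms(2)])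

lemma tangent_scale:
  assumes "X \<in> tangent_space M p"
  shows "(\<lambda>d. a *\<^sub>R X d) \<in> tangent_space M p"
proof (rule tangent_spaceI)
  fix c d assume cd: "c \<in> charts_at M p" "d \<in> charts_at M p"
  show "a *\<^sub>R X d = dtransition c d p (a *\<^sub>R X c)"
    unfolding linear_scale[OF linear_dtransition[OF cd]]
    by (intro arg_cong2[where f = "(*\<^sub>R)"] tangent_transition assms cd refl)
qed (simp add: tangent_outside[OF assms])

text \<open>This frees \<open>vdifferential\<close> from the arbitrary chart
  \<open>chart_at\<close>: the chain rule absorbs the transition, so any chart around the point
  computes it.\<close>

lemma vdifferential_has_derivative:
  assumes c: "c \<in> charts_at M p" and X: "X \<in> tangent_space M p"
    and F: "((F \<circ> chart_inv c) has_derivative F') (at (snd c p))"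
  shows "vdifferential M F p X = F' (X c)"
proof -
  let ?d = "chart_at M p"
  have d: "?d \<in> charts_at M p"
    using chart_at_in_charts_at[OF M] charts_atD[OF M c] by blast
  have "fderiv (F \<circ> chart_inv ?d) (snd ?d p) = (\<lambda>v. F' (dtransition ?d c p v))"
    by (rule frechet_derivative_eqI[OF has_derivative_change_chart[OF c d F]])
  then show ?thesis
    using tangent_transition[OF X d c] by (simp add: vdifferential_def Let_def)
qed

lemma vdifferential_smooth:
  assumes "c \<in> charts_at M p" "X \<in> tangent_space M p" "smooth_on W (F \<circ> chart_inv c)" "snd c p \<in> W"
  shows "vdifferential M F p X = fderiv (F \<circ> chart_inv c) (snd c p) (X c)"
  by (rule vdifferential_has_derivative[OF assms(1,2) smooth_on_has_derivative[OF assms(3,4)]])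

text \<open>The structure equations speak only of smooth fields on open sets; the fields with
  constant coefficients in a chart are those to which they will be applied.\<close>

lemma vector_field_coord_vec:
  assumes c: "c \<in> atlas M"
  shows "vector_field M (fst c) (\<lambda>q. coord_vec M c q u)"
  unfolding vector_field_def
proof (intro conjI ballI)
  show "coord_vec M c q u \<in> tangent_space M q" if "q \<in> fst c" for q
    using c that coord_vec_tangent by (simp add: charts_at_def)
next
  fix d assume d: "d \<in> atlas M"
  note cd = transition_smooth[OF c d] and dc = transition_smooth[OF d c]
  note cc = atlas_chart[OF c] and dd = atlas_chart[OF d]
  let ?W = "snd d ` (fst d \<inter> fst c)"
  have "smooth_on ?W (\<lambda>y. fderiv (snd d \<circ> chart_inv c) ((snd c \<circ> chart_inv d) y) u)"
    by (rule smooth_on_derivative_apply[OF dc(1) cd dc(2) _ smooth_on_const])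
      (auto simp: chart_inv_left[OF dd])
  then have "smooth_on ?W (\<lambda>y. coord_vec M c (chart_inv d y) u d)"
    by (rule smooth_on_cong[OF dc(1)])
      (use d in \<open>auto simp: coord_vec_def dtransition_def charts_at_def chart_inv_left[OF dd]\<close>)
  then show "smooth_on (snd d ` (fst c \<inter> fst d)) (\<lambda>y. coord_vec M c (chart_inv d y) u d)"
    by (simp add: Int_commute)
qed

text \<open>Constant coefficients contribute no derivatives of their own, so an iterated
  differential is a plain second derivative in the chart.\<close>

lemma vdifferential_coord_vec:
  assumes c: "c \<in> charts_at M p" and X: "X \<in> tangent_space M p"
    and W: "open W" "W \<subseteq> snd c ` fst c" "snd c p \<in> W" and F: "smooth_on W (F \<circ> chart_inv c)"
    and G: "\<And>q. q \<in> fst c \<Longrightarrow> snd c q \<in> W \<Longrightarrow> G q = vdifferential M F q (coord_vec M c q u)"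
  shows "vdifferential M G p X =
      fderiv (\<lambda>y. fderiv (F \<circ> chart_inv c) y u) (snd c p) (X c)"
proof (rule vdifferential_has_derivative[OF c X])
  note c' = charts_atD[OF M c]
  have "fderiv (F \<circ> chart_inv c) y u = (G \<circ> chart_inv c) y" if y: "y \<in> W" for y
  proof -
    have q: "chart_inv c y \<in> fst c" "snd c (chart_inv c y) = y"
      using y W(2) chart_inv_in[OF c'(2)] chart_inv_right[OF c'(2)] by blast+
    then have cq: "c \<in> charts_at M (chart_inv c y)" using c' by (simp add: charts_at_def)
    show ?thesis
      using G[OF q(1)] y vdifferential_smooth[OF cq coord_vec_tangent[OF cq] F] q
      by (simp add: coord_vec_same[OF cq])
  qed
  from has_derivative_transform_within_open[OF smooth_on_has_derivative[OF smooth_on_derivative[OF F] W(3)] W(1,3) this]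
  show "((G \<circ> chart_inv c) has_derivative fderiv (\<lambda>y. fderiv (F \<circ> chart_inv c) y u)
      (snd c p)) (at (snd c p))" by (simp add: comp_def)
qed

end

section \<open>Smooth maps between manifolds and the chain rule\<close>

context
  fixes M :: "('m, 'e::euclidean_space) manifold" and N :: "('p, 'd::euclidean_space) manifold"
    and F :: "'m \<Rightarrow> 'p"
  assumes M: "smooth_atlas M" and N: "smooth_atlas N" and F: "smooth_map M N F"
begin

lemma smooth_map_point: "p \<in> points M \<Longrightarrow> F p \<in> points N"
  using F by (auto simp: smooth_map_def continuous_map_def)

lemma smooth_map_chart_rep:
  assumes c: "c \<in> atlas M" and d: "d \<in> atlas N"
  shows "open (snd c ` (fst c \<inter> F -` fst d))"
    and "smooth_on (snd c ` (fst c \<inter> F -` fst d)) (snd d \<circ> F \<circ> chart_inv c)"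
proof -
  have "openin (mtop N) (fst d)" using atlas_chart[OF N d] by (simp add: is_chart_def)
  then have "openin (mtop M) {p \<in> points M. F p \<in> fst d}"
    using F by (auto simp: smooth_map_def continuous_map_def)
  moreover have "fst c \<inter> {p \<in> points M. F p \<in> fst d} = fst c \<inter> F -` fst d"
    using chart_domain_subset[OF atlas_chart[OF M c]] by auto
  ultimately show "open (snd c ` (fst c \<inter> F -` fst d))"
    using open_chart_image[OF atlas_chart[OF M c]] by metis
  show "smooth_on (snd c ` (fst c \<inter> F -` fst d)) (snd d \<circ> F \<circ> chart_inv c)"
    using F c d by (simp add: smooth_map_def)
qed

lemma differential_rep:
  assumes c: "c \<in> charts_at M p" and d: "d \<in> charts_at N (F p)" and X: "X \<in> tangent_space M p"
  shows "((snd d \<circ> F \<circ> chart_inv c) has_derivative fderiv (snd d \<circ> F \<circ> chart_inv c) (snd c p))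
      (at (snd c p))"
    and "differential M N F p X d = fderiv (snd d \<circ> F \<circ> chart_inv c) (snd c p) (X c)"
proof -
  note c' = charts_atD[OF M c] and d' = charts_atD[OF N d]
  show *: "((snd d \<circ> F \<circ> chart_inv c) has_derivative fderiv (snd d \<circ> F \<circ> chart_inv c) (snd c p))
      (at (snd c p))"
    by (rule smooth_on_has_derivative[OF smooth_map_chart_rep(2)[OF c'(1) d'(1)]])
      (use c' d' in auto)
  show "differential M N F p X d = fderiv (snd d \<circ> F \<circ> chart_inv c) (snd c p) (X c)"
    using d vdifferential_has_derivative[OF M c X *] by (simp add: differential_def)
qed

lemma differential_chain:
  assumes p: "p \<in> points M" and d: "d \<in> charts_at N (F p)" and X: "X \<in> tangent_space M p"
    and G: "((G \<circ> chart_inv d) has_derivative G') (at (snd d (F p)))"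
  shows "vdifferential M (G \<circ> F) p X = G' (differential M N F p X d)"
proof -
  let ?c = "chart_at M p"
  have c: "?c \<in> charts_at M p" by (rule chart_at_in_charts_at[OF M p])
  note c' = charts_atD[OF M c] and d' = charts_atD[OF N d]
  let ?W = "snd ?c ` (fst ?c \<inter> F -` fst d)"
  have "((\<lambda>y. (G \<circ> chart_inv d) ((snd d \<circ> F \<circ> chart_inv ?c) y)) has_derivative
      (\<lambda>v. G' (fderiv (snd d \<circ> F \<circ> chart_inv ?c) (snd ?c p) v))) (at (snd ?c p))"
    using G c' d' by (intro has_derivative_compose[OF differential_rep(1)[OF c d X]])
      (simp add: chart_inv_left comp_def)
  then have "(((G \<circ> F) \<circ> chart_inv ?c) has_derivative
      (\<lambda>v. G' (fderiv (snd d \<circ> F \<circ> chart_inv ?c) (snd ?c p) v))) (at (snd ?c p))"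
    by (rule has_derivative_transform_within_open[OF _ smooth_map_chart_rep(1)[OF c'(1) d'(1)]])
      (use c' d' in \<open>auto simp: chart_inv_left\<close>)
  from vdifferential_has_derivative[OF M c X this] show ?thesis
    by (simp add: differential_rep(2)[OF c d X])
qed

lemma differential_tangent:
  assumes "X \<in> tangent_space M p" "p \<in> points M"
  shows "differential M N F p X \<in> tangent_space N (F p)"
proof -
  show ?thesis
  proof (rule tangent_spaceI[OF N])
    fix d e assume de: "d \<in> charts_at N (F p)" "e \<in> charts_at N (F p)"
    show "differential M N F p X e = dtransition d e (F p) (differential M N F p X d)"
      using differential_chain[OF assms(2) de(1) assms(1) transition_has_derivative[OF N de]]
      unfolding differential_def if_P[OF de(2)] .
  qed (simp add: differential_def)
qed

lemma differential_linear:
  assumes p: "p \<in> points M" and X: "X \<in> tangent_space M p" and Y: "Y \<in> tangent_space M p"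
  shows "differential M N F p (\<lambda>d. a *\<^sub>R X d + b *\<^sub>R Y d) =
      (\<lambda>d. a *\<^sub>R differential M N F p X d + b *\<^sub>R differential M N F p Y d)"
proof
  fix d
  have c: "chart_at M p \<in> charts_at M p" by (rule chart_at_in_charts_at[OF M p])
  note XY = tangent_add[OF M tangent_scale[OF M X] tangent_scale[OF M Y]]
  show "differential M N F p (\<lambda>d. a *\<^sub>R X d + b *\<^sub>R Y d) d =
      a *\<^sub>R differential M N F p X d + b *\<^sub>R differential M N F p Y d"
  proof (cases "d \<in> charts_at N (F p)")
    case True
    have "linear (fderiv (snd d \<circ> F \<circ> chart_inv (chart_at M p)) (snd (chart_at M p) p))"
      using differential_rep(1)[OF c True X] has_derivative_linear by blast
    then show ?thesis
      by (simp add: differential_rep(2)[OF c True] X Y XY linear_add linear_scale)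
  qed (simp add: differential_def)
qed

end

lemma differential_compose:
  fixes M :: "('m, 'e::euclidean_space) manifold" and N :: "('p, 'd::euclidean_space) manifold"
    and P :: "('q, 'f::euclidean_space) manifold"
  assumes "smooth_atlas M" "smooth_atlas N" "smooth_atlas P" "smooth_map M N F" "smooth_map N P G"
    and "p \<in> points M" "X \<in> tangent_space M p"
  shows "differential M P (G \<circ> F) p X = differential N P G (F p) (differential M N F p X)"
proof
  fix e
  show "differential M P (G \<circ> F) p X e = differential N P G (F p) (differential M N F p X) e"
  proof (cases "e \<in> charts_at P (G (F p))")
    case True
    let ?d = "chart_at N (F p)"
    have d: "?d \<in> charts_at N (F p)"
      by (rule chart_at_in_charts_at[OF assms(2) smooth_map_point[OF assms(1,2,4,6)]])
    note Y = differential_tangent[OF assms(1,2,4,7,6)]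
    show ?thesis
      using differential_chain[OF assms(1,2,4,6) d assms(7) differential_rep(1)[OF assms(2,3,5) d True Y]]
        True differential_rep(2)[OF assms(2,3,5) d True Y]
      unfolding differential_def[of M P] by (simp add: comp_def)
  qed (simp add: differential_def)
qed

lemma smooth_map_compose:
  fixes M :: "('m, 'e::euclidean_space) manifold" and N :: "('p, 'd::euclidean_space) manifold"
    and P :: "('q, 'f::euclidean_space) manifold"
  assumes M: "smooth_atlas M" and N: "smooth_atlas N" and P: "smooth_atlas P"
    and F: "smooth_map M N F" and G: "smooth_map N P G"
  shows "smooth_map M P (G \<circ> F)"
  unfolding smooth_map_def
proof (intro conjI ballI)
  show cont: "continuous_map (mtop M) (mtop P) (G \<circ> F)"
    using F G by (auto simp: smooth_map_def intro: continuous_map_compose)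
  fix c e assume c: "c \<in> atlas M" and e: "e \<in> atlas P"
  show "smooth_on (snd c ` (fst c \<inter> (G \<circ> F) -` fst e)) (snd e \<circ> (G \<circ> F) \<circ> chart_inv c)"
  proof (rule smooth_on_local)
    fix y assume "y \<in> snd c ` (fst c \<inter> (G \<circ> F) -` fst e)"
    then obtain p where p: "p \<in> fst c" "G (F p) \<in> fst e" "y = snd c p" by auto
    have "p \<in> points M" using chart_domain_subset[OF atlas_chart[OF M c]] p by auto
    then obtain d where d: "d \<in> atlas N" "F p \<in> fst d"
      using charts_atD[OF N chart_at_in_charts_at[OF N smooth_map_point[OF M N F]]] by metis
    note FF = smooth_map_chart_rep[OF M N F c d(1)] and GG = smooth_map_chart_rep[OF N P G d(1) e]
    let ?W = "snd c ` (fst c \<inter> F -` fst d)"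
    let ?f = "snd d \<circ> F \<circ> chart_inv c"
    \<comment> \<open>The part of the chart on which the composite factors through the intermediate
      chart \<open>d\<close>.\<close>
    define V where "V = ?W \<inter> ?f -` (snd d ` (fst d \<inter> G -` fst e))"
    have V: "open V"
      unfolding V_def by (rule continuous_open_preimage[OF smooth_on_continuous[OF FF(2)] FF(1) GG(1)])
    have "smooth_on V (\<lambda>y. (snd e \<circ> G \<circ> chart_inv d) (?f y))"
      by (rule smooth_on_compose[OF V GG(1) _ smooth_on_subset[OF FF(2)] GG(2)]) (auto simp: V_def)
    then have "smooth_on V (snd e \<circ> (G \<circ> F) \<circ> chart_inv c)"
      by (rule smooth_on_cong[OF V])
        (auto simp: V_def chart_inv_left[OF atlas_chart[OF M c]] chart_inv_left[OF atlas_chart[OF N d(1)]]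
          dest!: inj_onD[OF chart_inj[OF atlas_chart[OF N d(1)]]])
    moreover have "y \<in> V"
      using p d by (auto simp: V_def chart_inv_left[OF atlas_chart[OF M c]])
    ultimately show "\<exists>V. open V \<and> y \<in> V \<and> smooth_on V (snd e \<circ> (G \<circ> F) \<circ> chart_inv c)"
      using V by blast
  qed
qed

section \<open>The pseudosphere and its quotient as manifolds\<close>

type_synonym 'n sphere_coord = "(real ^ 'n) \<times> (real ^ 'n) \<times> real"
type_synonym 'n base_coord = "(real ^ 'n) \<times> (real ^ 'n)"

text \<open>A transition between two arbitrary charts factors locally through the reference chart
  \<open>e\<close>. For an atlas of all charts with some property, this leaves only comparisons with
  one well-understood chart.\<close>

lemma smooth_atlasI:
  assumes chart: "\<And>c. c \<in> atlas M \<Longrightarrow> is_chart (mtop M) c"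
    and ref: "\<And>p. p \<in> points M \<Longrightarrow> \<exists>e\<in>atlas M. p \<in> fst e \<and>
      (\<forall>d\<in>atlas M. smooth_on (snd d ` (fst d \<inter> fst e)) (snd e \<circ> chart_inv d) \<and>
        smooth_on (snd e ` (fst e \<inter> fst d)) (snd d \<circ> chart_inv e))"
  shows "smooth_atlas (M :: ('m, 'e::euclidean_space) manifold)"
  unfolding smooth_atlas_def
proof (intro conjI ballI)
  show "is_chart (mtop M) c" if "c \<in> atlas M" for c by (rule chart[OF that])
  show "(\<Union>c\<in>atlas M. fst c) = points M"
    using chart_domain_subset[OF chart] ref by blast
  fix c d assume c: "c \<in> atlas M" and d: "d \<in> atlas M"
  show "smooth_on (snd c ` (fst c \<inter> fst d)) (snd d \<circ> chart_inv c)"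
  proof (rule smooth_on_local)
    fix y assume "y \<in> snd c ` (fst c \<inter> fst d)"
    then obtain p where p: "p \<in> fst c" "p \<in> fst d" "y = snd c p" by auto
    have "p \<in> points M" using chart_domain_subset[OF chart[OF c]] p by auto
    from ref[OF this] c d obtain e where e: "e \<in> atlas M" "p \<in> fst e"
      and ce: "smooth_on (snd c ` (fst c \<inter> fst e)) (snd e \<circ> chart_inv c)"
      and ed: "smooth_on (snd e ` (fst e \<inter> fst d)) (snd d \<circ> chart_inv e)" by blast
    have dom: "openin (mtop M) (fst d)" "openin (mtop M) (fst e)"
      using chart[OF d] chart[OF e(1)] by (simp_all add: is_chart_def)
    note invs = chart_inv_left[OF chart[OF c]] chart_inv_left[OF chart[OF e(1)]]
    let ?V = "snd c ` (fst c \<inter> (fst d \<inter> fst e))"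
    have V: "open ?V" using dom by (intro open_chart_image[OF chart[OF c]]) auto
    have "smooth_on ?V (\<lambda>y. (snd d \<circ> chart_inv e) ((snd e \<circ> chart_inv c) y))"
      by (rule smooth_on_compose[OF V open_chart_image[OF chart[OF e(1)] dom(1)] _ smooth_on_subset[OF ce] ed])
        (auto simp: invs)
    then have "smooth_on ?V (snd d \<circ> chart_inv c)"
      by (rule smooth_on_cong[OF V]) (auto simp: invs)
    then show "\<exists>V. open V \<and> y \<in> V \<and> smooth_on V (snd d \<circ> chart_inv c)"
      using V p e by blast
  qed
qed

section \<open>Linear coordinates on kernels and annihilators\<close>

definition riesz :: "('a::euclidean_space \<Rightarrow>\<^sub>L real) \<Rightarrow> 'a" where
  "riesz \<alpha> = (\<Sum>b\<in>Basis. blinfun_apply \<alpha> b *\<^sub>R b)"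

lemma bounded_linear_riesz: "bounded_linear riesz"
  unfolding riesz_def
  by (intro bounded_linear_sum bounded_linear_scaleR_const blinfun.bounded_linear_left)

lemma riesz_inner: "riesz \<alpha> \<bullet> v = blinfun_apply \<alpha> v"
proof -
  have "blinfun_apply \<alpha> v = (\<Sum>b\<in>Basis. (v \<bullet> b) * blinfun_apply \<alpha> b)"
    by (subst euclidean_representation[of v, symmetric])
      (simp add: blinfun.sum_right blinfun.scaleR_right)
  also have "\<dots> = riesz \<alpha> \<bullet> v"
    by (simp add: riesz_def inner_sum_left inner_commute[of v] mult.commute)
  finally show ?thesis ..
qed

lemma riesz_blinfun_inner_left: "riesz (blinfun_inner_left a) = a"
proof (rule vector_eq_rdot[THEN iffD1], rule allI)
  show "riesz (blinfun_inner_left a) \<bullet> v = a \<bullet> v" for v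
    unfolding riesz_inner by (simp add: inner_commute)
qed

text \<open>\<open>'n option\<close> has one index more than \<open>'n\<close>, so the hyperplane
  has the dimension of \<open>real ^ 'n\<close>. The left inverse \<open>K\<close> is defined on the
  whole space, which lets coordinate maps built from it be differentiated there.\<close>

lemma hyperplane_parametrization:
  fixes a :: "'n::finite aff"
  assumes "a \<noteq> 0"
  obtains L :: "real ^ 'n \<Rightarrow> 'n aff" and K
  where "bounded_linear L" "bounded_linear K" "\<And>u. K (L u) = u" "range L = {x. a \<bullet> x = 0}"
proof -
  have "dim (UNIV :: (real ^ 'n) set) = dim {x. a \<bullet> x = 0}"
    by (simp add: dim_hyperplane[OF assms])
  then obtain L :: "real ^ 'n \<Rightarrow> 'n aff"
    where L: "linear L" "range L = {x. a \<bullet> x = 0}" "\<And>x. norm (L x) = norm x"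
    using isometry_subspaces[OF subspace_UNIV subspace_hyperplane] by (metis UNIV_I)
  have "inj L" using L(1,3) by (metis linear_injective_0 norm_eq_zero)
  then obtain K where "linear K" "K \<circ> L = id"
    using linear_injective_left_inverse[OF L(1)] by blast
  then show ?thesis
    using that[of L K] L by (simp add: linear_conv_bounded_linear pointfree_idE)
qed

lemma kernel_parametrization:
  fixes \<alpha> :: "'n::finite aff_dual"
  assumes "\<alpha> \<noteq> 0"
  obtains L :: "real ^ 'n \<Rightarrow> 'n aff" and K
  where "bounded_linear L" "bounded_linear K" "\<And>u. K (L u) = u" "range L = {w. blinfun_apply \<alpha> w = 0}"
proof -
  have "riesz \<alpha> \<noteq> 0" using assms riesz_inner[of \<alpha>] by (metis blinfun_eqI inner_zero_left zero_blinfun.rep_eq)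
  from hyperplane_parametrization[OF this, unfolded riesz_inner] show ?thesis using that by blast
qed

text \<open>\<open>riesz\<close> identifies the annihilator of \<open>v\<close> with the hyperplane
  orthogonal to \<open>v\<close>.\<close>

lemma annihilator_parametrization:
  fixes v :: "'n::finite aff"
  assumes "v \<noteq> 0"
  obtains L :: "real ^ 'n \<Rightarrow> 'n aff_dual" and K
  where "bounded_linear L" "bounded_linear K" "\<And>u. K (L u) = u" "range L = {\<beta>. blinfun_apply \<beta> v = 0}"
proof -
  obtain L :: "real ^ 'n \<Rightarrow> 'n aff" and K where LK: "bounded_linear L" "bounded_linear K"
    "\<And>u. K (L u) = u" "range L = {x. v \<bullet> x = 0}" using hyperplane_parametrization[OF assms] by blast
  show ?thesis
  proof (rule that[of "\<lambda>u. blinfun_inner_left (L u)" "\<lambda>\<beta>. K (riesz \<beta>)"])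
    show "range (\<lambda>u. blinfun_inner_left (L u)) = {\<beta>. blinfun_apply \<beta> v = 0}"
    proof (intro equalityI subsetI)
      fix \<beta> :: "'n aff_dual" assume "\<beta> \<in> {\<beta>. blinfun_apply \<beta> v = 0}"
      then have "riesz \<beta> \<in> range L" by (simp add: LK(4) inner_commute flip: riesz_inner)
      then obtain u where u: "riesz \<beta> = L u" by blast
      have "\<beta> = blinfun_inner_left (L u)"
        by (rule blinfun_eqI) (simp add: inner_commute[of _ "riesz \<beta>"] riesz_inner flip: u)
      then show "\<beta> \<in> range (\<lambda>u. blinfun_inner_left (L u))" by blast
    qed (use LK(4) in auto)
  qed (use LK in \<open>simp_all add: riesz_blinfun_inner_left bounded_linear_compose[OF bounded_linear_blinfun_inner_left]
      bounded_linear_compose[OF LK(2) bounded_linear_riesz]\<close>)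
qed

section \<open>The action, its orbits and charts adapted to them\<close>

lemma sphere_set_iff: "z \<in> sphere_set \<longleftrightarrow> blinfun_apply (snd z) (fst z) = 1"
  by (cases z) (simp add: sphere_set_def)

lemma action_eq: "action t z = (exp t *\<^sub>R fst z, exp (- t) *\<^sub>R snd z)"
  by (cases z) simp

lemma action_0 [simp]: "action 0 z = z"
  by (simp add: action_eq)

lemma action_action [simp]: "action s (action t z) = action (s + t) z"
  by (simp add: action_eq exp_add exp_diff exp_minus divide_inverse mult.commute)

lemma action_sphere_set_iff [simp]: "action t z \<in> sphere_set \<longleftrightarrow> z \<in> sphere_set"
  by (simp add: sphere_set_iff action_eq blinfun.scaleR_left blinfun.scaleR_right flip: exp_add mult.assoc)

lemma proj_plus_eq_iff: "proj_plus z = proj_plus z' \<longleftrightarrow> (\<exists>t. z' = action t z)"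
proof
  assume "proj_plus z = proj_plus z'"
  moreover have "z' \<in> proj_plus z'" unfolding proj_plus_def by (rule range_eqI[of _ _ 0]) simp
  ultimately show "\<exists>t. z' = action t z" by (auto simp: proj_plus_def)
next
  assume "\<exists>t. z' = action t z"
  then obtain t where t: "z' = action t z" ..
  have "action s z = action (s - t) z'" "action s z' = action (s + t) z" for s by (simp_all add: t)
  then show "proj_plus z = proj_plus z'" unfolding proj_plus_def by blast
qed

lemma proj_plus_action [simp]: "proj_plus (action t z) = proj_plus z"
  using proj_plus_eq_iff[of z "action t z"] by auto

lemma in_proj_plus_iff: "z' \<in> proj_plus z \<longleftrightarrow> (\<exists>t. z' = action t z)"
  by (auto simp: proj_plus_def)

text \<open>
  A chart adapted to the orbits of the action, centred at \<open>(v0, \<alpha>0)\<close>: every point \<open>(v, \<alpha>)\<close> with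
  \<open>\<alpha>0 v > 0\<close> and \<open>\<alpha> v0 > 0\<close> is determined by \<open>t = ln (\<alpha>0 v)\<close>, which is affine along orbits, and by
  \<open>v / \<alpha>0 v - v0 \<in> ker \<alpha>0\<close> and \<open>\<alpha> / \<alpha> v0 - \<alpha>0\<close>, which are constant along orbits.
\<close>

locale adapted_chart =
  fixes v0 :: "'n::finite aff" and \<alpha>0 :: "'n aff_dual"
    and L :: "real ^ 'n \<Rightarrow> 'n aff" and K :: "'n aff \<Rightarrow> real ^ 'n"
    and L' :: "real ^ 'n \<Rightarrow> 'n aff_dual" and K' :: "'n aff_dual \<Rightarrow> real ^ 'n"
  assumes unit: "blinfun_apply \<alpha>0 v0 = 1"
    and bounded_linear: "bounded_linear L" "bounded_linear K" "bounded_linear L'" "bounded_linear K'"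
    and KL [simp]: "K (L w) = w" and KL' [simp]: "K' (L' b) = b"
    and range_L: "range L = {w. blinfun_apply \<alpha>0 w = 0}"
    and range_L': "range L' = {\<beta>. blinfun_apply \<beta> v0 = 0}"
begin

text \<open>An open set of the ambient space, not of the sphere: \<open>base\<close> and
  \<open>coord\<close> can thus be differentiated as functions on a vector space before they are
  restricted.\<close>

definition half_space :: "'n para set" where
  "half_space = {z. blinfun_apply \<alpha>0 (fst z) > 0 \<and> blinfun_apply (snd z) v0 > 0}"

definition base :: "'n para \<Rightarrow> 'n base_coord" where
  "base z = (K (inverse (blinfun_apply \<alpha>0 (fst z)) *\<^sub>R fst z - v0),
     K' (inverse (blinfun_apply (snd z) v0) *\<^sub>R snd z - \<alpha>0))"

definition coord :: "'n para \<Rightarrow> 'n sphere_coord" where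
  "coord z = (fst (base z), snd (base z), ln (blinfun_apply \<alpha>0 (fst z)))"

text \<open>The pairing of the normalised representatives \<open>\<alpha>0 + L' b\<close> and
  \<open>v0 + L w\<close>. Dividing by it puts \<open>param\<close> on the sphere, and its
  positivity describes the range of the chart.\<close>

definition denom :: "'n base_coord \<Rightarrow> real" where
  "denom x = 1 + blinfun_apply (L' (snd x)) (L (fst x))"

definition param :: "'n sphere_coord \<Rightarrow> 'n para" where
  "param y = (exp (snd (snd y)) *\<^sub>R (v0 + L (fst y)),
     (exp (- snd (snd y)) * inverse (denom (fst y, fst (snd y)))) *\<^sub>R (\<alpha>0 + L' (fst (snd y))))"

definition dom :: "'n para set" where
  "dom = sphere_set \<inter> half_space"

definition sphere_chart :: "('n para, 'n sphere_coord) chart" where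
  "sphere_chart = (dom, coord)"

text \<open>The choice of a representative is harmless because \<open>base\<close> is constant along
  orbits.\<close>

definition base_chart :: "('n para set, 'n base_coord) chart" where
  "base_chart = (proj_plus ` dom, \<lambda>q. base (SOME z. z \<in> q))"

lemma kernel_L [simp]: "blinfun_apply \<alpha>0 (L w) = 0" "blinfun_apply (L' b) v0 = 0"
  using range_L range_L' by auto

lemma L_K: "blinfun_apply \<alpha>0 w = 0 \<Longrightarrow> L (K w) = w"
  by (metis (mono_tags, lifting) KL imageE mem_Collect_eq range_L)

lemma L'_K': "blinfun_apply \<beta> v0 = 0 \<Longrightarrow> L' (K' \<beta>) = \<beta>"
  by (metis (mono_tags, lifting) KL' imageE mem_Collect_eq range_L')

lemma param_coord:
  assumes "z \<in> dom"
  shows "param (coord z) = z" "denom (base z) > 0"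
proof -
  obtain v \<alpha> where z: "z = (v, \<alpha>)" by (cases z)
  define p q where "p = blinfun_apply \<alpha>0 v" and "q = blinfun_apply \<alpha> v0"
  have pq: "p > 0" "q > 0" "blinfun_apply \<alpha> v = 1"
    using assms by (auto simp: z p_def q_def dom_def half_space_def sphere_set_iff)
  have LK: "L (K (inverse p *\<^sub>R v - v0)) = inverse p *\<^sub>R v - v0"
    using pq by (intro L_K) (simp add: blinfun.diff_right blinfun.scaleR_right unit flip: p_def)
  have LK': "L' (K' (inverse q *\<^sub>R \<alpha> - \<alpha>0)) = inverse q *\<^sub>R \<alpha> - \<alpha>0"
    using pq by (intro L'_K') (simp add: blinfun.diff_left blinfun.scaleR_left unit flip: q_def)
  \<comment> \<open>The representatives are \<open>v\<close> divided by \<open>p\<close> and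
    \<alpha> divided by \<open>q\<close>, and \<alpha> takes the value 1 on
    \<open>v\<close>.\<close>
  have denom: "denom (base z) = inverse (p * q)"
    using pq unit
    by (simp add: denom_def base_def z LK LK' blinfun.bilinear_simps flip: p_def q_def)
      (simp add: field_simps)
  then show "denom (base z) > 0" using pq by simp
  show "param (coord z) = z"
    using pq denom
    by (simp add: param_def coord_def)
      (simp add: base_def z LK LK' exp_minus flip: p_def q_def, simp add: field_simps)
qed

lemma coord_param:
  assumes "denom (fst y, fst (snd y)) > 0"
  shows "param y \<in> dom" "coord (param y) = y" "base (param y) = (fst y, fst (snd y))"
proof -
  obtain w b t where y: "y = (w, b, t)" by (cases y)
  have d: "denom (w, b) > 0" using assms by (simp add: y)
  have *: "blinfun_apply \<alpha>0 (fst (param y)) = exp t"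
    "blinfun_apply (snd (param y)) v0 = exp (- t) * inverse (denom (w, b))"
    using unit by (simp_all add: param_def y blinfun.bilinear_simps)
  have "blinfun_apply (snd (param y)) (fst (param y)) =
      exp (- t) * exp t * (inverse (denom (w, b)) * blinfun_apply (\<alpha>0 + L' b) (v0 + L w))"
    by (simp add: param_def y blinfun.scaleR_left blinfun.scaleR_right)
  also have "blinfun_apply (\<alpha>0 + L' b) (v0 + L w) = denom (w, b)"
    using unit by (simp add: denom_def blinfun.bilinear_simps)
  finally have "blinfun_apply (snd (param y)) (fst (param y)) = 1"
    using d by (simp flip: exp_add)
  then show "param y \<in> dom"
    using d * by (simp add: dom_def half_space_def sphere_set_iff)
  show base: "base (param y) = (fst y, fst (snd y))"
    using d unfolding base_def *
    by (simp add: param_def y) (simp add: exp_minus field_simps)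
  show "coord (param y) = y"
    unfolding coord_def base * by (simp add: y)
qed

lemma action_half_space [simp]: "action t z \<in> half_space \<longleftrightarrow> z \<in> half_space"
  by (simp add: half_space_def action_eq blinfun.scaleR_left blinfun.scaleR_right zero_less_mult_iff)

lemma action_dom [simp]: "action t z \<in> dom \<longleftrightarrow> z \<in> dom"
  by (simp add: dom_def)

lemma base_action [simp]: "base (action t z) = base z"
  by (simp add: base_def action_eq blinfun.scaleR_left blinfun.scaleR_right)
    (simp add: exp_minus field_simps)

lemma proj_plus_in_base_dom_iff: "proj_plus z \<in> proj_plus ` dom \<longleftrightarrow> z \<in> dom"
  by (auto simp: image_iff proj_plus_eq_iff[of z])

lemma base_chart_proj_plus: "snd base_chart (proj_plus z) = base z"
proof -
  have "\<exists>z'. z' \<in> proj_plus z" using in_proj_plus_iff by blast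
  then have "(SOME z'. z' \<in> proj_plus z) \<in> proj_plus z" by (rule someI_ex)
  then show ?thesis by (auto simp: base_chart_def in_proj_plus_iff)
qed

text \<open>The last coordinate is the logarithm of a quantity that the action multiplies by
  \<open>exp s\<close>; in this chart the action is a translation and the projection forgets that
  coordinate.\<close>

lemma param_action: "action s (param (w, b, t)) = param (w, b, s + t)"
  by (simp add: param_def action_eq exp_add)
    (simp add: exp_diff exp_minus divide_inverse mult_ac)

definition range_set :: "'n sphere_coord set" where
  "range_set = {y. denom (fst y, fst (snd y)) > 0}"

definition base_range :: "'n base_coord set" where
  "base_range = {x. denom x > 0}"

lemma coord_image: "coord ` dom = range_set"
proof
  show "coord ` dom \<subseteq> range_set" using param_coord(2) by (auto simp: range_set_def coord_def)
  show "range_set \<subseteq> coord ` dom"     using coord_param(1,2) by (auto simp: range_set_def intro!: image_eqI[OF sym])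
qed

lemma base_image: "base ` dom = base_range"
proof
  show "base ` dom \<subseteq> base_range" using param_coord(2) by (auto simp: base_range_def)
  show "base_range \<subseteq> base ` dom"
  proof
    fix x assume "x \<in> base_range"
    then show "x \<in> base ` dom"
      using coord_param(1,3)[of "(fst x, snd x, 0)"]
      by (intro image_eqI[of _ _ "param (fst x, snd x, 0)"]) (simp_all add: base_range_def)
  qed
qed

lemma smooth_denom: "smooth_on UNIV denom"
proof -
  have "smooth_on UNIV (\<lambda>x. L (fst x))" "smooth_on UNIV (\<lambda>x. L' (snd x))"
    by (intro smooth_on_linear bounded_linear_compose[OF _ bounded_linear_fst]
        bounded_linear_compose[OF _ bounded_linear_snd] bounded_linear)+
  then show ?thesis
    unfolding denom_def
    by (intro smooth_on_add smooth_on_const smooth_on_bounded_bilinear[OF bounded_bilinear_blinfun_apply]) auto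
qed

lemma open_base_range: "open base_range"
  unfolding base_range_def
  by (intro open_Collect_less continuous_on_const smooth_on_continuous[OF smooth_denom])

lemma open_range_set: "open range_set"
proof -
  have "continuous_on UNIV (\<lambda>y. denom (fst y, fst (snd y)))"
    by (rule continuous_on_compose2[OF smooth_on_continuous[OF smooth_denom]]) (auto intro!: continuous_intros)
  then show ?thesis unfolding range_set_def by (intro open_Collect_less continuous_on_const)
qed

lemma smooth_param: "smooth_on range_set param"
proof -
  note O = open_range_set
  have lin: "bounded_linear (\<lambda>y :: 'n sphere_coord. fst (snd y))"
    "bounded_linear (\<lambda>y :: 'n sphere_coord. snd (snd y))"
    by (intro bounded_linear_compose[OF bounded_linear_fst bounded_linear_snd]
        bounded_linear_compose[OF bounded_linear_snd bounded_linear_snd])+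
  have 1: "smooth_on range_set (\<lambda>y. denom (fst y, fst (snd y)))"
    by (rule smooth_on_compose[OF O open_UNIV _ _ smooth_denom])
      (auto intro!: smooth_on_linear bounded_linear_Pair bounded_linear_fst lin)
  have 2: "smooth_on range_set (\<lambda>y. L (fst y))" "smooth_on range_set (\<lambda>y. L' (fst (snd y)))"
    "smooth_on range_set (\<lambda>y :: 'n sphere_coord. snd (snd y))"
    by (intro smooth_on_linear bounded_linear_compose[OF _ bounded_linear_fst]
        bounded_linear_compose[OF _ lin(1)] bounded_linear lin)+
  show ?thesis
    unfolding param_def
    by (intro smooth_on_Pair smooth_on_scaleR smooth_on_mult smooth_on_exp smooth_on_minus smooth_on_add
        smooth_on_inverse_real smooth_on_const O 1 2) (simp add: range_set_def)
qed

text \<open>The map \<gamma> is built into the statement because it will be the identity of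
  \<open>half_space\<close> as well as the inverse of an arbitrary chart of the sphere.\<close>

lemma smooth_base:
  assumes W: "open W" and \<gamma>: "smooth_on W \<gamma>" "\<And>y. y \<in> W \<Longrightarrow> \<gamma> y \<in> half_space"
  shows "smooth_on W (\<lambda>y. base (\<gamma> y))"
proof -
  have nz: "blinfun_apply \<alpha>0 (fst (\<gamma> y)) \<noteq> 0" "blinfun_apply (snd (\<gamma> y)) v0 \<noteq> 0" if "y \<in> W" for y
    using \<gamma>(2)[OF that] by (auto simp: half_space_def)
  have "smooth_on W (\<lambda>y. blinfun_apply \<alpha>0 (fst (\<gamma> y)))" "smooth_on W (\<lambda>y. blinfun_apply (snd (\<gamma> y)) v0)"
    by (intro smooth_on_bounded_linear[OF blinfun.bounded_linear_right W]
        smooth_on_bounded_linear[OF blinfun.bounded_linear_left W] smooth_on_fst smooth_on_snd W \<gamma>)+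
  with nz show ?thesis
    unfolding base_def
    by (intro smooth_on_Pair smooth_on_bounded_linear[OF bounded_linear(2)] smooth_on_bounded_linear[OF bounded_linear(4)]
        smooth_on_scaleR smooth_on_inverse_real smooth_on_diff smooth_on_const smooth_on_fst smooth_on_snd \<gamma> W)
qed

lemma smooth_coord:
  assumes W: "open W" and \<gamma>: "smooth_on W \<gamma>" "\<And>y. y \<in> W \<Longrightarrow> \<gamma> y \<in> half_space"
  shows "smooth_on W (\<lambda>y. coord (\<gamma> y))"
proof -
  have "smooth_on W (\<lambda>y. blinfun_apply \<alpha>0 (fst (\<gamma> y)))"
    by (intro smooth_on_bounded_linear[OF blinfun.bounded_linear_right W] smooth_on_fst W \<gamma>)
  with \<gamma>(2) show ?thesis
    unfolding coord_def
    by (intro smooth_on_Pair smooth_on_fst smooth_on_snd smooth_on_ln smooth_base assms)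
      (auto simp: half_space_def)
qed

lemma open_half_space: "open half_space"
  unfolding half_space_def
  by (intro open_Collect_conj open_Collect_less continuous_intros)

lemma continuous_on_coord: "continuous_on half_space coord"
  using smooth_on_continuous[OF smooth_coord[OF open_half_space smooth_on_linear[OF bounded_linear_ident]]] by simp

lemma continuous_on_base: "continuous_on half_space base"
  using smooth_on_continuous[OF smooth_base[OF open_half_space smooth_on_linear[OF bounded_linear_ident]]] by simp

lemma openin_dom: "openin (top_of_set sphere_set) dom"
  unfolding dom_def using open_half_space by (simp add: openin_open_Int)

lemma is_chart_sphere_chart: "is_chart (top_of_set sphere_set) sphere_chart"
  unfolding sphere_chart_def
proof (rule is_chartI[where \<phi> = param])
  show "openin (top_of_set sphere_set) dom" by (rule openin_dom)
  show "open (coord ` dom)" by (simp add: coord_image open_range_set)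
  have "subtopology (top_of_set sphere_set) dom = top_of_set dom"
    by (simp add: subtopology_subtopology dom_def Int_absorb1 Int_assoc)
  then show "continuous_map (subtopology (top_of_set sphere_set) dom) euclidean coord"
    using continuous_on_subset[OF continuous_on_coord] by (simp add: dom_def)
  show "continuous_map (top_of_set (coord ` dom)) (top_of_set sphere_set) param"
    using smooth_on_continuous[OF smooth_param] coord_param(1)
    unfolding coord_image by (auto simp: continuous_map_in_subtopology range_set_def dom_def)
  show "param (coord z) = z" if "z \<in> dom" for z by (rule param_coord(1)[OF that])
qed

lemma chart_inv_sphere_chart: "y \<in> range_set \<Longrightarrow> chart_inv sphere_chart y = param y"
  using chart_inv_left[OF is_chart_sphere_chart, of "param y"] coord_param[of y]
  by (simp add: sphere_chart_def range_set_def)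

text \<open>Differentiating \<open>coord (param y) = y\<close> gives the derivative of
  \<open>param\<close> a left inverse.\<close>

lemma inj_param_derivative:
  assumes y: "y \<in> range_set"
  shows "inj (fderiv param y)"
proof (rule inj_on_inverseI)
  fix v
  have sm: "smooth_on range_set (\<lambda>y. coord (param y))"
    by (rule smooth_coord[OF open_range_set smooth_param])
      (use coord_param(1) in \<open>auto simp: range_set_def dom_def\<close>)
  have c: "(coord has_derivative fderiv coord (param y)) (at (param y))"
    by (rule smooth_on_has_derivative[OF smooth_coord[OF open_half_space smooth_on_linear[OF bounded_linear_ident]]])
      (use coord_param(1) y in \<open>auto simp: range_set_def dom_def\<close>)
  have "((\<lambda>y. coord (param y)) has_derivative
      (\<lambda>v. fderiv coord (param y) (fderiv param y v))) (at y)"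
    by (rule has_derivative_compose[OF smooth_on_has_derivative[OF smooth_param y] c])
  moreover have "((\<lambda>y. coord (param y)) has_derivative (\<lambda>v. v)) (at y)"
    by (rule has_derivative_transform_within_open[OF has_derivative_ident open_range_set y])
      (simp add: coord_param(2) range_set_def)
  ultimately show "fderiv coord (param y) (fderiv param y v) = v"
    by (rule fun_cong[OF has_derivative_unique])
qed

lemma sphere_chart_in_atlas: "sphere_chart \<in> atlas pseudosphere"
proof -
  have im: "snd sphere_chart ` fst sphere_chart = range_set"
    by (simp add: sphere_chart_def coord_image)
  have "smooth_on range_set (chart_inv sphere_chart)"
    by (rule smooth_on_cong[OF open_range_set smooth_param]) (simp add: chart_inv_sphere_chart)
  moreover have "fderiv (chart_inv sphere_chart) y = fderiv param y"
    if "y \<in> range_set" for y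
    by (rule frechet_derivative_at_cong[OF open_range_set that chart_inv_sphere_chart])
  ultimately show ?thesis
    using is_chart_sphere_chart inj_param_derivative im
    by (simp add: pseudosphere_def del: ball_simps image_iff)
qed

end

lemma mtop_pseudosphere [simp]: "mtop pseudosphere = top_of_set sphere_set"
  by (simp add: pseudosphere_def)

lemma mtop_para_hyperbolic [simp]:
  "mtop para_hyperbolic = quotient_topology (top_of_set sphere_set) proj_plus"
  by (simp add: para_hyperbolic_def)

lemma pseudosphere_atlasD:
  assumes "d \<in> atlas pseudosphere"
  shows "is_chart (top_of_set sphere_set) d" "smooth_on (snd d ` fst d) (chart_inv d)"
    and "\<And>y. y \<in> snd d ` fst d \<Longrightarrow> inj (fderiv (chart_inv d) y)"
  using assms by (auto simp: pseudosphere_def)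

lemma para_hyperbolic_atlasD:
  fixes d :: "('n::finite para set, 'n base_coord) chart"
    and c :: "('n para, 'n sphere_coord) chart"
  assumes "d \<in> atlas para_hyperbolic"
  shows "is_chart (quotient_topology (top_of_set sphere_set) proj_plus) d"
    and "c \<in> atlas pseudosphere \<Longrightarrow> smooth_on (snd c ` (fst c \<inter> proj_plus -` fst d)) (snd d \<circ> proj_plus \<circ> chart_inv c)"
    and "c \<in> atlas pseudosphere \<Longrightarrow> y \<in> snd c ` (fst c \<inter> proj_plus -` fst d) \<Longrightarrow>
      surj (fderiv (snd d \<circ> proj_plus \<circ> chart_inv c) y)"
  using assms by (auto simp: para_hyperbolic_def Let_def)

lemma adapted_chart_exists:
  fixes z :: "'n::finite para"
  assumes "z \<in> sphere_set"
  obtains L K L' K' where "adapted_chart (fst z) (snd z) L K L' K'"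
proof -
  have unit: "blinfun_apply (snd z) (fst z) = 1" using assms by (simp add: sphere_set_iff)
  then have nz: "fst z \<noteq> 0" "snd z \<noteq> 0" by (auto simp: blinfun.zero_left blinfun.zero_right)
  obtain L :: "real ^ 'n \<Rightarrow> 'n aff" and K where L: "bounded_linear L" "bounded_linear K" "\<And>u. K (L u) = u"
    "range L = {w. blinfun_apply (snd z) w = 0}" using kernel_parametrization[OF nz(2)] by blast
  obtain L' :: "real ^ 'n \<Rightarrow> 'n aff_dual" and K' where L': "bounded_linear L'" "bounded_linear K'" "\<And>u. K' (L' u) = u"
    "range L' = {\<beta>. blinfun_apply \<beta> (fst z) = 0}" using annihilator_parametrization[OF nz(1)] by blast
  show ?thesis
    by (rule that[OF adapted_chart.intro[OF unit L(1,2) L'(1,2) L(3) L'(3) L(4) L'(4)]])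
qed

section \<open>Compatibility of the adapted charts with both atlases\<close>

context adapted_chart
begin

lemma center_in_dom: "(v0, \<alpha>0) \<in> dom"
  using unit by (simp add: dom_def half_space_def sphere_set_iff)

lemma dom_subset: "dom \<subseteq> sphere_set"
  by (simp add: dom_def)

lemma coord_center: "coord (v0, \<alpha>0) = 0"
  using unit bounded_linear
  by (simp add: coord_def base_def linear_simps zero_prod_def linear_0 bounded_linear.linear)

lemma param_zero: "param 0 = (v0, \<alpha>0)"
  using param_coord(1)[OF center_in_dom] by (simp add: coord_center)

text \<open>One direction is smooth because \<open>coord\<close> is smooth on an open set of the
  ambient space. Its derivative is injective since that of \<open>chart_inv d\<close> is, by the
  definition of the atlas, and factors through it; the inverse function result then gives the other
  direction.\<close>

lemma sphere_transition:
  assumes d: "d \<in> atlas pseudosphere"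
  shows "open (snd d ` (fst d \<inter> dom))"
    and "smooth_on (snd d ` (fst d \<inter> dom)) (coord \<circ> chart_inv d)"
    and "y \<in> snd d ` (fst d \<inter> dom) \<Longrightarrow> inj (fderiv (coord \<circ> chart_inv d) y)"
    and "open (coord ` (dom \<inter> fst d))"
    and "smooth_on (coord ` (dom \<inter> fst d)) (snd d \<circ> param)"
proof -
  note d' = pseudosphere_atlasD[OF d]
  note inv = chart_inv_left[OF d'(1)]
  let ?U = "snd d ` (fst d \<inter> dom)"
  let ?f = "coord \<circ> chart_inv d"
  show U: "open ?U" by (rule open_chart_image[OF d'(1) openin_dom])
  have half: "chart_inv d y \<in> half_space" if "y \<in> ?U" for y
    using that by (auto simp: inv dom_def)
  show f: "smooth_on ?U ?f"
    unfolding comp_def by (rule smooth_coord[OF U smooth_on_subset[OF d'(2)] half]) auto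
  show inj: "inj (fderiv ?f y)" if y: "y \<in> ?U" for y
  proof -
    have fy: "?f y \<in> range_set" using y coord_image by (auto simp: inv)
    have "((\<lambda>y. param (?f y)) has_derivative
        (\<lambda>v. fderiv param (?f y) (fderiv ?f y v))) (at y)"
      by (rule has_derivative_compose[OF smooth_on_has_derivative[OF f y] smooth_on_has_derivative[OF smooth_param fy]])
    then have "(chart_inv d has_derivative
        (\<lambda>v. fderiv param (?f y) (fderiv ?f y v))) (at y)"
      by (rule has_derivative_transform_within_open[OF _ U y]) (auto simp: inv param_coord)
    then have "fderiv (chart_inv d) y =
        (\<lambda>v. fderiv param (?f y) (fderiv ?f y v))"
      by (rule frechet_derivative_eqI)
    moreover have "inj (fderiv (chart_inv d) y)" by (rule d'(3)) (use y in blast)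
    ultimately show ?thesis
      by (metis (no_types, lifting) injD injI)
  qed
  have gf: "(snd d \<circ> param) (?f y) = y" if "y \<in> ?U" for y
    using that by (auto simp: inv param_coord)
  have im: "?f ` ?U = coord ` (dom \<inter> fst d)"
    by (auto simp: inv image_iff)
  show "smooth_on (coord ` (dom \<inter> fst d)) (snd d \<circ> param)"
    using smooth_on_inverse_map[OF U f gf inj] unfolding im .
  have "inj_on ?f ?U" by (rule inj_on_inverseI[where g = "snd d \<circ> param"]) (rule gf)
  from invariance_of_domain[OF smooth_on_continuous[OF f] U this] show "open (coord ` (dom \<inter> fst d))"
    unfolding im .
qed

lemma fst_snd_sphere_chart [simp]: "fst sphere_chart = dom" "snd sphere_chart = coord"
  by (simp_all add: sphere_chart_def)

lemma fst_base_chart [simp]: "fst base_chart = proj_plus ` dom"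
  by (simp add: base_chart_def)

lemma proj_plus_param:
  assumes "base z = x" "z \<in> dom"
  shows "proj_plus (param (fst x, snd x, t)) = proj_plus z"
proof -
  have "action (ln (blinfun_apply \<alpha>0 (fst z)) - t) (param (fst x, snd x, t)) = param (coord z)"
    unfolding param_action using assms by (simp add: coord_def)
  then have "proj_plus (param (coord z)) = proj_plus (param (fst x, snd x, t))"
    by (metis proj_plus_action)
  then show ?thesis using param_coord(1)[OF assms(2)] by simp
qed

lemma base_chart_image: "snd base_chart ` (proj_plus ` A) = base ` A"
  by (auto simp: image_iff base_chart_proj_plus)

text \<open>Open sets of the quotient are tested by their preimages, which reduces continuity of the
  chart to that of \<open>base\<close>. Its inverse is the slice of \<open>param\<close> where the
  last coordinate is 0, followed by the projection.\<close>

lemma is_chart_base_chart: "is_chart (quotient_topology (top_of_set sphere_set) proj_plus) base_chart"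
proof -
  let ?T = "quotient_topology (top_of_set sphere_set) proj_plus"
  have "is_chart ?T (fst base_chart, snd base_chart)"
  proof (rule is_chartI[where \<phi> = "\<lambda>x. proj_plus (param (fst x, snd x, 0))"])
    have vimage: "{z \<in> sphere_set. proj_plus z \<in> proj_plus ` dom} = dom"
      using dom_subset by (auto simp: proj_plus_in_base_dom_iff)
    show dom: "openin ?T (fst base_chart)"
      using openin_dom dom_subset by (auto simp: openin_quotient_topology vimage)
    show "open (snd base_chart ` fst base_chart)"
      by (simp add: base_chart_image base_image open_base_range)
    show "continuous_map (subtopology ?T (fst base_chart)) euclidean (snd base_chart)"
      unfolding continuous_map_def
    proof (intro conjI allI impI)
      fix W :: "'n base_coord set" assume "openin euclidean W"
      then have W: "open W" by simp
      have "{q \<in> topspace (subtopology ?T (fst base_chart)). snd base_chart q \<in> W} =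
          {q \<in> fst base_chart. snd base_chart q \<in> W}" (is "_ = ?Q")
        using openin_subset[OF dom] by auto
      moreover have "openin ?T ?Q"
        unfolding openin_quotient_topology
      proof
        show "?Q \<subseteq> proj_plus ` topspace (top_of_set sphere_set)" using dom_subset by auto
        have "{z \<in> sphere_set. proj_plus z \<in> ?Q} = sphere_set \<inter> (half_space \<inter> base -` W)"
          by (simp add: proj_plus_in_base_dom_iff base_chart_proj_plus) (auto simp: dom_def)
        then show "openin (top_of_set sphere_set)
            {z \<in> topspace (top_of_set sphere_set). proj_plus z \<in> ?Q}"
          using continuous_open_preimage[OF continuous_on_base open_half_space W] by (simp add: openin_open_Int)
      qed
      ultimately show "openin (subtopology ?T (fst base_chart))
          {q \<in> topspace (subtopology ?T (fst base_chart)). snd base_chart q \<in> W}"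
        using dom by (simp add: openin_open_subtopology del: fst_base_chart)
    qed simp
    have "continuous_on base_range (\<lambda>x. param (fst x, snd x, 0))"
      by (rule continuous_on_compose2[OF smooth_on_continuous[OF smooth_param]])
        (auto intro!: continuous_intros simp: base_range_def range_set_def)
    then have "continuous_map (top_of_set base_range) (top_of_set sphere_set) (\<lambda>x. param (fst x, snd x, 0))"
      using coord_param(1) dom_subset by (force simp: continuous_map_in_subtopology base_range_def)
    then show "continuous_map (top_of_set (snd base_chart ` fst base_chart)) ?T (\<lambda>x. proj_plus (param (fst x, snd x, 0)))"
      using continuous_map_compose[OF _ quotient_imp_continuous_map[OF quotient_map_quotient_topology], of _ _ _ proj_plus]
      unfolding fst_base_chart base_chart_image base_image comp_def by blast
    show "proj_plus (param (fst (snd base_chart q), snd (snd base_chart q), 0)) = q" if "q \<in> fst base_chart" for q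
      using that proj_plus_param by (auto simp: base_chart_proj_plus)
  qed
  then show ?thesis unfolding prod.collapse .
qed

lemma chart_inv_base_chart:
  assumes "z \<in> dom"
  shows "chart_inv base_chart (base z) = proj_plus z"
  using chart_inv_left[OF is_chart_base_chart, of "proj_plus z"] assms by (simp add: base_chart_proj_plus)

text \<open>Seen from any chart \<open>c\<close> of the sphere, the projection is the transition to
  \<open>coord\<close> followed by forgetting a coordinate. The transition has injective, hence
  surjective, derivative.\<close>

lemma base_chart_in_atlas: "base_chart \<in> atlas para_hyperbolic"
proof -
  have "smooth_on (snd c ` (fst c \<inter> proj_plus -` fst base_chart)) (snd base_chart \<circ> proj_plus \<circ> chart_inv c) \<and>
      (\<forall>y\<in>snd c ` (fst c \<inter> proj_plus -` fst base_chart).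
        surj (fderiv (snd base_chart \<circ> proj_plus \<circ> chart_inv c) y))"
    if c: "c \<in> atlas pseudosphere" for c :: "('n para, 'n sphere_coord) chart"
  proof -
    note c' = pseudosphere_atlasD[OF c] and tr = sphere_transition[OF c]
    have W: "fst c \<inter> proj_plus -` fst base_chart = fst c \<inter> dom"
      by (simp add: set_eq_iff proj_plus_in_base_dom_iff)
    have r: "snd base_chart \<circ> proj_plus \<circ> chart_inv c = (\<lambda>y. base (chart_inv c y))"
      by (simp add: comp_def base_chart_proj_plus)
    have half: "chart_inv c y \<in> half_space" if "y \<in> snd c ` (fst c \<inter> dom)" for y
      using that by (auto simp: chart_inv_left[OF c'(1)] dom_def)
    have "surj (fderiv (\<lambda>y. base (chart_inv c y)) y)" if y: "y \<in> snd c ` (fst c \<inter> dom)" for y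
    proof -
      let ?D = "fderiv (coord \<circ> chart_inv c) y"
      have D: "((coord \<circ> chart_inv c) has_derivative ?D) (at y)"
        by (rule smooth_on_has_derivative[OF tr(2) y])
      then have "((\<lambda>y. (fst ((coord \<circ> chart_inv c) y), fst (snd ((coord \<circ> chart_inv c) y)))) has_derivative
          (\<lambda>v. (fst (?D v), fst (snd (?D v))))) (at y)"
        by (intro has_derivative_Pair has_derivative_fst has_derivative_snd)
      then have "fderiv (\<lambda>y. base (chart_inv c y)) y = (\<lambda>v. (fst (?D v), fst (snd (?D v))))"
        by (intro frechet_derivative_eqI) (simp add: coord_def)
      moreover have "surj ?D"
        by (rule linear_injective_imp_surjective[OF has_derivative_linear[OF D] tr(3)[OF y] refl])
      then have "\<exists>v. u = (fst (?D v), fst (snd (?D v)))" for u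
        using surjD[of ?D "(fst u, snd u, 0)"] by (metis fst_conv snd_conv prod.collapse)
      ultimately show ?thesis by (simp add: surj_def)
    qed
    with smooth_base[OF tr(1) smooth_on_subset[OF c'(2)] half] show ?thesis
      unfolding W r by auto
  qed
  then show ?thesis
    using is_chart_base_chart by (simp add: para_hyperbolic_def Let_def)
qed

text \<open>The representation \<open>R\<close> of the projection in the adapted chart of the sphere
  depends on the first two coordinates only, through the transition \<open>?f\<close>. Restriction
  to a slice makes \<open>?f\<close> smooth, and surjectivity of the derivative of \<open>R\<close>,
  which the atlas demands, passes to \<open>?f\<close>. Equal dimensions turn it into injectivity,
  so the inverse is smooth too.\<close>

lemma base_transition:
  assumes d: "d \<in> atlas para_hyperbolic"
  shows "smooth_on (snd base_chart ` (fst base_chart \<inter> fst d)) (snd d \<circ> chart_inv base_chart)"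
    and "smooth_on (snd d ` (fst d \<inter> fst base_chart)) (snd base_chart \<circ> chart_inv d)"
proof -
  note d' = para_hyperbolic_atlasD[OF d]
  let ?V = "snd base_chart ` (fst base_chart \<inter> fst d)"
  let ?f = "snd d \<circ> chart_inv base_chart"
  let ?W = "coord ` (dom \<inter> proj_plus -` fst d)"
  define R where "R = snd d \<circ> proj_plus \<circ> chart_inv sphere_chart"
  have R: "smooth_on ?W R" and R_surj: "\<And>y. y \<in> ?W \<Longrightarrow> surj (fderiv R y)"
    using d'(2,3)[OF sphere_chart_in_atlas] by (simp_all add: R_def)
  have V: "open ?V"
    using open_chart_image[OF is_chart_base_chart] d'(1) by (simp add: is_chart_def)
  have dom_d: "fst base_chart \<inter> fst d = proj_plus ` (dom \<inter> proj_plus -` fst d)" by auto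
  have V_eq: "?V = base ` (dom \<inter> proj_plus -` fst d)"
    unfolding dom_d base_chart_image ..
  have W: "open ?W"
  proof -
    have "openin (top_of_set sphere_set) {z \<in> sphere_set. proj_plus z \<in> fst d}"
      using d'(1) by (simp add: is_chart_def openin_quotient_topology)
    moreover have W_eq: "dom \<inter> proj_plus -` fst d = fst sphere_chart \<inter> {z \<in> sphere_set. proj_plus z \<in> fst d}"
      using dom_subset by auto
    ultimately have "open (snd sphere_chart ` (fst sphere_chart \<inter> {z \<in> sphere_set. proj_plus z \<in> fst d}))"
      using open_chart_image[OF is_chart_sphere_chart] by blast
    then show ?thesis
      unfolding W_eq by simp
  qed
  have fR: "?f (fst y, fst (snd y)) = R y" if y: "y \<in> ?W" for y
  proof -
    obtain z where z: "z \<in> dom" "y = coord z" using y by blast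
    then have "(fst y, fst (snd y)) = base z" "chart_inv sphere_chart y = z"
      using chart_inv_left[OF is_chart_sphere_chart, of z] by (simp_all add: coord_def)
    with z show ?thesis by (simp add: R_def chart_inv_base_chart)
  qed
  \<comment> \<open>Every orbit in the domain meets the slice where the last coordinate is
    0.\<close>
  have VW: "(fst x, snd x, 0) \<in> ?W" if x: "x \<in> ?V" for x
  proof -
    obtain z where z: "z \<in> dom" "proj_plus z \<in> fst d" "x = base z" using x V_eq by blast
    then have "0 < denom x" using param_coord(2) by simp
    moreover have "proj_plus (param (fst x, snd x, 0)) = proj_plus z" using proj_plus_param z by metis
    ultimately show ?thesis
      using coord_param[of "(fst x, snd x, 0)"] z by (intro image_eqI[of _ _ "param (fst x, snd x, 0)"]) auto
  qed
  have "smooth_on ?V (\<lambda>x. R (fst x, snd x, 0))"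
    by (rule smooth_on_compose[OF V W VW _ R])
      (assumption, intro smooth_on_linear bounded_linear_Pair bounded_linear_fst bounded_linear_snd bounded_linear_zero)
  then show f: "smooth_on ?V ?f"
    by (rule smooth_on_cong[OF V]) (use fR[OF VW] in auto)
  have inj: "inj (fderiv ?f x)" if x: "x \<in> ?V" for x
  proof -
    let ?y = "(fst x, snd x, 0) :: 'n sphere_coord"
    have "((\<lambda>y. ?f (fst y, fst (snd y))) has_derivative
        (\<lambda>v. fderiv ?f x (fst v, fst (snd v)))) (at ?y)"
    proof (rule has_derivative_compose[where f = "\<lambda>y. (fst y, fst (snd y))" and g = ?f
          and f' = "\<lambda>v. (fst v, fst (snd v))" and g' = "fderiv ?f x"])
      show "((\<lambda>y :: 'n sphere_coord. (fst y, fst (snd y))) has_derivative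
          (\<lambda>v. (fst v, fst (snd v)))) (at ?y)"
        by (intro has_derivative_Pair has_derivative_fst has_derivative_snd has_derivative_ident)
      show "(?f has_derivative fderiv ?f x) (at (fst ?y, fst (snd ?y)))"
        using smooth_on_has_derivative[OF f x] by simp
    qed
    then have "(R has_derivative (\<lambda>v. fderiv ?f x (fst v, fst (snd v)))) (at ?y)"
      by (rule has_derivative_transform_within_open[OF _ W VW[OF x] fR])
    from R_surj[OF VW[OF x], unfolded frechet_derivative_eqI[OF this]]
    have "\<exists>v. u = fderiv ?f x v" for u
      by (drule_tac y = u in surjD) blast
    then have "surj (fderiv ?f x)" unfolding surj_def by blast
    then show ?thesis
      by (rule linear_surjective_imp_injective[OF linear_frechet_derivative[OF smooth_on_differentiable[OF f x]] _ refl])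
  qed
  have gf: "(snd base_chart \<circ> chart_inv d) (?f x) = x" if "x \<in> ?V" for x
    using that chart_inv_left[OF d'(1)] chart_inv_left[OF is_chart_base_chart] by auto
  have im: "?f ` ?V = snd d ` (fst d \<inter> fst base_chart)"
  proof -
    have "(\<lambda>q. chart_inv base_chart (snd base_chart q)) ` (fst base_chart \<inter> fst d) = fst d \<inter> fst base_chart"
      using chart_inv_left[OF is_chart_base_chart] by (simp add: Int_commute cong: image_cong_simp)
    then have "snd d ` (\<lambda>q. chart_inv base_chart (snd base_chart q)) ` (fst base_chart \<inter> fst d) =
        snd d ` (fst d \<inter> fst base_chart)" by simp
    then show ?thesis by (simp only: image_image o_apply)
  qed
  show "smooth_on (snd d ` (fst d \<inter> fst base_chart)) (snd base_chart \<circ> chart_inv d)"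
    using smooth_on_inverse_map[OF V f gf inj] unfolding im .
qed

end

lemma smooth_atlas_pseudosphere:
  "smooth_atlas (pseudosphere :: ('n::finite para, 'n sphere_coord) manifold)"
proof (rule smooth_atlasI)
  fix z :: "'n para"
  assume "z \<in> points (pseudosphere :: ('n para, 'n sphere_coord) manifold)"
  then have "z \<in> sphere_set" by simp
  then obtain L K L' K' where "adapted_chart (fst z) (snd z) L K L' K'"
    by (rule adapted_chart_exists)
  then interpret adapted_chart "fst z" "snd z" L K L' K' .
  have "smooth_on (\<kappa> ` A) (g \<circ> chart_inv sphere_chart)"
    if "open (\<kappa> ` A)" "\<kappa> ` A \<subseteq> range_set" "smooth_on (\<kappa> ` A) (g \<circ> param)"
    for \<kappa> :: "'n para \<Rightarrow> _" and A and g :: "'n para \<Rightarrow> 'n sphere_coord"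
  proof (rule smooth_on_cong[OF that(1,3)])
    fix y assume "y \<in> \<kappa> ` A"
    with that(2) have "y \<in> range_set" by blast
    then show "(g \<circ> param) y = (g \<circ> chart_inv sphere_chart) y" by (simp add: chart_inv_sphere_chart)
  qed
  moreover have "coord ` (dom \<inter> A) \<subseteq> range_set" for A using coord_image by auto
  ultimately have "z \<in> fst sphere_chart \<and>
      (\<forall>d\<in>atlas pseudosphere. smooth_on (snd d ` (fst d \<inter> fst sphere_chart)) (snd sphere_chart \<circ> chart_inv d) \<and>
        smooth_on (snd sphere_chart ` (fst sphere_chart \<inter> fst d)) (snd d \<circ> chart_inv sphere_chart))"
    using center_in_dom sphere_transition by simp
  then show "\<exists>e\<in>atlas pseudosphere. z \<in> fst e \<and>
      (\<forall>d\<in>atlas pseudosphere. smooth_on (snd d ` (fst d \<inter> fst e)) (snd e \<circ> chart_inv d) \<and>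
        smooth_on (snd e ` (fst e \<inter> fst d)) (snd d \<circ> chart_inv e))"
    using sphere_chart_in_atlas by blast
qed (simp add: pseudosphere_atlasD)

lemma smooth_atlas_para_hyperbolic:
  "smooth_atlas (para_hyperbolic :: ('n::finite para set, 'n base_coord) manifold)"
proof (rule smooth_atlasI)
  fix q :: "'n para set"
  assume "q \<in> points (para_hyperbolic :: ('n para set, 'n base_coord) manifold)"
  then obtain z where z: "z \<in> sphere_set" "q = proj_plus z" by (simp add: topspace_quotient_topology) blast
  from z(1) obtain L K L' K' where "adapted_chart (fst z) (snd z) L K L' K'"
    by (rule adapted_chart_exists)
  then interpret adapted_chart "fst z" "snd z" L K L' K' .
  have "q \<in> fst base_chart" using center_in_dom z by simp
  then show "\<exists>e\<in>atlas para_hyperbolic. q \<in> fst e \<and>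
      (\<forall>d\<in>atlas para_hyperbolic. smooth_on (snd d ` (fst d \<inter> fst e)) (snd e \<circ> chart_inv d) \<and>
        smooth_on (snd e ` (fst e \<inter> fst d)) (snd d \<circ> chart_inv e))"
    using base_chart_in_atlas base_transition by blast
qed (simp add: para_hyperbolic_atlasD)

lemma smooth_map_proj_plus:
  "smooth_map (pseudosphere :: ('n::finite para, 'n sphere_coord) manifold) para_hyperbolic proj_plus"
  unfolding smooth_map_def mtop_pseudosphere mtop_para_hyperbolic
proof (intro conjI ballI)
  show "continuous_map (top_of_set sphere_set) (quotient_topology (top_of_set sphere_set) proj_plus)
      (proj_plus :: 'n para \<Rightarrow> 'n para set)"
    by (rule quotient_imp_continuous_map[OF quotient_map_quotient_topology])
qed (rule para_hyperbolic_atlasD(2))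

section \<open>Tangent vectors of the pseudosphere and horizontal lifts\<close>

lemma ghat_eq: "ghat x y = (blinfun_apply (snd x) (fst y) + blinfun_apply (snd y) (fst x)) / 2"
  by (cases x; cases y) simp

lemma ghat_sym: "ghat x y = ghat y x"
  by (simp add: ghat_eq)

lemma ghat_add: "ghat (x + y) z = ghat x z + ghat y z" "ghat z (x + y) = ghat z x + ghat z y"
  by (simp_all add: ghat_eq blinfun.bilinear_simps add_divide_distrib)

lemma ghat_scaleR: "ghat (a *\<^sub>R x) z = a * ghat x z" "ghat z (a *\<^sub>R x) = a * ghat z x"
  by (simp_all add: ghat_eq blinfun.bilinear_simps algebra_simps)

lemma ghat_diff: "ghat (x - y) z = ghat x z - ghat y z" "ghat z (x - y) = ghat z x - ghat z y"
  by (simp_all add: ghat_eq blinfun.bilinear_simps diff_divide_distrib add_divide_distrib)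

lemma has_derivative_ghat:
  assumes "(A has_derivative A') (at y)" "(B has_derivative B') (at y)"
  shows "((\<lambda>y. ghat (A y) (B y)) has_derivative (\<lambda>v. ghat (A y) (B' v) + ghat (A' v) (B y))) (at y)"
proof -
  have *: "((\<lambda>y. blinfun_apply (snd (A y)) (fst (B y)) + blinfun_apply (snd (B y)) (fst (A y))) has_derivative
      (\<lambda>v. (blinfun_apply (snd (A y)) (fst (B' v)) + blinfun_apply (snd (A' v)) (fst (B y))) +
        (blinfun_apply (snd (B y)) (fst (A' v)) + blinfun_apply (snd (B' v)) (fst (A y))))) (at y)"
    by (intro has_derivative_add blinfun.FDERIV has_derivative_fst has_derivative_snd assms)
  show ?thesis
    using has_derivative_mult_right[OF *, of "1/2"] by (simp add: ghat_eq algebra_simps add_divide_distrib)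
qed

lemma ghat_nondegenerate: "(\<And>y. ghat x y = 0) \<Longrightarrow> x = 0"
proof (rule prod_eqI)
  assume g: "\<And>y. ghat x y = 0"
  show "snd x = snd 0"
    using g[of "(v, 0)" for v] by (intro blinfun_eqI) (simp add: ghat_eq blinfun.zero_left)
  have "fst x \<bullet> fst x = 0"
    using g[of "(0, blinfun_inner_left (fst x))"] by (simp add: ghat_eq blinfun.zero_right)
  then show "fst x = fst 0" by simp
qed

definition tangent_sphere :: "'n::finite para \<Rightarrow> 'n para set" where
  "tangent_sphere z = {x. blinfun_apply (snd z) (fst x) + blinfun_apply (snd x) (fst z) = 0}"

text \<open>The velocity at time 0 of the orbit \<open>action t z\<close>.\<close>

definition vertical :: "'n::finite para \<Rightarrow> 'n para" where
  "vertical z = (fst z, - snd z)"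

text \<open>The sphere is the level set 1 of the quadratic form of \<open>ghat\<close>, so
  \<open>z\<close> itself is a unit normal at \<open>z\<close>, and this is the orthogonal
  projection along it.\<close>

definition tan_part :: "'n::finite para \<Rightarrow> 'n para \<Rightarrow> 'n para" where
  "tan_part z x = x - ghat z x *\<^sub>R z"

text \<open>For \<open>z\<close> on the sphere, the orthogonal projection onto
  \<open>horizontal z\<close>. Its kernel is spanned by \<open>(fst z, 0)\<close> and
  \<open>(0, snd z)\<close>, or equally by \<open>z\<close> and \<open>vertical z\<close>.\<close>

definition hor_part :: "'n::finite para \<Rightarrow> 'n para \<Rightarrow> 'n para" where
  "hor_part z x = (fst x - blinfun_apply (snd z) (fst x) *\<^sub>R fst z, snd x - blinfun_apply (snd x) (fst z) *\<^sub>R snd z)"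

lemma horizontal_iff:
  "x \<in> horizontal z \<longleftrightarrow> blinfun_apply (snd z) (fst x) = 0 \<and> blinfun_apply (snd x) (fst z) = 0"
  by (cases x; cases z) simp

lemma horizontal_imp_tangent: "x \<in> horizontal z \<Longrightarrow> x \<in> tangent_sphere z"
  by (simp add: horizontal_iff tangent_sphere_def)

lemma hor_part_horizontal: "z \<in> sphere_set \<Longrightarrow> hor_part z x \<in> horizontal z"
  by (simp add: horizontal_iff hor_part_def sphere_set_iff blinfun.bilinear_simps)

lemma hor_part_id: "x \<in> horizontal z \<Longrightarrow> hor_part z x = x"
  by (simp add: horizontal_iff hor_part_def)

lemma hor_part_add: "hor_part z (x + y) = hor_part z x + hor_part z y"
  by (simp add: hor_part_def blinfun.bilinear_simps algebra_simps)

lemma ghat_hor_part: "y \<in> horizontal z \<Longrightarrow> ghat (hor_part z x) y = ghat x y"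
  by (simp add: ghat_eq hor_part_def horizontal_iff blinfun.bilinear_simps)

lemma hor_part_tangent:
  assumes "x \<in> tangent_sphere z"
  shows "hor_part z x = x - blinfun_apply (snd z) (fst x) *\<^sub>R vertical z"
proof -
  have "blinfun_apply (snd x) (fst z) = - blinfun_apply (snd z) (fst x)"
    using assms by (simp add: tangent_sphere_def eq_neg_iff_add_eq_0 add.commute)
  then show ?thesis by (simp add: hor_part_def vertical_def prod_eq_iff)
qed

lemma ghat_self: "z \<in> sphere_set \<Longrightarrow> ghat z z = 1"
  by (simp add: ghat_eq sphere_set_iff)

lemma tangent_sphere_iff: "x \<in> tangent_sphere z \<longleftrightarrow> ghat z x = 0"
  by (auto simp: tangent_sphere_def ghat_eq)

lemma tan_part_tangent: "z \<in> sphere_set \<Longrightarrow> tan_part z x \<in> tangent_sphere z"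
  by (simp add: tangent_sphere_iff tan_part_def ghat_diff ghat_scaleR ghat_self)

lemma tan_part_id: "x \<in> tangent_sphere z \<Longrightarrow> tan_part z x = x"
  by (simp add: tangent_sphere_iff tan_part_def)

lemma tan_part_add: "tan_part z (x + y) = tan_part z x + tan_part z y"
  by (simp add: tan_part_def ghat_add algebra_simps)

lemma ghat_tan_part: "y \<in> tangent_sphere z \<Longrightarrow> ghat (tan_part z x) y = ghat x y"
  by (simp add: tangent_sphere_iff tan_part_def ghat_diff ghat_scaleR)

lemma ghat_nondegenerate_tangent:
  assumes "z \<in> sphere_set" "x \<in> tangent_sphere z" "\<And>y. y \<in> tangent_sphere z \<Longrightarrow> ghat x y = 0"
  shows "x = 0"
proof (rule ghat_nondegenerate)
  fix y
  show "ghat x y = 0"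
    using assms(3)[OF tan_part_tangent[OF assms(1), of y]] ghat_tan_part[OF assms(2), of y] by (simp add: ghat_sym)
qed

lemma ghat_nondegenerate_horizontal:
  assumes "z \<in> sphere_set" "x \<in> horizontal z" "\<And>y. y \<in> horizontal z \<Longrightarrow> ghat x y = 0"
  shows "x = 0"
proof (rule ghat_nondegenerate)
  fix y
  show "ghat x y = 0"
    using assms(3)[OF hor_part_horizontal[OF assms(1), of y]] ghat_hor_part[OF assms(2), of y] by (simp add: ghat_sym)
qed

text \<open>\<open>hor_part\<close> kills \<open>z\<close>, so it does not distinguish
  \<open>x\<close> from \<open>tan_part z x\<close>, and on tangent vectors it only removes the
  vertical component. This links the covariant derivatives upstairs and downstairs.\<close>

lemma tan_part_minus_hor_part:
  assumes "z \<in> sphere_set"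
  shows "tan_part z x - hor_part z x = blinfun_apply (snd z) (fst (tan_part z x)) *\<^sub>R vertical z"
proof -
  have "hor_part z (tan_part z x) = hor_part z x"
    using assms by (simp add: tan_part_def hor_part_def sphere_set_iff blinfun.bilinear_simps algebra_simps)
  then have "hor_part z x = tan_part z x - blinfun_apply (snd z) (fst (tan_part z x)) *\<^sub>R vertical z"
    using hor_part_tangent[OF tan_part_tangent[OF assms, of x]] by simp
  then show ?thesis by (rule ssubst) simp
qed

lemma sphere_valued_derivative_tangent:
  assumes "open W" "y \<in> W" "\<And>x. x \<in> W \<Longrightarrow> \<gamma> x \<in> sphere_set" "(\<gamma> has_derivative \<gamma>') (at y)"
  shows "\<gamma>' u \<in> tangent_sphere (\<gamma> y)"
proof -
  have "((\<lambda>x. ghat (\<gamma> x) (\<gamma> x)) has_derivative (\<lambda>v. ghat (\<gamma> y) (\<gamma>' v) + ghat (\<gamma>' v) (\<gamma> y))) (at y)"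
    by (rule has_derivative_ghat[OF assms(4,4)])
  moreover have "((\<lambda>x. ghat (\<gamma> x) (\<gamma> x)) has_derivative (\<lambda>v. 0)) (at y)"
    by (rule has_derivative_transform_within_open[OF has_derivative_const assms(1,2)])
      (simp add: ghat_self assms(3))
  ultimately have "ghat (\<gamma> y) (\<gamma>' u) + ghat (\<gamma>' u) (\<gamma> y) = 0"
    by (rule fun_cong[OF has_derivative_unique])
  then show ?thesis by (simp add: tangent_sphere_iff ghat_sym)
qed

section \<open>Abstract tangent vectors of the sphere as ambient vectors\<close>

text \<open>Near a given point, \<open>snd d\<close> applied to \<gamma> is the transition from an
  adapted chart composed with \<open>coord\<close> applied to \<gamma>, and \<open>coord\<close> is
  smooth on an open set of the ambient space.\<close>

lemma smooth_into_pseudosphere: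
  fixes \<gamma> :: "'a::real_normed_vector \<Rightarrow> 'n::finite para"
  assumes W: "open W" and \<gamma>: "smooth_on W \<gamma>" "\<And>y. y \<in> W \<Longrightarrow> \<gamma> y \<in> sphere_set"
    and d: "d \<in> atlas pseudosphere" "\<And>y. y \<in> W \<Longrightarrow> \<gamma> y \<in> fst d"
  shows "smooth_on W (\<lambda>y. snd d (\<gamma> y))"
proof (rule smooth_on_local)
  fix y0 assume y0: "y0 \<in> W"
  obtain L K L' K' where "adapted_chart (fst (\<gamma> y0)) (snd (\<gamma> y0)) L K L' K'"
    using adapted_chart_exists[OF \<gamma>(2)[OF y0]] by blast
  then interpret adapted_chart "fst (\<gamma> y0)" "snd (\<gamma> y0)" L K L' K' .
  note tr = sphere_transition[OF d(1)]
  let ?V = "W \<inter> \<gamma> -` half_space"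
  have V: "open ?V"
    by (rule continuous_open_preimage[OF smooth_on_continuous[OF \<gamma>(1)] W open_half_space])
  have V_dom: "\<gamma> y \<in> dom" if "y \<in> ?V" for y using that \<gamma>(2) by (simp add: dom_def)
  have "smooth_on ?V (\<lambda>y. coord (\<gamma> y))"
    by (rule smooth_coord[OF V smooth_on_subset[OF \<gamma>(1)]]) auto
  then have "smooth_on ?V (\<lambda>y. (snd d \<circ> param) (coord (\<gamma> y)))"
    by (intro smooth_on_compose[OF V tr(4) _ _ tr(5)]) (use V_dom d(2) in auto)
  then have "smooth_on ?V (\<lambda>y. snd d (\<gamma> y))"
    by (rule smooth_on_cong[OF V]) (simp only: o_apply param_coord(1)[OF V_dom])
  moreover have "y0 \<in> ?V" using center_in_dom y0 by (simp add: dom_def)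
  ultimately show "\<exists>V. open V \<and> y0 \<in> V \<and> smooth_on V (\<lambda>y. snd d (\<gamma> y))" using V by blast
qed

context
  fixes z :: "'n::finite para"
    and S :: "('n para, 'n sphere_coord) manifold"
  assumes z: "z \<in> sphere_set"
  defines "S \<equiv> pseudosphere"
begin

lemma chart_at_pseudosphere: "chart_at S z \<in> charts_at S z"
  using chart_at_in_charts_at[OF smooth_atlas_pseudosphere] z by (simp add: S_def)

context
  fixes c assumes c: "c \<in> charts_at S z"
begin

lemma sphere_chartD:
  "c \<in> atlas pseudosphere" "is_chart (top_of_set sphere_set) c" "z \<in> fst c" "snd c z \<in> snd c ` fst c"
  "smooth_on (snd c ` fst c) (chart_inv c)" "open (snd c ` fst c)" "chart_inv c (snd c z) = z"
  using charts_atD[OF smooth_atlas_pseudosphere c[unfolded S_def]] pseudosphere_atlasD open_chart_range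
    chart_inv_left by simp_all

lemma ambient_chart:
  "X \<in> tangent_space S z \<Longrightarrow> ambient z X = fderiv (chart_inv c) (snd c z) (X c)"
  unfolding ambient_def S_def
  using vdifferential_smooth[OF smooth_atlas_pseudosphere, of c z X "snd c ` fst c" "\<lambda>x. x"]
    sphere_chartD c by (simp add: S_def comp_def)

lemma chart_inv_derivative_tangent:
  "fderiv (chart_inv c) (snd c z) u \<in> tangent_sphere z"
proof -
  have "chart_inv c y \<in> sphere_set" if "y \<in> snd c ` fst c" for y
    using chart_inv_in[OF sphere_chartD(2) that] chart_domain_subset[OF sphere_chartD(2)] by auto
  from sphere_valued_derivative_tangent[OF sphere_chartD(6,4) this smooth_on_has_derivative[OF sphere_chartD(5,4)]]
  show ?thesis by (simp add: sphere_chartD(7))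
qed

context
  fixes W :: "'a::real_normed_vector set" and \<gamma> :: "'a \<Rightarrow> 'n para" and y :: 'a
  assumes W: "open W" and \<gamma>: "smooth_on W \<gamma>" "\<And>y. y \<in> W \<Longrightarrow> \<gamma> y \<in> sphere_set" and y: "y \<in> W" "\<gamma> y = z"
begin

lemma sphere_valued_in_chart:
  obtains V where "open V" "y \<in> V" "V \<subseteq> W" "smooth_on V (\<lambda>y. snd c (\<gamma> y))" "\<And>y. y \<in> V \<Longrightarrow> \<gamma> y \<in> fst c"
proof -
  obtain T where T: "open T" "fst c = sphere_set \<inter> T"
    using sphere_chartD(2) by (auto simp: is_chart_def openin_open)
  define V where "V = W \<inter> \<gamma> -` T"
  have V: "open V"
    unfolding V_def by (rule continuous_open_preimage[OF smooth_on_continuous[OF \<gamma>(1)] W T(1)])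
  have VW: "V \<subseteq> W" by (simp add: V_def)
  have Vc: "\<gamma> y \<in> fst c" if "y \<in> V" for y using that T(2) \<gamma>(2) by (auto simp: V_def)
  have yV: "y \<in> V" using y T(2) sphere_chartD(3) by (auto simp: V_def)
  have "smooth_on V (\<lambda>y. snd c (\<gamma> y))"
    by (rule smooth_into_pseudosphere[OF V smooth_on_subset[OF \<gamma>(1) VW] \<gamma>(2) sphere_chartD(1) Vc])
      (use VW in auto)
  from that[OF V yV VW this Vc] show ?thesis .
qed

lemma sphere_valued_derivative:
  "fderiv \<gamma> y u =
    fderiv (chart_inv c) (snd c z) (fderiv (\<lambda>y. snd c (\<gamma> y)) y u)"
proof -
  obtain V where V: "open V" "y \<in> V" "V \<subseteq> W" and sm: "smooth_on V (\<lambda>y. snd c (\<gamma> y))"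
    and Vc: "\<And>y. y \<in> V \<Longrightarrow> \<gamma> y \<in> fst c" using sphere_valued_in_chart by blast
  have c': "(chart_inv c has_derivative fderiv (chart_inv c) (snd c z)) (at (snd c (\<gamma> y)))"
    using smooth_on_has_derivative[OF sphere_chartD(5,4)] y(2) by simp
  have "((\<lambda>y. chart_inv c (snd c (\<gamma> y))) has_derivative (\<lambda>u. fderiv (chart_inv c) (snd c z)
      (fderiv (\<lambda>y. snd c (\<gamma> y)) y u))) (at y)"
    by (rule has_derivative_compose[OF smooth_on_has_derivative[OF sm V(2)] c'])
  then have "(\<gamma> has_derivative (\<lambda>u. fderiv (chart_inv c) (snd c z)
      (fderiv (\<lambda>y. snd c (\<gamma> y)) y u))) (at y)"
    by (rule has_derivative_transform_within_open[OF _ V(1,2)]) (simp add: chart_inv_left[OF sphere_chartD(2) Vc])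
  from frechet_derivative_eqI[OF this] show ?thesis by (rule fun_cong)
qed

end

text \<open>A curve on the sphere with velocity \<open>x\<close> realises the vector: the straight
  line through \<open>z\<close>, with its second component rescaled to return to the sphere. The
  pairing \<open>?\<delta>\<close> has derivative 0 at 0 exactly because \<open>x\<close> is
  tangent, so the rescaling does not change the velocity.\<close>

lemma chart_inv_derivative_range:
  assumes "x \<in> tangent_sphere z"
  shows "\<exists>u. fderiv (chart_inv c) (snd c z) u = x"
proof -
  let ?\<delta> = "\<lambda>s::real. blinfun_apply (snd z + s *\<^sub>R snd x) (fst z + s *\<^sub>R fst x)"
  define \<gamma> where "\<gamma> = (\<lambda>s. (fst z + s *\<^sub>R fst x, inverse (?\<delta> s) *\<^sub>R (snd z + s *\<^sub>R snd x)))"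
  have lin: "smooth_on UNIV (\<lambda>s::real. fst z + s *\<^sub>R fst x)" "smooth_on UNIV (\<lambda>s::real. snd z + s *\<^sub>R snd x)"
    by (intro smooth_on_add smooth_on_const open_UNIV smooth_on_linear bounded_linear_scaleR_left)+
  have \<delta>: "smooth_on UNIV ?\<delta>"
    by (intro smooth_on_bounded_bilinear[OF bounded_bilinear_blinfun_apply] open_UNIV lin)
  have \<delta>0: "?\<delta> 0 = 1" using z by (simp add: sphere_set_iff)
  define W where "W = {s. ?\<delta> s > 0}"
  have W: "open W" unfolding W_def
    by (intro open_Collect_less continuous_on_const smooth_on_continuous[OF \<delta>])
  have "0 \<in> W" using \<delta>0 by (simp add: W_def)
  have sm: "smooth_on W \<gamma>"
    unfolding \<gamma>_def
    by (intro smooth_on_Pair smooth_on_scaleR smooth_on_inverse_real W smooth_on_subset[OF \<delta> subset_UNIV]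
        smooth_on_subset[OF lin(1) subset_UNIV] smooth_on_subset[OF lin(2) subset_UNIV]) (simp add: W_def)
  have sph: "\<gamma> s \<in> sphere_set" if "s \<in> W" for s
    using that by (simp add: \<gamma>_def W_def sphere_set_iff blinfun.scaleR_left)
  have g0: "\<gamma> 0 = z" using z by (simp add: \<gamma>_def sphere_set_iff)
  have l': "((\<lambda>s::real. fst z + s *\<^sub>R fst x) has_derivative (\<lambda>s. s *\<^sub>R fst x)) (at 0)"
    "((\<lambda>s::real. snd z + s *\<^sub>R snd x) has_derivative (\<lambda>s. s *\<^sub>R snd x)) (at 0)"
    by (auto intro!: derivative_eq_intros)
  have "(?\<delta> has_derivative (\<lambda>s. blinfun_apply (snd z + 0 *\<^sub>R snd x) (s *\<^sub>R fst x)
      + blinfun_apply (s *\<^sub>R snd x) (fst z + 0 *\<^sub>R fst x))) (at 0)"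
    by (rule blinfun.FDERIV[OF l'(2,1)])
  also have "(\<lambda>s. blinfun_apply (snd z + 0 *\<^sub>R snd x) (s *\<^sub>R fst x)
      + blinfun_apply (s *\<^sub>R snd x) (fst z + 0 *\<^sub>R fst x)) = (\<lambda>s. 0)"
    using assms by (simp add: tangent_sphere_def blinfun.scaleR_left blinfun.scaleR_right fun_eq_iff flip: distrib_left)
  finally have \<delta>': "(?\<delta> has_derivative (\<lambda>s. 0)) (at 0)" .
  have "((\<lambda>s. inverse (?\<delta> s)) has_derivative (\<lambda>s. - (inverse (?\<delta> 0) * 0 * inverse (?\<delta> 0)))) (at 0)"
    by (rule Deriv.has_derivative_inverse[OF _ \<delta>']) (use z in \<open>simp add: sphere_set_iff\<close>)
  from has_derivative_scaleR[OF this l'(2)]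
  have "((\<lambda>s. inverse (?\<delta> s) *\<^sub>R (snd z + s *\<^sub>R snd x)) has_derivative (\<lambda>s. s *\<^sub>R snd x)) (at 0)"
    using z by (simp add: sphere_set_iff)
  from has_derivative_Pair[OF l'(1) this] have "(\<gamma> has_derivative (\<lambda>s. s *\<^sub>R x)) (at 0)"
    by (simp add: \<gamma>_def scaleR_prod_def)
  from frechet_derivative_eqI[OF this] have "fderiv \<gamma> 0 1 = x" by simp
  then show ?thesis
    using sphere_valued_derivative[OF W sm sph \<open>0 \<in> W\<close> g0, of 1] by metis
qed

lemma inj_chart_inv_derivative: "inj (fderiv (chart_inv c) (snd c z))"
  using pseudosphere_atlasD(3)[OF sphere_chartD(1,4)] .

lemma linear_chart_inv_derivative: "linear (fderiv (chart_inv c) (snd c z))"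
  by (rule has_derivative_linear[OF smooth_on_has_derivative[OF sphere_chartD(5,4)]])

end

lemma ambient_tangent: "X \<in> tangent_space S z \<Longrightarrow> ambient z X \<in> tangent_sphere z"
  using ambient_chart[OF chart_at_pseudosphere] chart_inv_derivative_tangent[OF chart_at_pseudosphere] by simp

lemma ambient_surj:
  assumes "x \<in> tangent_sphere z"
  obtains X where "X \<in> tangent_space S z" "ambient z X = x"
proof -
  note c = chart_at_pseudosphere
  obtain u where u: "fderiv (chart_inv (chart_at S z)) (snd (chart_at S z) z) u = x"
    using chart_inv_derivative_range[OF c assms] by blast
  show ?thesis
  proof (rule that)
    show X: "coord_vec S (chart_at S z) z u \<in> tangent_space S z"
      using coord_vec_tangent[OF smooth_atlas_pseudosphere] c by (simp add: S_def)
    show "ambient z (coord_vec S (chart_at S z) z u) = x"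
      using ambient_chart[OF c X] coord_vec_same[OF smooth_atlas_pseudosphere c[unfolded S_def]] u by (simp add: S_def)
  qed
qed

lemma ambient_inj:
  assumes "X \<in> tangent_space S z" "Y \<in> tangent_space S z" "ambient z X = ambient z Y"
  shows "X = Y"
proof -
  note c = chart_at_pseudosphere
  have "X (chart_at S z) = Y (chart_at S z)"
    using assms ambient_chart[OF c] inj_chart_inv_derivative[OF c] by (simp add: inj_eq)
  then show ?thesis
    using tangent_eqI[OF smooth_atlas_pseudosphere] assms c unfolding S_def by blast
qed

lemma ambient_linear:
  assumes "X \<in> tangent_space S z" "Y \<in> tangent_space S z"
  shows "ambient z (\<lambda>d. a *\<^sub>R X d + b *\<^sub>R Y d) = a *\<^sub>R ambient z X + b *\<^sub>R ambient z Y"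
proof -
  note c = chart_at_pseudosphere
  have "(\<lambda>d. a *\<^sub>R X d + b *\<^sub>R Y d) \<in> tangent_space S z"
    using assms unfolding S_def by (intro tangent_add tangent_scale smooth_atlas_pseudosphere)
  then show ?thesis
    using assms ambient_chart[OF c] linear_chart_inv_derivative[OF c] by (simp add: linear_add linear_scale)
qed

text \<open>A vector of the sphere may be projected by differentiating any sphere-valued map that
  realises it. For a section of the projection this gives back the direction
  \<open>u\<close>.\<close>

lemma sphere_curve_vector:
  fixes \<gamma> :: "'a::euclidean_space \<Rightarrow> 'n para"
    and d :: "('n para set, 'n base_coord) chart"
  assumes W: "open W" and \<gamma>: "smooth_on W \<gamma>" "\<And>y. y \<in> W \<Longrightarrow> \<gamma> y \<in> sphere_set" and y: "y \<in> W" "\<gamma> y = z"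
    and X: "X \<in> tangent_space S z" "ambient z X = fderiv \<gamma> y u"
    and d: "d \<in> charts_at para_hyperbolic (proj_plus z)"
  shows "((\<lambda>y. snd d (proj_plus (\<gamma> y))) has_derivative
      fderiv (\<lambda>y. snd d (proj_plus (\<gamma> y))) y) (at y)"
    and "differential S para_hyperbolic proj_plus z X d = fderiv (\<lambda>y. snd d (proj_plus (\<gamma> y))) y u"
proof -
  let ?c = "chart_at S z"
  note c = chart_at_pseudosphere
  obtain V where V: "open V" "y \<in> V" "V \<subseteq> W" "smooth_on V (\<lambda>y. snd ?c (\<gamma> y))" "\<And>y. y \<in> V \<Longrightarrow> \<gamma> y \<in> fst ?c"
    using sphere_valued_in_chart[OF c W \<gamma> y] by blast
  note Du = sphere_valued_derivative[OF c W \<gamma> y, of u]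
  have Xc: "X ?c = fderiv (\<lambda>y. snd ?c (\<gamma> y)) y u"
    using ambient_chart[OF c X(1)] X(2) Du inj_chart_inv_derivative[OF c] by (simp add: inj_eq)
  note rep = differential_rep[OF smooth_atlas_pseudosphere smooth_atlas_para_hyperbolic smooth_map_proj_plus
      c[unfolded S_def] d X(1)[unfolded S_def]]
  have "((\<lambda>y. (snd d \<circ> proj_plus \<circ> chart_inv ?c) (snd ?c (\<gamma> y))) has_derivative
      (\<lambda>u. fderiv (snd d \<circ> proj_plus \<circ> chart_inv ?c) (snd ?c z)
        (fderiv (\<lambda>y. snd ?c (\<gamma> y)) y u))) (at y)"
    using rep(1) y(2) by (intro has_derivative_compose[OF smooth_on_has_derivative[OF V(4,2)]]) (simp add: S_def comp_def)
  then have *: "((\<lambda>y. snd d (proj_plus (\<gamma> y))) has_derivative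
      (\<lambda>u. fderiv (snd d \<circ> proj_plus \<circ> chart_inv ?c) (snd ?c z)
        (fderiv (\<lambda>y. snd ?c (\<gamma> y)) y u))) (at y)"
    by (rule has_derivative_transform_within_open[OF _ V(1,2)])
      (simp add: chart_inv_left[OF sphere_chartD(2)[OF c] V(5)])
  then show "((\<lambda>y. snd d (proj_plus (\<gamma> y))) has_derivative
      fderiv (\<lambda>y. snd d (proj_plus (\<gamma> y))) y) (at y)"
    by (simp only: frechet_derivative_eqI[OF *])
  show "differential S para_hyperbolic proj_plus z X d = fderiv (\<lambda>y. snd d (proj_plus (\<gamma> y))) y u"
    using rep(2) Xc frechet_derivative_eqI[OF *] by (simp add: S_def)
qed

end

context
  fixes M :: "('m, 'e::euclidean_space) manifold" and F :: "'m \<Rightarrow> 'n::finite para"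
  assumes M: "smooth_atlas M" and F: "smooth_map M pseudosphere F"
begin

lemma smooth_map_in_sphere: "p \<in> points M \<Longrightarrow> F p \<in> sphere_set"
  using smooth_map_point[OF M smooth_atlas_pseudosphere F] by simp

lemma ambient_differential:
  assumes p: "p \<in> points M" and X: "X \<in> tangent_space M p"
  shows "ambient (F p) (differential M pseudosphere F p X) = vdifferential M F p X"
proof -
  note z = smooth_map_in_sphere[OF p]
  note c = chart_at_pseudosphere[OF z]
  have "(((\<lambda>x. x) \<circ> chart_inv (chart_at pseudosphere (F p))) has_derivative
      fderiv (chart_inv (chart_at pseudosphere (F p))) (snd (chart_at pseudosphere (F p)) (F p)))
      (at (snd (chart_at pseudosphere (F p)) (F p)))"
    using smooth_on_has_derivative[OF sphere_chartD(5,4)[OF z c]] by (simp add: comp_def)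
  from differential_chain[OF M smooth_atlas_pseudosphere F p c X this]
  have "vdifferential M F p X = fderiv (chart_inv (chart_at pseudosphere (F p)))
      (snd (chart_at pseudosphere (F p)) (F p)) (differential M pseudosphere F p X (chart_at pseudosphere (F p)))"
    by (simp add: comp_def)
  also have "\<dots> = ambient (F p) (differential M pseudosphere F p X)"
    by (rule ambient_chart[OF z c differential_tangent[OF M smooth_atlas_pseudosphere F X p], symmetric])
  finally show ?thesis ..
qed

lemma smooth_map_ambient:
  assumes c: "c \<in> atlas M"
  shows "smooth_on (snd c ` fst c) (F \<circ> chart_inv c)"
proof (rule smooth_on_local)
  note cc = atlas_chart[OF M c]
  fix y assume "y \<in> snd c ` fst c"
  then obtain p where p: "p \<in> fst c" "y = snd c p" by blast
  then have "p \<in> points M" using chart_domain_subset[OF cc] by blast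
  note z = smooth_map_in_sphere[OF this]
  let ?d = "chart_at pseudosphere (F p)"
  note d = chart_at_pseudosphere[OF z]
  note d' = sphere_chartD[OF z d]
  let ?W = "snd c ` (fst c \<inter> F -` fst ?d)"
  note W = smooth_map_chart_rep[OF M smooth_atlas_pseudosphere F c d'(1)]
  have "smooth_on ?W (\<lambda>y. chart_inv ?d ((snd ?d \<circ> F \<circ> chart_inv c) y))"
    by (rule smooth_on_compose[OF W(1) d'(6) _ W(2) d'(5)]) (auto simp: chart_inv_left[OF cc])
  then have "smooth_on ?W (F \<circ> chart_inv c)"
    by (rule smooth_on_cong[OF W(1)]) (auto simp: chart_inv_left[OF cc] chart_inv_left[OF d'(2)])
  moreover have "y \<in> ?W" using p d'(3) by blast
  ultimately show "\<exists>T. open T \<and> y \<in> T \<and> smooth_on T (F \<circ> chart_inv c)" using W(1) by blast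
qed

end

lemma bounded_linear_action: "bounded_linear (action t :: 'n::finite para \<Rightarrow> 'n para)"
proof -
  have "bounded_linear (\<lambda>z :: 'n para. (exp t *\<^sub>R fst z, exp (- t) *\<^sub>R snd z))"
    by (intro bounded_linear_Pair bounded_linear_compose[OF bounded_linear_scaleR_right]
        bounded_linear_fst bounded_linear_snd)
  then show ?thesis by (simp add: action_eq[abs_def])
qed

lemma smooth_map_action:
  "smooth_map (pseudosphere :: ('n::finite para, 'n sphere_coord) manifold) pseudosphere (action t)"
  unfolding smooth_map_def mtop_pseudosphere
proof (intro conjI ballI)
  show cont: "continuous_map (top_of_set sphere_set) (top_of_set sphere_set) (action t :: 'n para \<Rightarrow> 'n para)"
    using linear_continuous_on[OF bounded_linear_action]
    by (simp add: continuous_map_in_subtopology Pi_iff del: action.simps)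
  fix c d :: "('n para, 'n sphere_coord) chart"
  assume c: "c \<in> atlas pseudosphere" and d: "d \<in> atlas pseudosphere"
  note c' = pseudosphere_atlasD[OF c] and d' = pseudosphere_atlasD[OF d]
  let ?W = "snd c ` (fst c \<inter> action t -` fst d)"
  have op: "openin (top_of_set sphere_set) {z \<in> sphere_set. action t z \<in> fst d}"
    using cont d'(1) by (simp add: continuous_map_def is_chart_def)
  have eq: "fst c \<inter> action t -` fst d = fst c \<inter> {z \<in> sphere_set. action t z \<in> fst d}"
    using chart_domain_subset[OF c'(1)] by auto
  have W: "open ?W" using open_chart_image[OF c'(1) op] unfolding eq .
  have "smooth_on ?W (\<lambda>y. snd d (action t (chart_inv c y)))"
  proof (rule smooth_into_pseudosphere[OF W _ _ d])
    show "smooth_on ?W (\<lambda>y. action t (chart_inv c y))"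
      by (rule smooth_on_bounded_linear[OF bounded_linear_action W smooth_on_subset[OF c'(2)]]) blast
    fix y assume "y \<in> ?W"
    then obtain z where z: "z \<in> fst c" "action t z \<in> fst d" "y = snd c z" by blast
    then show "action t (chart_inv c y) \<in> fst d" by (simp add: chart_inv_left[OF c'(1)])
    then show "action t (chart_inv c y) \<in> sphere_set" using chart_domain_subset[OF d'(1)] by auto
  qed
  then show "smooth_on ?W (snd d \<circ> action t \<circ> chart_inv c)" by (simp add: comp_def)
qed

section \<open>The kernel of the differential of the projection, and horizontal lifts\<close>

context
  fixes z :: "'n::finite para"
    and S :: "('n para, 'n sphere_coord) manifold"
    and N :: "('n para set, 'n base_coord) manifold"
    and dproj :: "('n para, 'n sphere_coord) tvec \<Rightarrow> ('n para set, 'n base_coord) tvec"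
  assumes z: "z \<in> sphere_set"
  defines "S \<equiv> pseudosphere" and "N \<equiv> para_hyperbolic" and "dproj \<equiv> differential S N proj_plus z"
begin

lemma dproj_linear:
  "X \<in> tangent_space S z \<Longrightarrow> Y \<in> tangent_space S z \<Longrightarrow>
    dproj (\<lambda>d. a *\<^sub>R X d + b *\<^sub>R Y d) = (\<lambda>d. a *\<^sub>R dproj X d + b *\<^sub>R dproj Y d)"
  unfolding dproj_def S_def N_def
  by (rule differential_linear[OF smooth_atlas_pseudosphere smooth_atlas_para_hyperbolic smooth_map_proj_plus])
    (simp_all add: z)

lemma dproj_tangent: "X \<in> tangent_space S z \<Longrightarrow> dproj X \<in> tangent_space N (proj_plus z)"
  unfolding dproj_def S_def N_def
  by (rule differential_tangent[OF smooth_atlas_pseudosphere smooth_atlas_para_hyperbolic smooth_map_proj_plus])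
    (simp_all add: z)

text \<open>In the chart adapted to \<open>z\<close> the projection forgets the last coordinate, and
  the axis of that coordinate is the orbit through \<open>z\<close>, whose velocity is
  \<open>vertical z\<close>.\<close>

lemma dproj_zero_iff:
  assumes Y: "Y \<in> tangent_space S z"
  shows "dproj Y = (\<lambda>_. 0) \<longleftrightarrow> (\<exists>k. ambient z Y = k *\<^sub>R vertical z)"
proof -
  obtain L K L' K' where "adapted_chart (fst z) (snd z) L K L' K'"
    using adapted_chart_exists[OF z] by blast
  then interpret adapted_chart "fst z" "snd z" L K L' K' .
  have zdom: "z \<in> dom" and coord_z: "coord z = 0" and param_0: "param 0 = z"
    using center_in_dom coord_center param_zero by simp_all
  have zero: "0 \<in> range_set"
    using imageI[OF zdom, of coord] unfolding coord_image coord_z .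
  have c: "sphere_chart \<in> charts_at pseudosphere z"
    using sphere_chart_in_atlas zdom by (simp add: charts_at_def)
  have d: "base_chart \<in> charts_at para_hyperbolic (proj_plus z)"
    using base_chart_in_atlas zdom by (simp add: charts_at_def)
  note Y' = Y[unfolded S_def]
  have "((\<lambda>y :: 'n sphere_coord. (fst y, fst (snd y))) has_derivative (\<lambda>v. (fst v, fst (snd v)))) (at 0)"
    by (intro has_derivative_Pair has_derivative_fst has_derivative_snd has_derivative_ident)
  then have "((snd base_chart \<circ> proj_plus \<circ> chart_inv sphere_chart) has_derivative (\<lambda>v. (fst v, fst (snd v)))) (at 0)"
    by (rule has_derivative_transform_within_open[OF _ open_range_set zero])
      (simp only: o_apply chart_inv_sphere_chart base_chart_proj_plus coord_param(3) range_set_def mem_Collect_eq)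
  then have 1: "dproj Y base_chart = (fst (Y sphere_chart), fst (snd (Y sphere_chart)))"
    using differential_rep(2)[OF smooth_atlas_pseudosphere smooth_atlas_para_hyperbolic smooth_map_proj_plus c d Y']
    by (simp add: dproj_def S_def N_def coord_z frechet_derivative_eqI)
  have "fderiv (chart_inv sphere_chart) 0 = fderiv param 0"
    by (rule frechet_derivative_at_cong[OF open_range_set zero]) (rule chart_inv_sphere_chart)
  then have 2: "ambient z Y = fderiv param 0 (Y sphere_chart)"
    using ambient_chart[OF z c Y'] by (simp add: coord_z)
  have line: "((\<lambda>s. param (0, 0, s)) has_derivative (\<lambda>s. fderiv param 0 (0, 0, s))) (at 0)"
  proof (rule has_derivative_compose[where f = "\<lambda>s. (0, 0, s)" and g = param and f' = "\<lambda>s. (0, 0, s)"])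
    show "((\<lambda>s :: real. (0, 0, s) :: 'n sphere_coord) has_derivative (\<lambda>s. (0, 0, s))) (at 0)"
      by (intro has_derivative_Pair has_derivative_const has_derivative_ident)
    show "(param has_derivative fderiv param 0) (at (0, 0, 0))"
      using smooth_on_has_derivative[OF smooth_param zero] by (simp add: zero_prod_def)
  qed
  have act: "param (0, 0, s) = action s z" for s
    using param_action[of s 0 0 0] param_0 by (simp add: zero_prod_def)
  have act': "((\<lambda>s. action s z) has_derivative (\<lambda>s. s *\<^sub>R vertical z)) (at 0)"
    unfolding action_eq vertical_def by (auto intro!: derivative_eq_intros)
  have 3: "fderiv param 0 (0, 0, k) = k *\<^sub>R vertical z" for k
    by (rule fun_cong[OF has_derivative_unique[OF line[unfolded act] act']])
  show ?thesis
  proof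
    assume "dproj Y = (\<lambda>_. 0)"
    then have "Y sphere_chart = (0, 0, snd (snd (Y sphere_chart)))"
      using 1 by (simp add: prod_eq_iff zero_prod_def)
    then obtain k where "Y sphere_chart = (0, 0, k)" by blast
    then have "ambient z Y = k *\<^sub>R vertical z" using 2 3 by simp
    then show "\<exists>k. ambient z Y = k *\<^sub>R vertical z" by blast
  next
    assume "\<exists>k. ambient z Y = k *\<^sub>R vertical z"
    then obtain k where "ambient z Y = k *\<^sub>R vertical z" ..
    then have "fderiv param 0 (Y sphere_chart) = fderiv param 0 (0, 0, k)"
      using 2 3 by simp
    then have "Y sphere_chart = (0, 0, k)" using inj_param_derivative[OF zero] by (simp only: inj_eq)
    then have "dproj Y base_chart = 0" using 1 by (simp add: zero_prod_def)
    then show "dproj Y = (\<lambda>_. 0)"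
      using tangent_eqI[OF smooth_atlas_para_hyperbolic dproj_tangent[OF Y, unfolded N_def]
          tangent_zero[OF smooth_atlas_para_hyperbolic] d] by simp
  qed
qed

lemma dproj_eqI:
  assumes "X \<in> tangent_space S z" "Y \<in> tangent_space S z" "ambient z X - ambient z Y = k *\<^sub>R vertical z"
  shows "dproj X = dproj Y"
proof -
  have D: "(\<lambda>d. 1 *\<^sub>R X d + (- 1) *\<^sub>R Y d) \<in> tangent_space S z"
    unfolding S_def by (intro tangent_add tangent_scale smooth_atlas_pseudosphere) (use assms S_def in auto)
  have "ambient z (\<lambda>d. 1 *\<^sub>R X d + (- 1) *\<^sub>R Y d) = k *\<^sub>R vertical z"
    using ambient_linear[OF z, of X Y 1 "- 1"] assms by (simp add: S_def)
  then have 0: "dproj (\<lambda>d. 1 *\<^sub>R X d + (- 1) *\<^sub>R Y d) = (\<lambda>_. 0)"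
    using dproj_zero_iff[OF D] by blast
  have "1 *\<^sub>R dproj X d + (- 1) *\<^sub>R dproj Y d = 0" for d
    using fun_cong[OF dproj_linear[OF assms(1,2), of 1 "- 1"], of d] by (simp only: 0)
  then show ?thesis by auto
qed

text \<open>The difference of the two vectors is a multiple of \<open>vertical z\<close>. Pairing
  its first component with \<open>snd z\<close> gives the factor, and gives 0 because both vectors
  are horizontal.\<close>

lemma horizontal_vector_unique:
  assumes X: "X \<in> tangent_space S z" "ambient z X \<in> horizontal z"
    and Y: "Y \<in> tangent_space S z" "ambient z Y \<in> horizontal z" and eq: "dproj X = dproj Y"
  shows "X = Y"
proof (rule ambient_inj[OF z X(1)[unfolded S_def] Y(1)[unfolded S_def]])
  have D: "(\<lambda>d. 1 *\<^sub>R X d + (- 1) *\<^sub>R Y d) \<in> tangent_space S z"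
    unfolding S_def by (intro tangent_add tangent_scale smooth_atlas_pseudosphere) (use X Y S_def in auto)
  have "dproj (\<lambda>d. 1 *\<^sub>R X d + (- 1) *\<^sub>R Y d) = (\<lambda>_. 0)"
    unfolding dproj_linear[OF X(1) Y(1)] eq by simp
  then obtain k where "ambient z (\<lambda>d. 1 *\<^sub>R X d + (- 1) *\<^sub>R Y d) = k *\<^sub>R vertical z"
    using dproj_zero_iff[OF D] by blast
  then have k: "ambient z X - ambient z Y = k *\<^sub>R vertical z"
    using ambient_linear[OF z, of X Y 1 "- 1"] X Y by (simp add: S_def)
  have "blinfun_apply (snd z) (fst (ambient z X - ambient z Y)) = 0"
    using X(2) Y(2) by (simp add: horizontal_iff blinfun.diff_right)
  then have "k = 0"
    using z unfolding k by (simp add: vertical_def sphere_set_iff blinfun.scaleR_right)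
  then show "ambient z X = ambient z Y" using k by simp
qed

lemma horizontal_lift_eq:
  assumes "X \<in> tangent_space S z" "ambient z X \<in> horizontal z"
  shows "horizontal_lift z (dproj X) = ambient z X"
  unfolding horizontal_lift_def
proof (rule the_equality)
  show "ambient z X \<in> horizontal z \<and> (\<exists>Xa\<in>tangent_space pseudosphere z. ambient z Xa = ambient z X \<and>
      differential pseudosphere para_hyperbolic proj_plus z Xa = dproj X)"
    using assms by (auto simp: dproj_def S_def N_def)
  fix x assume "x \<in> horizontal z \<and> (\<exists>Xa\<in>tangent_space pseudosphere z. ambient z Xa = x \<and>
      differential pseudosphere para_hyperbolic proj_plus z Xa = dproj X)"
  then obtain Y where Y: "x \<in> horizontal z" "Y \<in> tangent_space S z" "ambient z Y = x" "dproj Y = dproj X"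
    unfolding dproj_def S_def N_def by blast
  then show "x = ambient z X" using horizontal_vector_unique[OF Y(2) _ assms Y(4)] by simp
qed

end

text \<open>The forms on the quotient are evaluated at an unspecified point of the orbit. The action
  preserves horizontality and commutes with the projection, so it carries the lift at
  \<open>z\<close> to the lift at that point.\<close>

lemma horizontal_lift_action:
  fixes z :: "'n::finite para"
  assumes z: "z \<in> sphere_set" and X: "X \<in> tangent_space pseudosphere z" "ambient z X \<in> horizontal z"
  shows "horizontal_lift (action t z) (differential pseudosphere para_hyperbolic proj_plus z X) = action t (ambient z X)"
proof -
  let ?S = "pseudosphere :: ('n para, 'n sphere_coord) manifold"
  note S = smooth_atlas_pseudosphere
  have zS: "z \<in> points ?S" and tz: "action t z \<in> sphere_set" using z by simp_all
  define X' where "X' = differential ?S ?S (action t) z X"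
  have X': "X' \<in> tangent_space ?S (action t z)"
    unfolding X'_def by (rule differential_tangent[OF S S smooth_map_action X(1) zS])
  note c = chart_at_pseudosphere[OF z]
  let ?c = "chart_at ?S z"
  have cd: "(chart_inv ?c has_derivative fderiv (chart_inv ?c) (snd ?c z)) (at (snd ?c z))"
    by (rule smooth_on_has_derivative[OF sphere_chartD(5,4)[OF z c]])
  have "ambient (action t z) X' = vdifferential ?S (action t) z X"
    unfolding X'_def by (rule ambient_differential[OF S smooth_map_action zS X(1)])
  also have "\<dots> = action t (fderiv (chart_inv ?c) (snd ?c z) (X ?c))"
    using bounded_linear.has_derivative[OF bounded_linear_action cd]
    by (intro vdifferential_has_derivative[OF S c X(1)]) (simp add: comp_def)
  also have "\<dots> = action t (ambient z X)" by (simp only: ambient_chart[OF z c X(1)])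
  finally have amb: "ambient (action t z) X' = action t (ambient z X)" .
  have "(proj_plus :: 'n para \<Rightarrow> _) \<circ> action t = proj_plus" by (simp add: comp_def)
  then have "differential ?S para_hyperbolic proj_plus (action t z) X' = differential ?S para_hyperbolic proj_plus z X"
    using differential_compose[OF S S smooth_atlas_para_hyperbolic smooth_map_action[of t] smooth_map_proj_plus zS X(1)]
    by (simp add: X'_def)
  then show ?thesis
    using horizontal_lift_eq[OF tz X'] amb X(2) by (simp add: horizontal_action)
qed

lemma some_in_orbit: "\<exists>t. (SOME z'. z' \<in> proj_plus z) = action t z"
proof -
  have "\<exists>z'. z' \<in> proj_plus z" using in_proj_plus_iff by blast
  then have "(SOME z'. z' \<in> proj_plus z) \<in> proj_plus z" by (rule someI_ex)
  then show ?thesis by (simp add: in_proj_plus_iff)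
qed

context
  fixes z :: "'n::finite para" and X Y
  assumes z: "z \<in> sphere_set" and X: "X \<in> tangent_space pseudosphere z" and Y: "Y \<in> tangent_space pseudosphere z"
begin

lemma hyperbolic_metric_horizontal:
  assumes "ambient z X \<in> horizontal z" "ambient z Y \<in> horizontal z"
  shows "hyperbolic_metric (proj_plus z) (differential pseudosphere para_hyperbolic proj_plus z X)
      (differential pseudosphere para_hyperbolic proj_plus z Y) = ghat (ambient z X) (ambient z Y)"
proof -
  obtain t where "(SOME z'. z' \<in> proj_plus z) = action t z" using some_in_orbit by blast
  then show ?thesis
    using horizontal_lift_action[OF z X assms(1)] horizontal_lift_action[OF z Y assms(2)]
    by (simp add: hyperbolic_metric_def ghat_action)
qed

lemma hyperbolic_symplectic_horizontal:
  assumes "ambient z X \<in> horizontal z" "ambient z Y \<in> horizontal z"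
  shows "hyperbolic_symplectic (proj_plus z) (differential pseudosphere para_hyperbolic proj_plus z X)
      (differential pseudosphere para_hyperbolic proj_plus z Y) = ghat (ambient z X) (para_phi (ambient z Y))"
proof -
  obtain t where "(SOME z'. z' \<in> proj_plus z) = action t z" using some_in_orbit by blast
  then show ?thesis
    using horizontal_lift_action[OF z X assms(1)] horizontal_lift_action[OF z Y assms(2)]
    by (simp add: hyperbolic_symplectic_def ghat_action para_phi_action)
qed

end

text \<open>Replacing a vector by its horizontal part changes it by a vertical one and hence not its
  projection. This form is required for derivatives of a section that is horizontal at one point
  only.\<close>

lemma hyperbolic_metric_hor_part:
  fixes z :: "'n::finite para"
  assumes z: "z \<in> sphere_set" and X: "X \<in> tangent_space pseudosphere z" and Y: "Y \<in> tangent_space pseudosphere z"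
  shows "hyperbolic_metric (proj_plus z) (differential pseudosphere para_hyperbolic proj_plus z X)
      (differential pseudosphere para_hyperbolic proj_plus z Y) = ghat (hor_part z (ambient z X)) (hor_part z (ambient z Y))"
proof -
  have "\<exists>X'\<in>tangent_space pseudosphere z. ambient z X' = hor_part z (ambient z X) \<and>
      differential pseudosphere para_hyperbolic proj_plus z X = differential pseudosphere para_hyperbolic proj_plus z X'"
    if X: "X \<in> tangent_space pseudosphere z" for X
  proof -
    obtain X' where X': "X' \<in> tangent_space pseudosphere z" "ambient z X' = hor_part z (ambient z X)"
      using ambient_surj[OF z horizontal_imp_tangent[OF hor_part_horizontal[OF z]]] by metis
    then have "ambient z X - ambient z X' = blinfun_apply (snd z) (fst (ambient z X)) *\<^sub>R vertical z"
      using hor_part_tangent[OF ambient_tangent[OF z X]] by simp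
    from dproj_eqI[OF z X X'(1) this] X' show ?thesis by blast
  qed
  then obtain X' Y' where XY: "X' \<in> tangent_space pseudosphere z" "ambient z X' = hor_part z (ambient z X)"
    "differential pseudosphere para_hyperbolic proj_plus z X = differential pseudosphere para_hyperbolic proj_plus z X'"
    "Y' \<in> tangent_space pseudosphere z" "ambient z Y' = hor_part z (ambient z Y)"
    "differential pseudosphere para_hyperbolic proj_plus z Y = differential pseudosphere para_hyperbolic proj_plus z Y'"
    using X Y by metis
  then show ?thesis
    using hyperbolic_metric_horizontal[OF z XY(1,4)] hor_part_horizontal[OF z] by simp
qed

section \<open>Covariant derivatives along maps into the pseudosphere and its quotient\<close>

definition second_derivative ::
    "('a::real_normed_vector \<Rightarrow> 'b::real_normed_vector) \<Rightarrow> 'a \<Rightarrow> 'a \<Rightarrow> 'a \<Rightarrow> 'b" where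
  "second_derivative f y u w = fderiv (\<lambda>x. fderiv f x w) y u"

lemma second_derivative_has_derivative:
  "smooth_on V f \<Longrightarrow> y \<in> V \<Longrightarrow>
    ((\<lambda>x. fderiv f x w) has_derivative (\<lambda>u. second_derivative f y u w)) (at y)"
  unfolding second_derivative_def by (rule smooth_on_has_derivative[OF smooth_on_derivative])

lemma second_derivative_commute:
  "open V \<Longrightarrow> smooth_on V f \<Longrightarrow> y \<in> V \<Longrightarrow> second_derivative f y u w = second_derivative f y w u"
  unfolding second_derivative_def by (rule smooth_second_derivative_symmetric)

lemma second_derivative_cong:
  assumes "open V" "y \<in> V" "\<And>x. x \<in> V \<Longrightarrow> f x = g x"
  shows "second_derivative f y u w = second_derivative g y u w"
proof -
  have "fderiv f x w = fderiv g x w" if "x \<in> V" for x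
    by (rule fun_cong[OF frechet_derivative_at_cong[OF assms(1) that assms(3)]])
  from frechet_derivative_at_cong[OF assms(1,2) this]
  show ?thesis unfolding second_derivative_def by (rule fun_cong)
qed

lemma second_derivative_compose:
  fixes f :: "'b::euclidean_space \<Rightarrow> 'c::real_normed_vector" and g :: "'a::real_normed_vector \<Rightarrow> 'b"
  assumes W: "open W" and V: "open V" and y: "y \<in> W" and gV: "\<And>x. x \<in> W \<Longrightarrow> g x \<in> V"
    and g: "smooth_on W g" and f: "smooth_on V f"
  shows "second_derivative (\<lambda>x. f (g x)) y u w =
      second_derivative f (g y) (fderiv g y u) (fderiv g y w) +
      fderiv f (g y) (second_derivative g y u w)"
proof -
  let ?Df = "\<lambda>z. fderiv f z" and ?Dg = "\<lambda>x. fderiv g x"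
  have gy: "g y \<in> V" by (rule gV[OF y])
  have expand: "?Df z v = (\<Sum>b\<in>Basis. (v \<bullet> b) *\<^sub>R ?Df z b)" if "z \<in> V" for z v
    by (rule linear_frechet_derivative_expand[OF smooth_on_differentiable[OF f that]])
  \<comment> \<open>The direction in which \<open>f\<close> is differentiated moves with
    \<open>x\<close>; the basis separates this from the motion of the base point.\<close>
  have comp: "fderiv (\<lambda>x. f (g x)) x w = (\<Sum>b\<in>Basis. (?Dg x w \<bullet> b) *\<^sub>R ?Df (g x) b)"
    if x: "x \<in> W" for x
    unfolding frechet_derivative_compose_at[OF smooth_on_differentiable[OF g x] smooth_on_differentiable[OF f gV[OF x]]]
    by (rule expand[OF gV[OF x]])
  have "((\<lambda>x. \<Sum>b\<in>Basis. (?Dg x w \<bullet> b) *\<^sub>R ?Df (g x) b) has_derivative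
      (\<lambda>u. \<Sum>b\<in>Basis. (?Dg y w \<bullet> b) *\<^sub>R second_derivative f (g y) (?Dg y u) b
        + (second_derivative g y u w \<bullet> b) *\<^sub>R ?Df (g y) b)) (at y)"
    by (intro has_derivative_sum has_derivative_scaleR has_derivative_inner_left
        second_derivative_has_derivative[OF g y]
        has_derivative_compose[OF smooth_on_has_derivative[OF g y] second_derivative_has_derivative[OF f gy]])
  then have "((\<lambda>x. fderiv (\<lambda>x. f (g x)) x w) has_derivative
      (\<lambda>u. \<Sum>b\<in>Basis. (?Dg y w \<bullet> b) *\<^sub>R second_derivative f (g y) (?Dg y u) b
        + (second_derivative g y u w \<bullet> b) *\<^sub>R ?Df (g y) b)) (at y)"
    by (rule has_derivative_transform_within_open[OF _ W y]) (rule comp[symmetric])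
  then have 1: "second_derivative (\<lambda>x. f (g x)) y u w =
      (\<Sum>b\<in>Basis. (?Dg y w \<bullet> b) *\<^sub>R second_derivative f (g y) (?Dg y u) b)
        + (\<Sum>b\<in>Basis. (second_derivative g y u w \<bullet> b) *\<^sub>R ?Df (g y) b)"
    unfolding second_derivative_def[of "\<lambda>x. f (g x)"] sum.distrib[symmetric] by (rule fun_cong[OF frechet_derivative_eqI])
  have "((\<lambda>z. \<Sum>b\<in>Basis. (?Dg y w \<bullet> b) *\<^sub>R ?Df z b) has_derivative
      (\<lambda>v. \<Sum>b\<in>Basis. (?Dg y w \<bullet> b) *\<^sub>R second_derivative f (g y) v b)) (at (g y))"
    by (intro has_derivative_sum has_derivative_scaleR_right second_derivative_has_derivative[OF f gy])
  then have "((\<lambda>z. ?Df z (?Dg y w)) has_derivative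
      (\<lambda>v. \<Sum>b\<in>Basis. (?Dg y w \<bullet> b) *\<^sub>R second_derivative f (g y) v b)) (at (g y))"
    by (rule has_derivative_transform_within_open[OF _ V gy]) (rule expand[symmetric])
  then have "second_derivative f (g y) v (?Dg y w) = (\<Sum>b\<in>Basis. (?Dg y w \<bullet> b) *\<^sub>R second_derivative f (g y) v b)" for v
    unfolding second_derivative_def[of f "g y" v "?Dg y w"] by (rule fun_cong[OF frechet_derivative_eqI])
  then show ?thesis unfolding 1 by (simp only: expand[OF gy, of "second_derivative g y u w"])
qed

text \<open>
  Koszul's formula for a metric that is, near \<open>y0\<close>, the pull-back of \<open>ghat\<close> under a parametrisation \<open>\<phi>\<close>
  up to the square of a 1-form \<open>a\<close> vanishing at \<open>y0\<close>; such a square has no influence on the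
  Christoffel symbols at \<open>y0\<close>.
\<close>

lemma christoffel_parametrization:
  fixes \<phi> :: "'d::euclidean_space \<Rightarrow> 'n::finite para" and a :: "'d \<Rightarrow> 'd \<Rightarrow> real"
  assumes V: "open V" "y0 \<in> V" and \<phi>: "smooth_on V \<phi>"
    and a: "\<And>u. (\<lambda>y. a y u) differentiable (at y0)" "\<And>u. a y0 u = 0"
    and metric: "\<And>y u w. y \<in> V \<Longrightarrow> metric_coeff N g d y u w =
      ghat (fderiv \<phi> y u) (fderiv \<phi> y w) + a y u * a y w"
    and nondeg: "\<And>z. (\<And>x. ghat (fderiv \<phi> y0 z) (fderiv \<phi> y0 x) = 0) \<Longrightarrow> z = 0"
    and z: "\<And>x. ghat (fderiv \<phi> y0 z) (fderiv \<phi> y0 x) =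
      ghat (second_derivative \<phi> y0 u w) (fderiv \<phi> y0 x)"
  shows "christoffel N g d y0 u w = z"
proof -
  let ?D = "fderiv \<phi> y0" and ?D2 = "second_derivative \<phi> y0"
  have m0: "metric_coeff N g d y0 u w = ghat (?D u) (?D w)" for u w
    using metric[OF V(2)] a(2) by simp
  have "((\<lambda>y. metric_coeff N g d y w x) has_derivative
      (\<lambda>u. ghat (?D w) (?D2 u x) + ghat (?D2 u w) (?D x))) (at y0)" for w x
  proof -
    have "((\<lambda>y. ghat (fderiv \<phi> y w) (fderiv \<phi> y x) + a y w * a y x) has_derivative
        (\<lambda>u. (ghat (?D w) (?D2 u x) + ghat (?D2 u w) (?D x)) +
          (a y0 w * fderiv (\<lambda>y. a y x) y0 u + fderiv (\<lambda>y. a y w) y0 u * a y0 x))) (at y0)"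
      by (intro has_derivative_add has_derivative_ghat second_derivative_has_derivative[OF \<phi> V(2)]
          has_derivative_mult differentiable_has_derivative a(1))
    then have "((\<lambda>y. ghat (fderiv \<phi> y w) (fderiv \<phi> y x) + a y w * a y x) has_derivative
        (\<lambda>u. ghat (?D w) (?D2 u x) + ghat (?D2 u w) (?D x))) (at y0)"
      by (simp add: a(2))
    then show ?thesis
      by (rule has_derivative_transform_within_open[OF _ V]) (simp add: metric)
  qed
  note deriv = frechet_derivative_eqI[OF this]
  note commute = second_derivative_commute[OF V(1) \<phi> V(2)]
  \<comment> \<open>Each derivative of a coefficient is a sum of two pairings. By symmetry of
    \<open>?D2\<close>, the four without \<open>?D2 u w\<close> cancel and the remaining two
    coincide.\<close>
  have koszul: "fderiv (\<lambda>y'. metric_coeff N g d y' w x) y0 u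
      + fderiv (\<lambda>y'. metric_coeff N g d y' u x) y0 w
      - fderiv (\<lambda>y'. metric_coeff N g d y' u w) y0 x = 2 * ghat (?D2 u w) (?D x)" for x
    unfolding deriv using commute[of u x] commute[of w x] commute[of w u] by (simp add: ghat_sym)
  show ?thesis
    unfolding christoffel_def
  proof (rule the_equality)
    show "\<forall>x. 2 * metric_coeff N g d y0 z x =
       fderiv (\<lambda>y'. metric_coeff N g d y' w x) y0 u
     + fderiv (\<lambda>y'. metric_coeff N g d y' u x) y0 w
     - fderiv (\<lambda>y'. metric_coeff N g d y' u w) y0 x"
      unfolding koszul m0 z by simp
    fix z' assume "\<forall>x. 2 * metric_coeff N g d y0 z' x =
       fderiv (\<lambda>y'. metric_coeff N g d y' w x) y0 u
     + fderiv (\<lambda>y'. metric_coeff N g d y' u x) y0 w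
     - fderiv (\<lambda>y'. metric_coeff N g d y' u w) y0 x"
    then have z': "ghat (?D z') (?D x) = ghat (?D z) (?D x)" for x unfolding koszul m0 z by simp
    have "linear ?D" by (rule linear_frechet_derivative[OF smooth_on_differentiable[OF \<phi> V(2)]])
    then have "z' - z = 0"
      by (intro nondeg) (simp add: linear_diff ghat_diff z')
    then show "z' = z" by simp
  qed
qed

lemma covariant_derivative_chart:
  fixes M :: "('m, 'e::euclidean_space) manifold" and N :: "('p, 'd::euclidean_space) manifold"
  assumes M: "smooth_atlas M" and N: "smooth_atlas N" and F: "smooth_map M N F"
    and c: "c \<in> charts_at M p" and d: "d \<in> charts_at N (F p)" and X: "X \<in> tangent_space M p"
  defines "x \<equiv> snd d \<circ> F \<circ> chart_inv c"
  shows "covariant_derivative M N g F (\<lambda>q. differential M N F q (coord_vec M c q u)) p X d =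
      second_derivative x (snd c p) (X c) u +
      christoffel N g d (snd d (F p)) (fderiv x (snd c p) (X c)) (fderiv x (snd c p) u)"
proof -
  note c' = charts_atD[OF M c] and d' = charts_atD[OF N d]
  note W = smooth_map_chart_rep[OF M N F c'(1) d'(1)]
  let ?W = "snd c ` (fst c \<inter> F -` fst d)"
  have "vdifferential M (\<lambda>q. differential M N F q (coord_vec M c q u) d) p X =
      fderiv (\<lambda>y. fderiv ((snd d \<circ> F) \<circ> chart_inv c) y u) (snd c p) (X c)"
  proof (rule vdifferential_coord_vec[OF M c X W(1) _ _ W(2)])
    fix q assume q: "q \<in> fst c" "snd c q \<in> ?W"
    then have "F q \<in> fst d" using inj_onD[OF chart_inj[OF c'(2)]] by blast
    then have "d \<in> charts_at N (F q)" using d'(1) by (simp add: charts_at_def)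
    then show "differential M N F q (coord_vec M c q u) d = vdifferential M (snd d \<circ> F) q (coord_vec M c q u)"
      by (simp add: differential_def)
  qed (use c' d' in auto)
  then show ?thesis
    unfolding covariant_derivative_def if_P[OF d] differential_rep(2)[OF M N F c d X]
      differential_rep(2)[OF M N F c d coord_vec_tangent[OF M c]] coord_vec_same[OF M c]
    by (simp add: second_derivative_def x_def)
qed

section \<open>Covariant derivatives along maps into the pseudosphere\<close>

lemma sphere_metric_coeff:
  fixes d :: "('n::finite para, 'n sphere_coord) chart"
  assumes d: "d \<in> atlas pseudosphere" and y: "y \<in> snd d ` fst d"
  shows "metric_coeff pseudosphere sphere_metric d y u w =
      ghat (fderiv (chart_inv d) y u) (fderiv (chart_inv d) y w)"
proof -
  note d' = pseudosphere_atlasD[OF d]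
  have q: "chart_inv d y \<in> fst d" "snd d (chart_inv d y) = y"
    by (rule chart_inv_in[OF d'(1) y], rule chart_inv_right[OF d'(1) y])
  then have c: "d \<in> charts_at pseudosphere (chart_inv d y)" using d by (simp add: charts_at_def)
  have "chart_inv d y \<in> sphere_set" using q chart_domain_subset[OF d'(1)] by auto
  then have "ambient (chart_inv d y) (coord_vec pseudosphere d (chart_inv d y) u) = fderiv (chart_inv d) y u" for u
    using ambient_chart[OF _ c coord_vec_tangent[OF smooth_atlas_pseudosphere c]]
      coord_vec_same[OF smooth_atlas_pseudosphere c] q(2) by simp
  then show ?thesis by (simp add: metric_coeff_def sphere_metric_def Let_def)
qed

text \<open>This is Gauss's formula. The inverse chart is an isometric parametrisation, so its
  derivative maps the Christoffel vector to the tangential part of its second derivative. The chain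
  rule for \<open>F\<close> written as the inverse chart after its coordinates adds exactly the
  missing term.\<close>

lemma covariant_derivative_pseudosphere:
  fixes M :: "('m, 'e::euclidean_space) manifold" and F :: "'m \<Rightarrow> 'n::finite para"
  assumes M: "smooth_atlas M" and F: "smooth_map M pseudosphere F"
    and c: "c \<in> charts_at M p" and X: "X \<in> tangent_space M p"
    and C: "C \<in> tangent_space pseudosphere (F p)"
      "ambient (F p) C = tan_part (F p) (second_derivative (F \<circ> chart_inv c) (snd c p) (X c) u)"
  shows "covariant_derivative M pseudosphere sphere_metric F (\<lambda>q. differential M pseudosphere F q (coord_vec M c q u)) p X = C"
proof
  fix d :: "('n para, 'n sphere_coord) chart"
  note S = smooth_atlas_pseudosphere and c' = charts_atD[OF M c]
  have z: "F p \<in> sphere_set" by (rule smooth_map_in_sphere[OF M F c'(4)])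
  show "covariant_derivative M pseudosphere sphere_metric F (\<lambda>q. differential M pseudosphere F q (coord_vec M c q u)) p X d = C d"
  proof (cases "d \<in> charts_at pseudosphere (F p)")
    case False
    then show ?thesis using tangent_outside[OF S C(1)] by (simp add: covariant_derivative_def)
  next
    case d: True
    note d' = sphere_chartD[OF z d]
    let ?\<phi> = "chart_inv d" and ?\<zeta> = "F \<circ> chart_inv c" and ?x = "snd d \<circ> F \<circ> chart_inv c"
    let ?y = "snd c p" and ?yd = "snd d (F p)"
    let ?W = "snd c ` (fst c \<inter> F -` fst d)"
    note W = smooth_map_chart_rep[OF M S F c'(1) d'(1)]
    let ?D = "fderiv ?\<phi> ?yd"
    have y: "?y \<in> ?W" using c' d' by auto
    have x0: "?x ?y = ?yd" by (simp add: chart_inv_left[OF c'(2,3)])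
    have xV: "?x y \<in> snd d ` fst d" if "y \<in> ?W" for y
      using that by (auto simp: chart_inv_left[OF c'(2)])
    have lin: "linear ?D" by (rule linear_chart_inv_derivative[OF z d])
    define v w where "v = fderiv ?x ?y (X c)" and "w = fderiv ?x ?y u"
    obtain \<gamma> where \<gamma>: "?D \<gamma> = tan_part (F p) (second_derivative ?\<phi> ?yd v w)"
      using chart_inv_derivative_range[OF z d tan_part_tangent[OF z]] by blast
    have chr: "christoffel pseudosphere sphere_metric d ?yd v w = \<gamma>"
    proof (rule christoffel_parametrization[where a = "\<lambda>y u. 0", OF d'(6,4,5)])
      show "metric_coeff pseudosphere sphere_metric d y u w =
          ghat (fderiv ?\<phi> y u) (fderiv ?\<phi> y w) + 0 * 0"
        if "y \<in> snd d ` fst d" for y u w using sphere_metric_coeff[OF d'(1) that] by simp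
      show "ghat (?D \<gamma>) (?D x) = ghat (second_derivative ?\<phi> ?yd v w) (?D x)" for x
        unfolding \<gamma> by (rule ghat_tan_part[OF chart_inv_derivative_tangent[OF z d]])
      fix z' assume *: "\<And>x. ghat (?D z') (?D x) = 0"
      have "?D z' = 0"
        using * chart_inv_derivative_range[OF z d]
        by (intro ghat_nondegenerate_tangent[OF z chart_inv_derivative_tangent[OF z d]]) metis
      then show "z' = 0" using inj_chart_inv_derivative[OF z d] lin by (metis linear_injective_0)
    qed simp_all
    have "second_derivative ?\<zeta> ?y (X c) u = second_derivative (\<lambda>y. ?\<phi> (?x y)) ?y (X c) u"
      by (rule second_derivative_cong[OF W(1) y])
        (auto simp: chart_inv_left[OF c'(2)] chart_inv_left[OF d'(2)])
    also have "\<dots> = second_derivative ?\<phi> ?yd v w + ?D (second_derivative ?x ?y (X c) u)"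
      using second_derivative_compose[OF W(1) d'(6) y xV W(2) d'(5)] by (simp only: x0 v_def w_def)
    finally have "tan_part (F p) (second_derivative ?\<zeta> ?y (X c) u) = ?D \<gamma> + ?D (second_derivative ?x ?y (X c) u)"
      by (simp only: tan_part_add \<gamma> tan_part_id[OF chart_inv_derivative_tangent[OF z d]])
    also have "\<dots> = ?D (second_derivative ?x ?y (X c) u + \<gamma>)" by (simp add: linear_add[OF lin] add.commute)
    finally have "?D (C d) = ?D (second_derivative ?x ?y (X c) u + \<gamma>)"
      using C ambient_chart[OF z d C(1)] by simp
    then have "C d = second_derivative ?x ?y (X c) u + \<gamma>"
      using inj_chart_inv_derivative[OF z d] by (simp only: inj_eq)
    then show ?thesis
      unfolding covariant_derivative_chart[OF M S F c d X] using chr by (simp add: v_def w_def)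
  qed
qed

section \<open>Covariant derivatives along maps into the quotient\<close>

text \<open>The section is the slice of the chart adapted to \<open>z\<close> where the last
  coordinate is 0. Its centre has to be \<open>z\<close>: at other points \<open>snd z\<close> is in
  general not the functional that defines the horizontal space.\<close>

lemma horizontal_section:
  fixes z :: "'n::finite para" and d :: "('n para set, 'n base_coord) chart"
  assumes z: "z \<in> sphere_set" and d: "d \<in> charts_at para_hyperbolic (proj_plus z)"
  obtains V s where "open V" "snd d (proj_plus z) \<in> V" "V \<subseteq> snd d ` fst d" "smooth_on V s"
    "\<And>y. y \<in> V \<Longrightarrow> s y \<in> sphere_set" "\<And>y. y \<in> V \<Longrightarrow> proj_plus (s y) = chart_inv d y"
    "s (snd d (proj_plus z)) = z" "\<And>u. fderiv s (snd d (proj_plus z)) u \<in> horizontal z"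
proof -
  obtain L K L' K' where "adapted_chart (fst z) (snd z) L K L' K'"
    using adapted_chart_exists[OF z] by blast
  then interpret adapted_chart "fst z" "snd z" L K L' K' .
  note d' = charts_atD[OF smooth_atlas_para_hyperbolic d]
  note dc = d'(2)[unfolded mtop_para_hyperbolic]
  let ?V = "snd d ` (fst d \<inter> fst base_chart)"
  define b where "b = snd base_chart \<circ> chart_inv d"
  define s where "s = (\<lambda>y. param (fst (b y), snd (b y), 0))"
  have V: "open ?V"
    using open_chart_image[OF dc] is_chart_base_chart by (simp add: is_chart_def)
  have b: "smooth_on ?V b"
    unfolding b_def by (rule base_transition(2)[OF d'(1)])
  have V_dom: "\<exists>z'. z' \<in> dom \<and> chart_inv d y = proj_plus z' \<and> b y = base z'" if y: "y \<in> ?V" for y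
  proof -
    obtain z' where "z' \<in> dom" "proj_plus z' \<in> fst d" "y = snd d (proj_plus z')" using y by auto
    then show ?thesis by (intro exI[of _ z']) (simp add: b_def chart_inv_left[OF dc] base_chart_proj_plus)
  qed
  have b_range: "(fst (b y), snd (b y), 0) \<in> range_set" if y: "y \<in> ?V" for y
    using V_dom[OF y] param_coord(2) by (auto simp: range_set_def)
  have sm: "smooth_on ?V s"
    unfolding s_def
    by (rule smooth_on_compose[OF V open_range_set b_range _ smooth_param], assumption)
      (intro smooth_on_Pair V smooth_on_fst smooth_on_snd smooth_on_const b)
  have sph: "s y \<in> sphere_set" if y: "y \<in> ?V" for y
    using coord_param(1)[of "(fst (b y), snd (b y), 0)"] b_range[OF y] dom_subset by (auto simp: s_def range_set_def)
  have proj: "proj_plus (s y) = chart_inv d y" if y: "y \<in> ?V" for y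
    using V_dom[OF y] proj_plus_param by (auto simp: s_def)
  have zd: "z \<in> dom" using center_in_dom by simp
  let ?y = "snd d (proj_plus z)"
  have y: "?y \<in> ?V" using d' zd by auto
  have "b ?y = 0"
    using coord_center by (simp add: b_def chart_inv_left[OF dc d'(3)] base_chart_proj_plus coord_def prod_eq_iff)
  then have sy: "s ?y = z" using param_zero by (simp add: s_def zero_prod_def)
  have "fderiv s ?y u \<in> horizontal z" for u
  proof -
    have D: "(s has_derivative fderiv s ?y) (at ?y)"
      by (rule smooth_on_has_derivative[OF sm y])
    have T: "fderiv s ?y u \<in> tangent_sphere z"
      using sphere_valued_derivative_tangent[OF V y sph D] by (simp only: sy)
    \<comment> \<open>The section lies in the affine subspace where \<open>\<alpha>0\<close> is 1 on the first component.\<close>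
    have "((\<lambda>y. blinfun_apply (snd z) (fst (s y))) has_derivative
        (\<lambda>u. blinfun_apply (snd z) (fst (fderiv s ?y u)))) (at ?y)"
      by (intro bounded_linear.has_derivative[OF blinfun.bounded_linear_right] has_derivative_fst D)
    moreover have "(\<lambda>y. blinfun_apply (snd z) (fst (s y))) = (\<lambda>y. 1)"
      using unit by (simp add: s_def param_def blinfun.add_right)
    ultimately have "blinfun_apply (snd z) (fst (fderiv s ?y u)) = 0"
      using fun_cong[OF has_derivative_unique[OF _ has_derivative_const[of 1]], of _ ?y u] by simp
    with T show ?thesis by (simp add: horizontal_iff tangent_sphere_def)
  qed
  then show ?thesis using that[of ?V s] V y sm sph proj sy by auto
qed

text \<open>\<open>vertical z\<close> has square -1 under \<open>ghat\<close>, so removing vertical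
  components adds their product. This product is the square of a 1-form that
  \<open>christoffel_parametrization\<close> tolerates.\<close>

lemma ghat_hor_part_hor_part:
  assumes z: "z \<in> sphere_set" and x: "x \<in> tangent_sphere z" and y: "y \<in> tangent_sphere z"
  shows "ghat (hor_part z x) (hor_part z y) =
      ghat x y + blinfun_apply (snd z) (fst x) * blinfun_apply (snd z) (fst y)"
proof -
  have "ghat (hor_part z x) (hor_part z y) = ghat x (hor_part z y)"
    by (rule ghat_hor_part[OF hor_part_horizontal[OF z]])
  also have "\<dots> = ghat x y - blinfun_apply (snd z) (fst y) * ghat x (vertical z)"
    by (simp add: hor_part_tangent[OF y] ghat_diff ghat_scaleR)
  also have "ghat x (vertical z) = - blinfun_apply (snd z) (fst x)"
    using x by (simp add: ghat_eq vertical_def tangent_sphere_def blinfun.minus_left)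
  finally show ?thesis by simp
qed

text \<open>The action scales the two components of \<zeta> by reciprocal factors. Horizontality at
  \<open>y\<close> makes these factors stationary, so the second derivatives differ in the first
  component by a multiple of \<open>fst (\<zeta> y)\<close> and in the second by one of
  \<open>snd (\<zeta> y)\<close>, and \<open>hor_part\<close> removes both.\<close>

lemma hor_part_second_derivative_scaled:
  fixes \<eta> \<zeta> :: "'a::real_normed_vector \<Rightarrow> 'n::finite para"
  assumes W: "open W" "y \<in> W" and \<eta>: "smooth_on W \<eta>" and \<zeta>: "smooth_on W \<zeta>"
    and sph: "\<And>x. x \<in> W \<Longrightarrow> \<zeta> x \<in> sphere_set" "\<And>x. x \<in> W \<Longrightarrow> \<exists>t. \<eta> x = action t (\<zeta> x)"
    and eq: "\<eta> y = \<zeta> y"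
    and hor: "\<And>u. fderiv \<eta> y u \<in> horizontal (\<zeta> y)" "\<And>u. fderiv \<zeta> y u \<in> horizontal (\<zeta> y)"
  shows "hor_part (\<zeta> y) (second_derivative \<eta> y u w) = hor_part (\<zeta> y) (second_derivative \<zeta> y u w)"
proof -
  have zy: "\<zeta> y \<in> sphere_set" by (rule sph(1)[OF W(2)])
  \<comment> \<open>If \<open>P = \<rho> Q\<close> with \<open>\<rho> = 1\<close> and \<open>d\<rho> = 0\<close> at \<open>y\<close>, then the second derivatives of \<open>P\<close> and \<open>Q\<close>
    at \<open>y\<close> differ by a multiple of \<open>Q y\<close>.\<close>
  have scaled: "\<exists>k. second_derivative P y u w = second_derivative Q y u w + k *\<^sub>R Q y"
    if P: "smooth_on W P" and Q: "smooth_on W Q" and PQ: "\<And>x. x \<in> W \<Longrightarrow> \<exists>r. P x = r *\<^sub>R Q x"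
      and l: "bounded_linear l" and ly: "l (P y) = 1" "P y = Q y"
      and lD: "\<And>v. l (fderiv P y v) = 0" "\<And>v. l (fderiv Q y v) = 0"
    for P Q :: "'a \<Rightarrow> 'v::real_normed_vector" and l :: "'v \<Rightarrow> real"
  proof -
    interpret l: bounded_linear l by (rule l)
    define V where "V = W \<inter> (\<lambda>x. l (Q x)) -` {0<..}"
    have lP: "smooth_on W (\<lambda>x. l (P x))" and lQ: "smooth_on W (\<lambda>x. l (Q x))"
      by (rule smooth_on_bounded_linear[OF l W(1) P], rule smooth_on_bounded_linear[OF l W(1) Q])
    have V: "open V" "y \<in> V" "V \<subseteq> W" "\<And>x. x \<in> V \<Longrightarrow> l (Q x) \<noteq> 0"
      using continuous_open_preimage[OF smooth_on_continuous[OF lQ] W(1) open_greaterThan] W(2) ly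
      by (auto simp: V_def)
    \<comment> \<open>The factor is only known to exist pointwise; the functional \<open>l\<close>
      recovers it as a smooth function.\<close>
    define \<rho> where "\<rho> = (\<lambda>x. l (P x) * inverse (l (Q x)))"
    have \<rho>: "smooth_on V \<rho>"
      unfolding \<rho>_def
      by (intro smooth_on_mult smooth_on_inverse_real V smooth_on_subset[OF lP] smooth_on_subset[OF lQ])
    have P_eq: "\<rho> x *\<^sub>R Q x = P x" if x: "x \<in> V" for x
    proof -
      have "\<exists>r. P x = r *\<^sub>R Q x" using PQ V(3) x by blast
      then obtain r where "P x = r *\<^sub>R Q x" ..
      then show ?thesis using V(4)[OF x] by (simp add: \<rho>_def l.scaleR)
    qed
    have \<rho>y: "\<rho> y = 1" using ly by (simp add: \<rho>_def)
    have QV: "smooth_on V Q" by (rule smooth_on_subset[OF Q V(3)])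
    have dP: "fderiv P x v = \<rho> x *\<^sub>R fderiv Q x v + fderiv \<rho> x v *\<^sub>R Q x"
      if x: "x \<in> V" for x v
    proof -
      have "((\<lambda>x. \<rho> x *\<^sub>R Q x) has_derivative
          (\<lambda>v. \<rho> x *\<^sub>R fderiv Q x v + fderiv \<rho> x v *\<^sub>R Q x)) (at x)"
        by (intro has_derivative_scaleR smooth_on_has_derivative[OF \<rho> x] smooth_on_has_derivative[OF QV x])
      then have "(P has_derivative
          (\<lambda>v. \<rho> x *\<^sub>R fderiv Q x v + fderiv \<rho> x v *\<^sub>R Q x)) (at x)"
        by (rule has_derivative_transform_within_open[OF _ V(1) x P_eq])
      then show ?thesis by (simp add: frechet_derivative_eqI)
    qed
    \<comment> \<open>Applying \<open>l\<close> to the product rule isolates the derivative of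
      \<rho>, since \<open>l\<close> kills both first derivatives and is 1 on
      \<open>Q y\<close>.\<close>
    have d\<rho>: "fderiv \<rho> y v = 0" for v
      using arg_cong[OF dP[OF V(2), of v], of l] lD ly by (simp add: l.add l.scaleR)
    have "((\<lambda>x. \<rho> x *\<^sub>R fderiv Q x w + fderiv \<rho> x w *\<^sub>R Q x) has_derivative
        (\<lambda>u. (\<rho> y *\<^sub>R second_derivative Q y u w + fderiv \<rho> y u *\<^sub>R fderiv Q y w)
          + (fderiv \<rho> y w *\<^sub>R fderiv Q y u + second_derivative \<rho> y u w *\<^sub>R Q y))) (at y)"
      by (intro has_derivative_add has_derivative_scaleR second_derivative_has_derivative[OF \<rho> V(2)]
          second_derivative_has_derivative[OF QV V(2)] smooth_on_has_derivative[OF \<rho> V(2)] smooth_on_has_derivative[OF QV V(2)])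
    then have "((\<lambda>x. fderiv P x w) has_derivative
        (\<lambda>u. second_derivative Q y u w + second_derivative \<rho> y u w *\<^sub>R Q y)) (at y)"
      unfolding \<rho>y d\<rho> using has_derivative_transform_within_open[OF _ V(1,2) dP[symmetric]] by simp
    then have "second_derivative P y u w = second_derivative Q y u w + second_derivative \<rho> y u w *\<^sub>R Q y"
      unfolding second_derivative_def[of P] by (rule fun_cong[OF frechet_derivative_eqI])
    then show ?thesis by blast
  qed
  have D_fst: "fderiv (\<lambda>x. fst (f x)) x v = fst (fderiv f x v)"
    "fderiv (\<lambda>x. snd (f x)) x v = snd (fderiv f x v)"
    if "smooth_on W f" "x \<in> W" for f :: "'a \<Rightarrow> 'n para" and x v
    using has_derivative_fst[OF smooth_on_has_derivative[OF that]] has_derivative_snd[OF smooth_on_has_derivative[OF that]]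
    by (simp_all add: frechet_derivative_eqI)
  have D2_fst: "second_derivative (\<lambda>x. fst (f x)) y u w = fst (second_derivative f y u w)"
    "second_derivative (\<lambda>x. snd (f x)) y u w = snd (second_derivative f y u w)"
    if f: "smooth_on W f" for f :: "'a \<Rightarrow> 'n para"
  proof -
    note D2 = second_derivative_has_derivative[OF f W(2), of w]
    have "((\<lambda>x. fderiv (\<lambda>x. fst (f x)) x w) has_derivative (\<lambda>u. fst (second_derivative f y u w))) (at y)"
      by (rule has_derivative_transform_within_open[OF has_derivative_fst[OF D2] W]) (rule D_fst(1)[OF f, symmetric])
    then show "second_derivative (\<lambda>x. fst (f x)) y u w = fst (second_derivative f y u w)"
      unfolding second_derivative_def[of "\<lambda>x. fst (f x)"] by (rule fun_cong[OF frechet_derivative_eqI])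
    have "((\<lambda>x. fderiv (\<lambda>x. snd (f x)) x w) has_derivative (\<lambda>u. snd (second_derivative f y u w))) (at y)"
      by (rule has_derivative_transform_within_open[OF has_derivative_snd[OF D2] W]) (rule D_fst(2)[OF f, symmetric])
    then show "second_derivative (\<lambda>x. snd (f x)) y u w = snd (second_derivative f y u w)"
      unfolding second_derivative_def[of "\<lambda>x. snd (f x)"] by (rule fun_cong[OF frechet_derivative_eqI])
  qed
  note comps = smooth_on_fst[OF W(1) \<eta>] smooth_on_fst[OF W(1) \<zeta>] smooth_on_snd[OF W(1) \<eta>] smooth_on_snd[OF W(1) \<zeta>]
  \<comment> \<open>The functional is the pairing with the other component at \<open>y\<close>: it
    is 1 on \<open>fst (\<zeta> y)\<close> and vanishes on first components of horizontal
    vectors.\<close>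
  have "\<exists>k. second_derivative (\<lambda>x. fst (\<eta> x)) y u w = second_derivative (\<lambda>x. fst (\<zeta> x)) y u w + k *\<^sub>R fst (\<zeta> y)"
  proof (rule scaled[OF comps(1,2) _ blinfun.bounded_linear_right[of "snd (\<zeta> y)"]])
    show "\<exists>r. fst (\<eta> x) = r *\<^sub>R fst (\<zeta> x)" if "x \<in> W" for x
      using sph(2)[OF that] by (auto simp: action_eq)
  qed (use zy eq hor W in \<open>simp_all add: sphere_set_iff horizontal_iff D_fst \<eta> \<zeta>\<close>)
  then obtain k where k: "fst (second_derivative \<eta> y u w) = fst (second_derivative \<zeta> y u w) + k *\<^sub>R fst (\<zeta> y)"
    by (auto simp: D2_fst \<eta> \<zeta>)
  have "\<exists>k. second_derivative (\<lambda>x. snd (\<eta> x)) y u w = second_derivative (\<lambda>x. snd (\<zeta> x)) y u w + k *\<^sub>R snd (\<zeta> y)"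
  proof (rule scaled[OF comps(3,4) _ blinfun.bounded_linear_left[of "fst (\<zeta> y)"]])
    show "\<exists>r. snd (\<eta> x) = r *\<^sub>R snd (\<zeta> x)" if "x \<in> W" for x
      using sph(2)[OF that] by (auto simp: action_eq)
  qed (use zy eq hor W in \<open>simp_all add: sphere_set_iff horizontal_iff D_fst \<eta> \<zeta>\<close>)
  then obtain k' where k': "snd (second_derivative \<eta> y u w) = snd (second_derivative \<zeta> y u w) + k' *\<^sub>R snd (\<zeta> y)"
    by (auto simp: D2_fst \<eta> \<zeta>)
  show ?thesis
    using zy by (simp add: hor_part_def k k' sphere_set_iff blinfun.bilinear_simps algebra_simps)
qed

text \<open>The argument for the sphere is repeated with a section \<open>s\<close> in place of the
  inverse chart and \<open>hor_part\<close> in place of \<open>tan_part\<close>. Horizontality of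
  \<open>F\<close> enters where \<open>F\<close> is compared with \<open>s\<close> composed with the
  coordinates of the projected map.\<close>

lemma covariant_derivative_para_hyperbolic:
  fixes M :: "('m, 'e::euclidean_space) manifold" and F :: "'m \<Rightarrow> 'n::finite para"
  assumes M: "smooth_atlas M" and F: "smooth_map M pseudosphere F"
    and c: "c \<in> charts_at M p" and X: "X \<in> tangent_space M p"
    and hor: "\<And>v. fderiv (F \<circ> chart_inv c) (snd c p) v \<in> horizontal (F p)"
    and Y: "Y \<in> tangent_space pseudosphere (F p)"
      "ambient (F p) Y = hor_part (F p) (second_derivative (F \<circ> chart_inv c) (snd c p) (X c) u)"
  shows "covariant_derivative M para_hyperbolic hyperbolic_metric (proj_plus \<circ> F)
      (\<lambda>q. differential M para_hyperbolic (proj_plus \<circ> F) q (coord_vec M c q u)) p X =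
    differential pseudosphere para_hyperbolic proj_plus (F p) Y"
proof
  fix d :: "('n para set, 'n base_coord) chart"
  let ?S = "pseudosphere :: ('n para, 'n sphere_coord) manifold"
  let ?dp = "\<lambda>z X. differential ?S para_hyperbolic proj_plus z X"
  note S = smooth_atlas_pseudosphere and N = smooth_atlas_para_hyperbolic and c' = charts_atD[OF M c]
  note \<sigma> = smooth_map_compose[OF M S N F smooth_map_proj_plus]
  have z: "F p \<in> sphere_set" by (rule smooth_map_in_sphere[OF M F c'(4)])
  show "covariant_derivative M para_hyperbolic hyperbolic_metric (proj_plus \<circ> F)
      (\<lambda>q. differential M para_hyperbolic (proj_plus \<circ> F) q (coord_vec M c q u)) p X d = ?dp (F p) Y d"
  proof (cases "d \<in> charts_at para_hyperbolic (proj_plus (F p))")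
    case False
    then show ?thesis by (simp add: covariant_derivative_def differential_def)
  next
    case d: True
    note d' = charts_atD[OF N d]
    note dc = d'(2)[unfolded mtop_para_hyperbolic]
    let ?\<zeta> = "F \<circ> chart_inv c" and ?x = "snd d \<circ> (proj_plus \<circ> F) \<circ> chart_inv c"
    let ?y = "snd c p" and ?yd = "snd d (proj_plus (F p))"
    obtain V s where V: "open V" "?yd \<in> V" "V \<subseteq> snd d ` fst d" and s: "smooth_on V s"
      and sph: "\<And>y. y \<in> V \<Longrightarrow> s y \<in> sphere_set" and proj: "\<And>y. y \<in> V \<Longrightarrow> proj_plus (s y) = chart_inv d y"
      and sy: "s ?yd = F p" and s_hor: "\<And>u. fderiv s ?yd u \<in> horizontal (F p)"
      using horizontal_section[OF z d] by blast
    let ?D = "fderiv s ?yd"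
    have lin: "linear ?D" by (rule linear_frechet_derivative[OF smooth_on_differentiable[OF s V(2)]])
    have s_tan: "fderiv s y u \<in> tangent_sphere (s y)" if "y \<in> V" for y u
      by (rule sphere_valued_derivative_tangent[OF V(1) that sph smooth_on_has_derivative[OF s that]])
    have d_at: "d \<in> charts_at para_hyperbolic (proj_plus (s y))" if "y \<in> V" for y
      using d'(1) proj[OF that] chart_inv_in[OF dc subsetD[OF V(3) that]] by (simp add: charts_at_def)
    \<comment> \<open>The coordinates of the projection along \<open>s\<close> are the identity,
      because \<open>s\<close> is a section.\<close>
    have dproj_s: "?dp (s y) X' d = u"
      if y: "y \<in> V" and X': "X' \<in> tangent_space ?S (s y)" "ambient (s y) X' = fderiv s y u" for y X' u
    proof -
      have "((\<lambda>y. snd d (proj_plus (s y))) has_derivative (\<lambda>u. u)) (at y)"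
        by (rule has_derivative_transform_within_open[OF has_derivative_ident V(1) y])
          (simp only: proj chart_inv_right[OF dc subsetD[OF V(3)]])
      from frechet_derivative_eqI[OF this]
      show ?thesis using sphere_curve_vector(2)[OF sph[OF y] V(1) s sph y refl X' d_at[OF y]] by simp
    qed
    \<comment> \<open>At the centre, \<open>?D\<close> takes horizontal values, so it inverts the
      differential of the projection on horizontal vectors.\<close>
    have lift: "?D (?dp (F p) Y' d) = ambient (F p) Y'"
      if Y': "Y' \<in> tangent_space ?S (F p)" "ambient (F p) Y' \<in> horizontal (F p)" for Y'
    proof -
      obtain X' where X': "X' \<in> tangent_space ?S (F p)" "ambient (F p) X' = ?D (?dp (F p) Y' d)"
        using ambient_surj[OF z horizontal_imp_tangent[OF s_hor]] by metis
      have "?dp (F p) X' d = ?dp (F p) Y' d"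
        using dproj_s[OF V(2), unfolded sy, OF X'] .
      then have "?dp (F p) X' = ?dp (F p) Y'"
        by (rule tangent_eqI[OF N dproj_tangent[OF z X'(1)] dproj_tangent[OF z Y'(1)] d])
      then have "X' = Y'"
        using horizontal_vector_unique[OF z X'(1) _ Y'] X'(2) s_hor by simp
      then show ?thesis using X'(2) by simp
    qed
    have inj: "u = v" if "?D u = ?D v" for u v
    proof -
      obtain X' where X': "X' \<in> tangent_space ?S (F p)" "ambient (F p) X' = ?D u"
        using ambient_surj[OF z horizontal_imp_tangent[OF s_hor]] by metis
      show ?thesis
        by (rule trans[OF dproj_s[OF V(2), unfolded sy, OF X', symmetric] dproj_s[OF V(2), unfolded sy, OF X'(1) X'(2)[unfolded that]]])
    qed
    have surj: "\<exists>v. ?D v = x" if x: "x \<in> horizontal (F p)" for x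
    proof -
      obtain X' where X': "X' \<in> tangent_space ?S (F p)" "ambient (F p) X' = x"
        using ambient_surj[OF z horizontal_imp_tangent[OF x]] by metis
      then show ?thesis using lift[OF X'(1)] x by blast
    qed
    define v w where "v = fderiv ?x ?y (X c)" and "w = fderiv ?x ?y u"
    \<comment> \<open>The vertical component of the derivative of the section; it vanishes at the
      centre by horizontality there.\<close>
    define a where "a = (\<lambda>y u. blinfun_apply (snd (s y)) (fst (fderiv s y u)))"
    obtain \<gamma> where \<gamma>: "?D \<gamma> = hor_part (F p) (second_derivative s ?yd v w)"
      using surj[OF hor_part_horizontal[OF z]] by blast
    have chr: "christoffel para_hyperbolic hyperbolic_metric d ?yd v w = \<gamma>"
    proof (rule christoffel_parametrization[where a = a, OF V(1,2) s])
      show "(\<lambda>y. a y u) differentiable (at ?yd)" for u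
        unfolding a_def
        by (rule smooth_on_differentiable[OF smooth_on_bounded_bilinear[OF bounded_bilinear_blinfun_apply V(1)] V(2)])
          (intro smooth_on_fst smooth_on_snd V(1) s smooth_on_derivative)+
      show "a ?yd u = 0" for u using s_hor by (simp add: a_def sy horizontal_iff)
      show "metric_coeff para_hyperbolic hyperbolic_metric d y u w =
          ghat (fderiv s y u) (fderiv s y w) + a y u * a y w"
        if y: "y \<in> V" for y u w
      proof -
        have "\<exists>X'\<in>tangent_space ?S (s y). ambient (s y) X' = fderiv s y u \<and>
            coord_vec para_hyperbolic d (proj_plus (s y)) u = ?dp (s y) X'" for u
        proof -
          obtain X' where X': "X' \<in> tangent_space ?S (s y)" "ambient (s y) X' = fderiv s y u"
            using ambient_surj[OF sph[OF y] s_tan[OF y]] by metis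
          have "coord_vec para_hyperbolic d (proj_plus (s y)) u = ?dp (s y) X'"
            by (rule tangent_eqI[OF N coord_vec_tangent[OF N d_at[OF y]] dproj_tangent[OF sph[OF y] X'(1)] d_at[OF y]])
              (simp add: coord_vec_same[OF N d_at[OF y]] dproj_s[OF y X'])
          with X' show ?thesis by blast
        qed
        then obtain X' Y' where
          "X' \<in> tangent_space ?S (s y)" "ambient (s y) X' = fderiv s y u"
          "coord_vec para_hyperbolic d (proj_plus (s y)) u = ?dp (s y) X'"
          "Y' \<in> tangent_space ?S (s y)" "ambient (s y) Y' = fderiv s y w"
          "coord_vec para_hyperbolic d (proj_plus (s y)) w = ?dp (s y) Y'" by metis
        then show ?thesis
          using hyperbolic_metric_hor_part[OF sph[OF y], of X' Y'] ghat_hor_part_hor_part[OF sph[OF y] s_tan[OF y] s_tan[OF y]]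
          by (simp add: metric_coeff_def Let_def a_def flip: proj[OF y])
      qed
      show "ghat (?D \<gamma>) (?D x) = ghat (second_derivative s ?yd v w) (?D x)" for x
        unfolding \<gamma> by (rule ghat_hor_part[OF s_hor])
      fix z' assume *: "\<And>x. ghat (?D z') (?D x) = 0"
      have "?D z' = 0"
        using * surj by (intro ghat_nondegenerate_horizontal[OF z s_hor]) metis
      then show "z' = 0" using inj[of z' 0] linear_0[OF lin] by simp
    qed
    let ?W0 = "snd c ` (fst c \<inter> (proj_plus \<circ> F) -` fst d)"
    note W0 = smooth_map_chart_rep[OF M N \<sigma> c'(1) d'(1)]
    define W where "W = ?W0 \<inter> ?x -` V"
    have W: "open W"
      unfolding W_def by (rule continuous_open_preimage[OF smooth_on_continuous[OF W0(2)] W0(1) V(1)])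
    have x0: "?x ?y = ?yd" by (simp add: chart_inv_left[OF c'(2,3)])
    have y: "?y \<in> W" using c' d' V(2) x0 by (auto simp: W_def)
    have xV: "?x y \<in> V" if "y \<in> W" for y using that unfolding W_def by blast
    have x: "smooth_on W ?x" by (rule smooth_on_subset[OF W0(2)]) (simp add: W_def)
    have \<zeta>: "smooth_on W ?\<zeta>"
      by (rule smooth_on_subset[OF smooth_map_ambient[OF M F c'(1)]]) (auto simp: W_def)
    have \<zeta>y: "?\<zeta> ?y = F p" by (simp add: chart_inv_left[OF c'(2,3)])
    have sx: "smooth_on W (\<lambda>y. s (?x y))" by (rule smooth_on_compose[OF W V(1) xV x s])
    have sxy: "s (?x ?y) = ?\<zeta> ?y" by (simp only: x0 sy \<zeta>y)
    \<comment> \<open>The two maps have the same projection but may sit at different places of each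
      orbit. They agree at \<open>?y\<close>, and both have horizontal derivatives there.\<close>
    have "hor_part (F p) (second_derivative (\<lambda>y. s (?x y)) ?y (X c) u) =
        hor_part (F p) (second_derivative ?\<zeta> ?y (X c) u)"
    proof (rule hor_part_second_derivative_scaled[OF W y sx \<zeta> _ _ sxy, unfolded \<zeta>y])
      fix q assume q: "q \<in> W"
      then obtain m where m: "m \<in> fst c" "proj_plus (F m) \<in> fst d" "q = snd c m" by (auto simp: W_def)
      have "m \<in> points M" using chart_domain_subset[OF c'(2)] m by blast
      then show "?\<zeta> q \<in> sphere_set"
        using smooth_map_in_sphere[OF M F] m by (simp add: chart_inv_left[OF c'(2)])
      have "proj_plus (s (?x q)) = proj_plus (?\<zeta> q)"
        using proj[OF xV[OF q]] m by (simp add: chart_inv_left[OF c'(2)] chart_inv_left[OF dc])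
      then show "\<exists>t. s (?x q) = action t (?\<zeta> q)" 
        by (rule proj_plus_eq_iff[THEN iffD1, OF sym])
    next
      show "fderiv (\<lambda>y. s (?x y)) ?y u \<in> horizontal (F p)" for u
        using frechet_derivative_compose_at[OF smooth_on_differentiable[OF x y] smooth_on_differentiable[OF s xV[OF y]]]
          s_hor unfolding x0 by simp
      show "fderiv ?\<zeta> ?y u \<in> horizontal (F p)" for u by (rule hor)
    qed
    then have "ambient (F p) Y = hor_part (F p) (second_derivative (\<lambda>y. s (?x y)) ?y (X c) u)"
      using Y(2) by simp
    also have "\<dots> = hor_part (F p) (second_derivative s ?yd v w + ?D (second_derivative ?x ?y (X c) u))"
      using second_derivative_compose[OF W V(1) y xV x s] by (simp only: x0 v_def w_def)
    also have "\<dots> = ?D \<gamma> + ?D (second_derivative ?x ?y (X c) u)"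
      by (simp only: hor_part_add \<gamma> hor_part_id[OF s_hor])
    also have "\<dots> = ?D (second_derivative ?x ?y (X c) u + \<gamma>)" by (simp add: linear_add[OF lin] add.commute)
    finally have Y_eq: "ambient (F p) Y = ?D (second_derivative ?x ?y (X c) u + \<gamma>)" .
    have "ambient (F p) Y \<in> horizontal (F p)"
      unfolding Y(2) by (rule hor_part_horizontal[OF z])
    from lift[OF Y(1) this] have "?D (?dp (F p) Y d) = ?D (second_derivative ?x ?y (X c) u + \<gamma>)"
      unfolding Y_eq .
    then have "?dp (F p) Y d = second_derivative ?x ?y (X c) u + \<gamma>" by (rule inj)
    moreover have "d \<in> charts_at para_hyperbolic ((proj_plus \<circ> F) p)" using d by simp
    from covariant_derivative_chart[OF M N \<sigma> c this X]
    have "covariant_derivative M para_hyperbolic hyperbolic_metric (proj_plus \<circ> F)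
        (\<lambda>q. differential M para_hyperbolic (proj_plus \<circ> F) q (coord_vec M c q u)) p X d =
      second_derivative ?x ?y (X c) u + christoffel para_hyperbolic hyperbolic_metric d ?yd v w"
      by (simp only: v_def w_def o_apply[of proj_plus F p])
    ultimately show ?thesis using chr by simp
  qed
qed

section \<open>Projections of horizontal immersions\<close>

text \<open>Two decompositions differ by a tangential vector orthogonal to all tangential ones,
  which nondegeneracy forces to be 0. As \<open>g\<close> is an arbitrary function on tangent
  vectors, the additivity this uses is a hypothesis.\<close>

lemma normal_part_eqI:
  fixes M :: "('m, 'e::euclidean_space) manifold" and N :: "('p, 'd::euclidean_space) manifold"
  assumes M: "smooth_atlas M" and N: "smooth_atlas N" and F: "smooth_map M N F" and p: "p \<in> points M"
    and nondeg: "nondegenerate M (pullback M N g F)"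
    and V: "V \<in> tangent_space N (F p)"
    and orth: "\<And>Z. Z \<in> tangent_space M p \<Longrightarrow> g (F p) V (differential M N F p Z) = 0"
    and decomp: "Z0 \<in> tangent_space M p" "W = (\<lambda>d. differential M N F p Z0 d + V d)"
    and add: "\<And>Z Y. Z \<in> tangent_space M p \<Longrightarrow> Y \<in> tangent_space M p \<Longrightarrow>
      g (F p) (\<lambda>d. differential M N F p Z d + V d) (differential M N F p Y) =
      g (F p) (differential M N F p Z) (differential M N F p Y) + g (F p) V (differential M N F p Y)"
  shows "normal_part M N g F p W = V"
  unfolding normal_part_def
proof (rule the_equality)
  show "V \<in> tangent_space N (F p) \<and> (\<forall>Z\<in>tangent_space M p. g (F p) V (differential M N F p Z) = 0) \<and>
      (\<exists>Z\<in>tangent_space M p. W = (\<lambda>d. differential M N F p Z d + V d))"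
    using V orth decomp by blast
  fix V' assume V': "V' \<in> tangent_space N (F p) \<and> (\<forall>Z\<in>tangent_space M p. g (F p) V' (differential M N F p Z) = 0) \<and>
      (\<exists>Z\<in>tangent_space M p. W = (\<lambda>d. differential M N F p Z d + V' d))"
  then obtain Z1 where Z1: "Z1 \<in> tangent_space M p" "W = (\<lambda>d. differential M N F p Z1 d + V' d)" by blast
  define Z where "Z = (\<lambda>d. 1 *\<^sub>R Z0 d + (- 1) *\<^sub>R Z1 d)"
  have Z: "Z \<in> tangent_space M p"
    unfolding Z_def by (intro tangent_add tangent_scale M decomp Z1)
  have dZ: "differential M N F p Z = (\<lambda>d. 1 *\<^sub>R differential M N F p Z0 d + (- 1) *\<^sub>R differential M N F p Z1 d)"
    unfolding Z_def by (rule differential_linear[OF M N F p decomp(1) Z1(1)])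
  have "V' d = differential M N F p Z d + V d" for d
    using fun_cong[OF trans[OF Z1(2)[symmetric] decomp(2)], of d] unfolding dZ by (simp add: algebra_simps)
  then have V'_eq: "V' = (\<lambda>d. differential M N F p Z d + V d)" by (rule ext)
  have "pullback M N g F p Z Y = 0" if Y: "Y \<in> tangent_space M p" for Y
    using add[OF Z Y] orth[OF Y] V' Y unfolding V'_eq pullback_def by simp
  then have "Z = (\<lambda>_. 0)" using nondeg p Z by (simp add: nondegenerate_def)
  then have "Z0 d = Z1 d" for d using fun_cong[of Z "\<lambda>_. 0" d] unfolding Z_def by simp
  then have "Z0 = Z1" by (rule ext)
  then have "V' d = V d" for d
    using fun_cong[OF trans[OF Z1(2)[symmetric] decomp(2)], of d] by simp
  then show "V' = V" by (rule ext)
qed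

text \<open>\<open>ghat\<close> is indefinite, so the orthogonal projection onto the range of
  \<open>A\<close> has to come from nondegeneracy: it makes the Gram operator \<open>T\<close>
  injective, hence surjective.\<close>

lemma ghat_represent:
  fixes A :: "'e::euclidean_space \<Rightarrow> 'n::finite para"
  assumes A: "linear A" and nondeg: "\<And>u. (\<And>w. ghat (A u) (A w) = 0) \<Longrightarrow> u = 0"
  shows "\<exists>u. \<forall>w. ghat (A u) (A w) = ghat x (A w)"
proof -
  have A_expand: "A w = (\<Sum>b\<in>Basis. (w \<bullet> b) *\<^sub>R A b)" for w
    by (subst euclidean_representation[of w, symmetric]) (simp add: linear_sum[OF A] linear_scale[OF A])
  have ghat_sum: "ghat x (\<Sum>b\<in>Basis. (w \<bullet> b) *\<^sub>R A b) = (\<Sum>b\<in>Basis. (w \<bullet> b) * ghat x (A b))" for x w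
  proof -
    have "linear (ghat x)" by (rule linearI) (simp_all add: ghat_add ghat_scaleR)
    then show ?thesis by (simp add: linear_sum ghat_scaleR)
  qed
  define T where "T = (\<lambda>u. \<Sum>b\<in>Basis. ghat (A u) (A b) *\<^sub>R b)"
  have T: "linear T"
    unfolding T_def
    by (rule linearI) (simp_all add: linear_add[OF A] linear_scale[OF A] ghat_add ghat_scaleR
        scaleR_left_distrib sum.distrib scaleR_sum_right)
  have T_inner: "T u \<bullet> b = ghat (A u) (A b)" if "b \<in> Basis" for u b
    using that by (simp add: T_def inner_sum_left inner_Basis if_distrib cong: if_cong)
  have "inj T"
    unfolding linear_injective_0[OF T]
  proof (intro allI impI)
    fix u assume "T u = 0"
    then have "ghat (A u) (A w) = 0" for w
      using T_inner[of _ u] by (subst A_expand) (simp add: ghat_sum)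
    then show "u = 0" by (rule nondeg)
  qed
  then have "surj T" by (rule linear_injective_imp_surjective[OF T _ refl])
  then obtain u where u: "T u = (\<Sum>b\<in>Basis. ghat x (A b) *\<^sub>R b)" by (metis surjD)
  have "ghat (A u) (A b) = ghat x (A b)" if "b \<in> Basis" for b
    using T_inner[OF that, of u] that unfolding u by (simp add: inner_sum_left inner_Basis if_distrib cong: if_cong)
  then have "ghat (A u) (A w) = ghat x (A w)" for w
    by (subst (1 2) A_expand) (simp only: ghat_sum cong: sum.cong)
  then show ?thesis by blast
qed

lemma sphere_metric_linear:
  fixes z :: "'n::finite para"
  assumes "z \<in> sphere_set" "X \<in> tangent_space pseudosphere z" "Y \<in> tangent_space pseudosphere z"
  shows "sphere_metric z (\<lambda>d. a *\<^sub>R X d + b *\<^sub>R Y d) W = a * sphere_metric z X W + b * sphere_metric z Y W"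
  using ambient_linear[OF assms] by (simp add: sphere_metric_def ghat_add ghat_scaleR)

section \<open>Horizontal immersions and their projections\<close>

context
  fixes M :: "('m, real ^ 'k) manifold" and F :: "'m \<Rightarrow> 'n::finite para"
  assumes M: "smooth_atlas M" and ndi: "nondegenerate_immersion M pseudosphere sphere_metric F"
    and hor: "\<And>p X. p \<in> points M \<Longrightarrow> X \<in> tangent_space M p \<Longrightarrow> vdifferential M F p X \<in> horizontal (F p)"
begin

lemma smooth_F: "smooth_map M pseudosphere F"
  using ndi by (simp add: nondegenerate_immersion_def immersion_def)

lemma smooth_proj_F: "smooth_map M para_hyperbolic (proj_plus \<circ> F)"
  by (rule smooth_map_compose[OF M smooth_atlas_pseudosphere smooth_atlas_para_hyperbolic smooth_F smooth_map_proj_plus])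

context
  fixes p assumes p: "p \<in> points M"
begin

lemma F_sphere: "F p \<in> sphere_set"
  by (rule smooth_map_in_sphere[OF M smooth_F p])

lemma dF_tangent: "X \<in> tangent_space M p \<Longrightarrow> differential M pseudosphere F p X \<in> tangent_space pseudosphere (F p)"
  by (rule differential_tangent[OF M smooth_atlas_pseudosphere smooth_F _ p])

lemma ambient_dF: "X \<in> tangent_space M p \<Longrightarrow> ambient (F p) (differential M pseudosphere F p X) = vdifferential M F p X"
  by (rule ambient_differential[OF M smooth_F p])

lemma ambient_dF_horizontal:
  "X \<in> tangent_space M p \<Longrightarrow> ambient (F p) (differential M pseudosphere F p X) \<in> horizontal (F p)"
  using ambient_dF hor[OF p] by simp

lemma differential_proj_F:
  "X \<in> tangent_space M p \<Longrightarrow>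
    differential M para_hyperbolic (proj_plus \<circ> F) p X = differential pseudosphere para_hyperbolic proj_plus (F p) (differential M pseudosphere F p X)"
  by (rule differential_compose[OF M smooth_atlas_pseudosphere smooth_atlas_para_hyperbolic smooth_F smooth_map_proj_plus p])

lemma pullback_hyperbolic_metric:
  assumes "X \<in> tangent_space M p" "Y \<in> tangent_space M p"
  shows "pullback M para_hyperbolic hyperbolic_metric (proj_plus \<circ> F) p X Y = pullback M pseudosphere sphere_metric F p X Y"
  using hyperbolic_metric_horizontal[OF F_sphere dF_tangent[OF assms(1)] dF_tangent[OF assms(2)]]
    ambient_dF_horizontal assms
  by (simp add: pullback_def differential_proj_F sphere_metric_def)

lemma pullback_hyperbolic_symplectic:
  assumes "X \<in> tangent_space M p" "Y \<in> tangent_space M p"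
  shows "pullback M para_hyperbolic hyperbolic_symplectic (proj_plus \<circ> F) p X Y =
    ghat (vdifferential M F p X) (para_phi (vdifferential M F p Y))"
  using hyperbolic_symplectic_horizontal[OF F_sphere dF_tangent[OF assms(1)] dF_tangent[OF assms(2)]]
    ambient_dF_horizontal assms
  by (simp add: pullback_def differential_proj_F ambient_dF)

end

lemma nondegenerate_immersion_proj:
  "nondegenerate_immersion M para_hyperbolic hyperbolic_metric (proj_plus \<circ> F)"
  unfolding nondegenerate_immersion_def immersion_def
proof (intro conjI ballI)
  show "smooth_map M para_hyperbolic (proj_plus \<circ> F)" by (rule smooth_proj_F)
  show "nondegenerate M (pullback M para_hyperbolic hyperbolic_metric (proj_plus \<circ> F))"
    using ndi pullback_hyperbolic_metric by (simp add: nondegenerate_immersion_def nondegenerate_def)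
  fix p assume p: "p \<in> points M"
  show "inj_on (differential M para_hyperbolic (proj_plus \<circ> F) p) (tangent_space M p)"
  proof (rule inj_onI)
    fix X Y assume X: "X \<in> tangent_space M p" and Y: "Y \<in> tangent_space M p"
      and "differential M para_hyperbolic (proj_plus \<circ> F) p X = differential M para_hyperbolic (proj_plus \<circ> F) p Y"
    then have "differential M pseudosphere F p X = differential M pseudosphere F p Y"
      using horizontal_vector_unique[OF F_sphere[OF p] dF_tangent[OF p X] ambient_dF_horizontal[OF p X]
          dF_tangent[OF p Y] ambient_dF_horizontal[OF p Y]] by (simp add: differential_proj_F[OF p])
    then show "X = Y"
      using ndi p X Y by (auto simp: nondegenerate_immersion_def immersion_def dest: inj_onD)
  qed
qed

text \<open>The tangential component of the covariant derivative is the same vector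
  \<open>Z0\<close> upstairs and downstairs: pairings with horizontal vectors do not see the
  vertical component in which the two derivatives differ. For the same reason the projection of
  \<open>V\<close> is normal, whether or not \<open>V\<close> is horizontal.\<close>

lemma second_fundamental_form_proj:
  assumes p: "p \<in> points M" and X: "X \<in> tangent_space M p" and Y: "Y \<in> tangent_space M p"
  obtains V where "V \<in> tangent_space pseudosphere (F p)"
    "second_fundamental_form M pseudosphere sphere_metric F p X Y = V"
    "second_fundamental_form M para_hyperbolic hyperbolic_metric (proj_plus \<circ> F) p X Y = differential pseudosphere para_hyperbolic proj_plus (F p) V"
proof -
  note F_sphere = F_sphere[OF p] and dF_tangent = dF_tangent[OF p] and ambient_dF = ambient_dF[OF p]
    and ambient_dF_horizontal = ambient_dF_horizontal[OF p] and differential_proj_F = differential_proj_F[OF p]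
  let ?c = "chart_at M p"
  have c: "?c \<in> charts_at M p" by (rule chart_at_in_charts_at[OF M p])
  note c' = charts_atD[OF M c]
  let ?\<zeta> = "F \<circ> chart_inv ?c" and ?dF = "differential M pseudosphere F p" and ?dp = "differential pseudosphere para_hyperbolic proj_plus (F p)"
  let ?A = "fderiv ?\<zeta> (snd ?c p)"
  note \<zeta> = smooth_map_ambient[OF M smooth_F c'(1)]
  have A: "ambient (F p) (?dF Z) = ?A (Z ?c)" if "Z \<in> tangent_space M p" for Z
    using ambient_dF[OF that] vdifferential_smooth[OF M c that \<zeta> c'(5)] by simp
  have lin: "linear ?A" by (rule linear_frechet_derivative[OF smooth_on_differentiable[OF \<zeta> c'(5)]])
  have coord: "coord_vec M ?c p u \<in> tangent_space M p" "coord_vec M ?c p u ?c = u" for u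
    by (rule coord_vec_tangent[OF M c], rule coord_vec_same[OF M c])
  have A_hor: "?A u \<in> horizontal (F p)" for u
    using ambient_dF_horizontal[OF coord(1)] A[OF coord(1)] coord(2) by metis
  have nondeg: "u = 0" if "\<And>w. ghat (?A u) (?A w) = 0" for u
  proof -
    have "pullback M pseudosphere sphere_metric F p (coord_vec M ?c p u) Y = 0" if "Y \<in> tangent_space M p" for Y
      using \<open>\<And>w. ghat (?A u) (?A w) = 0\<close> A[OF that] A[OF coord(1)]
      by (simp add: pullback_def sphere_metric_def coord(2))
    then have "coord_vec M ?c p u = (\<lambda>_. 0)"
      using ndi p coord(1) by (simp add: nondegenerate_immersion_def nondegenerate_def)
    then show ?thesis using coord(2)[of u] by simp
  qed
  let ?B = "second_derivative ?\<zeta> (snd ?c p) (X ?c) (Y ?c)"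
  obtain C where C: "C \<in> tangent_space pseudosphere (F p)" "ambient (F p) C = tan_part (F p) ?B"
    using ambient_surj[OF F_sphere tan_part_tangent[OF F_sphere]] by blast
  obtain C' where C': "C' \<in> tangent_space pseudosphere (F p)" "ambient (F p) C' = hor_part (F p) ?B"
    using ambient_surj[OF F_sphere horizontal_imp_tangent[OF hor_part_horizontal[OF F_sphere]]] by blast
  have "?dp C = ?dp C'"
    by (rule dproj_eqI[OF F_sphere C(1) C'(1)]) (simp only: C C' tan_part_minus_hor_part[OF F_sphere])
  then have cov: "covariant_derivative M pseudosphere sphere_metric F (\<lambda>q. differential M pseudosphere F q (coord_vec M ?c q (Y ?c))) p X = C"
    "covariant_derivative M para_hyperbolic hyperbolic_metric (proj_plus \<circ> F)
      (\<lambda>q. differential M para_hyperbolic (proj_plus \<circ> F) q (coord_vec M ?c q (Y ?c))) p X = ?dp C"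
    using covariant_derivative_pseudosphere[OF M smooth_F c X C]
      covariant_derivative_para_hyperbolic[OF M smooth_F c X A_hor C'] by simp_all
  \<comment> \<open>The coordinates of the tangential component of \<open>C\<close>.\<close>
  obtain u where u: "\<And>w. ghat (?A u) (?A w) = ghat (ambient (F p) C) (?A w)"
    using ghat_represent[OF lin nondeg] by blast
  define Z0 where "Z0 = coord_vec M ?c p u"
  have Z0: "Z0 \<in> tangent_space M p" "Z0 ?c = u" using coord by (simp_all add: Z0_def)
  define V where "V = (\<lambda>d. 1 *\<^sub>R C d + (- 1) *\<^sub>R ?dF Z0 d)"
  have V: "V \<in> tangent_space pseudosphere (F p)"
    unfolding V_def by (intro tangent_add tangent_scale smooth_atlas_pseudosphere C dF_tangent Z0)
  have amb_V: "ambient (F p) V = ambient (F p) C - ?A u"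
    unfolding V_def ambient_linear[OF F_sphere C(1) dF_tangent[OF Z0(1)]] by (simp add: A[OF Z0(1)] Z0)
  have orth: "ghat (ambient (F p) V) (?A w) = 0" for w
    unfolding amb_V by (simp add: ghat_diff u)
  have C_eq: "C = (\<lambda>d. ?dF Z0 d + V d)" by (simp add: V_def)
  have nd: "nondegenerate M (pullback M pseudosphere sphere_metric F)"
    using ndi by (simp add: nondegenerate_immersion_def)
  have ndN: "nondegenerate M (pullback M para_hyperbolic hyperbolic_metric (proj_plus \<circ> F))"
    using nondegenerate_immersion_proj by (simp add: nondegenerate_immersion_def)
  have "normal_part M pseudosphere sphere_metric F p C = V"
  proof (rule normal_part_eqI[OF M smooth_atlas_pseudosphere smooth_F p nd V _ Z0(1) C_eq])
    show "sphere_metric (F p) V (?dF Z) = 0" if "Z \<in> tangent_space M p" for Z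
      using orth A[OF that] by (simp add: sphere_metric_def)
    show "sphere_metric (F p) (\<lambda>d. ?dF Z d + V d) (?dF Y) = sphere_metric (F p) (?dF Z) (?dF Y) + sphere_metric (F p) V (?dF Y)"
      if "Z \<in> tangent_space M p" for Z Y
      using sphere_metric_linear[OF F_sphere dF_tangent[OF that] V, of 1 1] by simp
  qed
  moreover have "normal_part M para_hyperbolic hyperbolic_metric (proj_plus \<circ> F) p (?dp C) = ?dp V"
  proof (rule normal_part_eqI[OF M smooth_atlas_para_hyperbolic smooth_proj_F p ndN _ _ Z0(1)])
    show "?dp V \<in> tangent_space para_hyperbolic ((proj_plus \<circ> F) p)"
      using dproj_tangent[OF F_sphere V] by simp
    \<comment> \<open>One factor is horizontal, so the metric of the quotient can be evaluated on
      \<open>W\<close> without taking its horizontal part.\<close>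
    have met: "hyperbolic_metric ((proj_plus \<circ> F) p) (?dp W) (differential M para_hyperbolic (proj_plus \<circ> F) p Z) =
        ghat (ambient (F p) W) (?A (Z ?c))"
      if W: "W \<in> tangent_space pseudosphere (F p)" and Z: "Z \<in> tangent_space M p" for W Z
      using hyperbolic_metric_hor_part[OF F_sphere W dF_tangent[OF Z]] hor_part_id[OF A_hor] ghat_hor_part[OF A_hor]
      by (simp add: differential_proj_F[OF Z] A[OF Z])
    show "hyperbolic_metric ((proj_plus \<circ> F) p) (?dp V) (differential M para_hyperbolic (proj_plus \<circ> F) p Z) = 0"
      if "Z \<in> tangent_space M p" for Z
      unfolding met[OF V that] by (rule orth)
    have sum: "(\<lambda>d. differential M para_hyperbolic (proj_plus \<circ> F) p Z d + ?dp V d) = ?dp (\<lambda>d. 1 *\<^sub>R ?dF Z d + 1 *\<^sub>R V d)"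
      if Z: "Z \<in> tangent_space M p" for Z
      using dproj_linear[OF F_sphere dF_tangent[OF Z] V, of 1 1] by (simp add: differential_proj_F[OF Z])
    show "?dp C = (\<lambda>d. differential M para_hyperbolic (proj_plus \<circ> F) p Z0 d + ?dp V d)"
      unfolding sum[OF Z0(1)] by (subst C_eq) simp
    show "hyperbolic_metric ((proj_plus \<circ> F) p) (\<lambda>d. differential M para_hyperbolic (proj_plus \<circ> F) p Z d + ?dp V d)
          (differential M para_hyperbolic (proj_plus \<circ> F) p Y) =
        hyperbolic_metric ((proj_plus \<circ> F) p) (differential M para_hyperbolic (proj_plus \<circ> F) p Z) (differential M para_hyperbolic (proj_plus \<circ> F) p Y) +
        hyperbolic_metric ((proj_plus \<circ> F) p) (?dp V) (differential M para_hyperbolic (proj_plus \<circ> F) p Y)"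
      if Z: "Z \<in> tangent_space M p" and Y: "Y \<in> tangent_space M p" for Z Y
    proof -
      have ZV: "(\<lambda>d. 1 *\<^sub>R ?dF Z d + 1 *\<^sub>R V d) \<in> tangent_space pseudosphere (F p)"
        by (intro tangent_add tangent_scale smooth_atlas_pseudosphere dF_tangent Z V)
      show ?thesis
        by (simp only: met[OF ZV Y, folded sum[OF Z]] met[OF V Y]
            met[OF dF_tangent[OF Z] Y, folded differential_proj_F[OF Z]]
            ambient_linear[OF F_sphere dF_tangent[OF Z] V, of 1 1, unfolded scaleR_one] ghat_add scaleR_one)
    qed
  qed
  ultimately show ?thesis
    using that[OF V] by (simp add: second_fundamental_form_def Let_def cov)
qed

text \<open>The induced metrics coincide, so the same inverse Gram matrix contracts both second
  fundamental forms, and linearity of the differential of the projection moves it outside the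
  trace.\<close>

lemma mean_curvature_proj:
  assumes p: "p \<in> points M" and H: "mean_curvature M pseudosphere sphere_metric F p = (\<lambda>_. 0)"
  shows "mean_curvature M para_hyperbolic hyperbolic_metric (proj_plus \<circ> F) p = (\<lambda>_. 0)"
proof
  fix d :: "('n para set, 'n base_coord) chart"
  let ?c = "chart_at M p" and ?dp = "differential pseudosphere para_hyperbolic proj_plus (F p)"
  have c: "?c \<in> charts_at M p" by (rule chart_at_in_charts_at[OF M p])
  define E where "E = (\<lambda>i. coord_vec M ?c p (axis i 1))"
  have E: "E i \<in> tangent_space M p" for i unfolding E_def by (rule coord_vec_tangent[OF M c])
  define G where "G = (\<chi> i j. pullback M pseudosphere sphere_metric F p (E i) (E j))"
  have G': "(\<chi> i j. pullback M para_hyperbolic hyperbolic_metric (proj_plus \<circ> F) p (E i) (E j)) = G"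
    unfolding G_def pullback_hyperbolic_metric[OF p E E] ..
  define V where "V = (\<lambda>i j. second_fundamental_form M pseudosphere sphere_metric F p (E i) (E j))"
  have V: "V i j \<in> tangent_space pseudosphere (F p)"
    and VN: "second_fundamental_form M para_hyperbolic hyperbolic_metric (proj_plus \<circ> F) p (E i) (E j) = ?dp (V i j)" for i j
    using second_fundamental_form_proj[OF p E[of i] E[of j]] unfolding V_def by metis+
  have H0: "(\<Sum>i\<in>UNIV. \<Sum>j\<in>UNIV. (matrix_inv G $ i $ j) *\<^sub>R V i j e) = 0" for e
    using fun_cong[OF H, of e] by (simp add: mean_curvature_def Let_def V_def G_def E_def)
  have "(\<Sum>i\<in>UNIV. \<Sum>j\<in>UNIV. (matrix_inv G $ i $ j) *\<^sub>R ?dp (V i j) d) = 0"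
  proof (cases "d \<in> charts_at para_hyperbolic (proj_plus (F p))")
    case True
    let ?e = "chart_at pseudosphere (F p)"
    note e = chart_at_pseudosphere[OF F_sphere[OF p]]
    let ?D = "fderiv (snd d \<circ> proj_plus \<circ> chart_inv ?e) (snd ?e (F p))"
    note rep = differential_rep[OF smooth_atlas_pseudosphere smooth_atlas_para_hyperbolic smooth_map_proj_plus e True]
    have lin: "linear ?D" by (rule has_derivative_linear[OF rep(1)[OF V]])
    have "(\<Sum>i\<in>UNIV. \<Sum>j\<in>UNIV. (matrix_inv G $ i $ j) *\<^sub>R ?dp (V i j) d) =
        ?D (\<Sum>i\<in>UNIV. \<Sum>j\<in>UNIV. (matrix_inv G $ i $ j) *\<^sub>R V i j ?e)"
      by (simp only: rep(2)[OF V] linear_sum[OF lin] linear_scale[OF lin])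
    then show ?thesis by (simp only: H0 linear_0[OF lin])
  qed (simp add: differential_def)
  then show "mean_curvature M para_hyperbolic hyperbolic_metric (proj_plus \<circ> F) p d = 0"
    by (simp add: mean_curvature_def Let_def VN G' flip: E_def)
qed

end

section \<open>Equiaffine immersions\<close>

context
  fixes M :: "('m, real ^ 'n) manifold" and f \<xi> :: "'m \<Rightarrow> 'n aff" and \<nu> :: "'m \<Rightarrow> 'n aff_dual"
    and nabla :: "'m \<Rightarrow> ('m, real ^ 'n) tvec \<Rightarrow> ('m \<Rightarrow> ('m, real ^ 'n) tvec) \<Rightarrow> ('m, real ^ 'n) tvec"
    and h :: "('m, real ^ 'n) tensor2" and S :: "'m \<Rightarrow> ('m, real ^ 'n) tvec \<Rightarrow> ('m, real ^ 'n) tvec"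
    and \<tau> :: "'m \<Rightarrow> ('m, real ^ 'n) tvec \<Rightarrow> real" and p :: 'm
    and c :: "('m, real ^ 'n) chart" and ft xt nt
  assumes M: "smooth_atlas M"
    and aff: "affine_immersion M f \<xi>" and struct: "structure_equations M f \<xi> nabla h S \<tau>"
    and equi: "equiaffine M \<tau>" and conormal: "conormal_map M f \<xi> \<nu>"
    and smooth: "smooth_map M pseudosphere (\<lambda>p. (\<xi> p, \<nu> p))" and c: "c \<in> charts_at M p"
  defines "ft \<equiv> f \<circ> chart_inv c" and "xt \<equiv> \<xi> \<circ> chart_inv c" and "nt \<equiv> \<nu> \<circ> chart_inv c"
begin

lemma coordinate_smooth:
  "smooth_on (snd c ` fst c) ft" "smooth_on (snd c ` fst c) xt" "smooth_on (snd c ` fst c) nt"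
proof -
  note c' = charts_atD[OF M c]
  show "smooth_on (snd c ` fst c) ft" "smooth_on (snd c ` fst c) xt"
    using aff c'(1) by (simp_all add: affine_immersion_def smooth_vmap_def ft_def xt_def)
  show "smooth_on (snd c ` fst c) nt"
    using smooth_on_snd[OF open_chart_range[OF c'(2)] smooth_map_ambient[OF M smooth c'(1)]]
    by (simp add: nt_def comp_def)
qed

lemma coordinate_equations:
  assumes y: "y \<in> snd c ` fst c"
  shows "blinfun_apply (nt y) (xt y) = 1"
    and "blinfun_apply (nt y) (fderiv ft y u) = 0"
    and "blinfun_apply (nt y) (fderiv xt y u) = 0"
    and "X \<in> tangent_space M (chart_inv c y) \<Longrightarrow>
      fderiv xt y (X c) = - fderiv ft y (S (chart_inv c y) X c)"
proof -
  note c' = charts_atD[OF M c]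
  let ?q = "chart_inv c y"
  have q: "?q \<in> fst c" "snd c ?q = y"
    by (rule chart_inv_in[OF c'(2) y], rule chart_inv_right[OF c'(2) y])
  then have cq: "c \<in> charts_at M ?q" and qM: "?q \<in> points M"
    using c' chart_domain_subset[OF c'(2)] by (auto simp: charts_at_def)
  have vd: "vdifferential M f ?q X = fderiv ft y (X c)"
    "vdifferential M \<xi> ?q X = fderiv xt y (X c)" if "X \<in> tangent_space M ?q" for X
    using vdifferential_smooth[OF M cq that coordinate_smooth(1)[unfolded ft_def]]
      vdifferential_smooth[OF M cq that coordinate_smooth(2)[unfolded xt_def]] y q(2)
    by (simp_all add: ft_def xt_def)
  note U = coord_vec_tangent[OF M cq] and Uc = coord_vec_same[OF M cq]
  show "blinfun_apply (nt y) (xt y) = 1"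
    using conormal qM by (simp add: conormal_map_def nt_def xt_def)
  show 2: "blinfun_apply (nt y) (fderiv ft y u) = 0" for u
  proof -
    have "blinfun_apply (\<nu> ?q) (vdifferential M f ?q (coord_vec M c ?q u)) = 0"
      using conormal qM U[of u] unfolding conormal_map_def by blast
    then show ?thesis by (simp add: vd(1)[OF U] Uc nt_def)
  qed
  have S: "S ?q X \<in> tangent_space M ?q" "vdifferential M \<xi> ?q X = - vdifferential M f ?q (S ?q X)"
    if "X \<in> tangent_space M ?q" for X
    using struct equi qM that by (auto simp: structure_equations_def equiaffine_def)
  show 4: "fderiv xt y (X c) = - fderiv ft y (S ?q X c)"
    if X: "X \<in> tangent_space M ?q" for X
    using S(2)[OF X] vd(2)[OF X] vd(1)[OF S(1)[OF X]] by simp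
  show "blinfun_apply (nt y) (fderiv xt y u) = 0"
    using 4[OF U[of u]] 2 by (simp add: Uc blinfun.minus_right)
qed

context
  fixes y
  assumes y: "y \<in> snd c ` fst c"
begin

lemma open_coordinates: "open (snd c ` fst c)"
  by (rule open_chart_range[OF charts_atD(2)[OF M c]])

text \<open>The product rule for a constant pairing, to be used with \<xi> and with the derivatives
  of \<xi> and of \<open>f\<close> in a fixed direction.\<close>

lemma conormal_derivative:
  assumes A: "(A has_derivative A') (at y)"
    and const: "\<And>x. x \<in> snd c ` fst c \<Longrightarrow> blinfun_apply (nt x) (A x) = k"
  shows "blinfun_apply (fderiv nt y u) (A y) = - blinfun_apply (nt y) (A' u)"
proof -
  have "((\<lambda>x. blinfun_apply (nt x) (A x)) has_derivative
      (\<lambda>u. blinfun_apply (nt y) (A' u) + blinfun_apply (fderiv nt y u) (A y))) (at y)"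
    by (rule blinfun.FDERIV[OF smooth_on_has_derivative[OF coordinate_smooth(3) y] A])
  moreover have "((\<lambda>x. blinfun_apply (nt x) (A x)) has_derivative (\<lambda>u. 0)) (at y)"
    by (rule has_derivative_transform_within_open[OF has_derivative_const open_coordinates y]) (simp only: const)
  ultimately have "blinfun_apply (nt y) (A' u) + blinfun_apply (fderiv nt y u) (A y) = 0"
    by (rule fun_cong[OF has_derivative_unique])
  then show ?thesis by simp
qed

lemma conormal_derivative_xi: "blinfun_apply (fderiv nt y u) (xt y) = 0"
  using conormal_derivative[OF smooth_on_has_derivative[OF coordinate_smooth(2) y] coordinate_equations(1)]
    coordinate_equations(3)[OF y] by simp

lemma conormal_derivative_dxi:
  "blinfun_apply (fderiv nt y u) (fderiv xt y w) =
    - blinfun_apply (nt y) (second_derivative xt y u w)"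
  by (rule conormal_derivative[OF second_derivative_has_derivative[OF coordinate_smooth(2) y] coordinate_equations(3)])

lemma conormal_derivative_df:
  "blinfun_apply (fderiv nt y u) (fderiv ft y w) =
    - blinfun_apply (nt y) (second_derivative ft y u w)"
  by (rule conormal_derivative[OF second_derivative_has_derivative[OF coordinate_smooth(1) y] coordinate_equations(2)])

text \<open>Both sides are the \<open>\<xi>\<close>-component of a symmetric second derivative of \<open>\<xi>\<close>.\<close>

lemma conormal_derivative_symmetric:
  "blinfun_apply (fderiv nt y u) (fderiv xt y w) =
    blinfun_apply (fderiv nt y w) (fderiv xt y u)"
  unfolding conormal_derivative_dxi
  by (simp only: second_derivative_commute[OF open_coordinates coordinate_smooth(2) y, of u w])

end

text \<open>Along a field with constant coefficients the structure equation decomposes a plain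
  second derivative of \<open>f\<close>; \<nu> annihilates its tangential part and is 1 on
  \<xi>.\<close>

lemma fundamental_form_eq:
  assumes X: "X \<in> tangent_space M p" and Y: "Y \<in> tangent_space M p"
  shows "h p X Y = blinfun_apply (\<nu> p) (second_derivative ft (snd c p) (X c) (Y c))"
proof -
  note c' = charts_atD[OF M c]
  let ?Y = "\<lambda>q. coord_vec M c q (Y c)"
  have Yp: "?Y p = Y" by (rule coord_vec_of_tangent[OF M Y c])
  have "openin (mtop M) (fst c)" using c'(2) by (simp add: is_chart_def)
  then have eq: "nabla p X ?Y \<in> tangent_space M p" "vdifferential M (\<lambda>q. vdifferential M f q (?Y q)) p X =
      vdifferential M f p (nabla p X ?Y) + h p X (?Y p) *\<^sub>R \<xi> p"
    using struct vector_field_coord_vec[OF M c'(1), of "Y c"] c'(3) X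
    unfolding structure_equations_def by blast+
  have "vdifferential M (\<lambda>q. vdifferential M f q (?Y q)) p X = second_derivative ft (snd c p) (X c) (Y c)"
    unfolding second_derivative_def ft_def
    by (rule vdifferential_coord_vec[OF M c X open_chart_range[OF c'(2)] subset_refl c'(5)
          coordinate_smooth(1)[unfolded ft_def]]) simp
  with eq Yp have "second_derivative ft (snd c p) (X c) (Y c) = vdifferential M f p (nabla p X ?Y) + h p X Y *\<^sub>R \<xi> p"
    by simp
  then show ?thesis
    using conormal c'(4) eq(1) by (simp add: conormal_map_def blinfun.add_right blinfun.scaleR_right)
qed

lemma gauss_map_differential:
  assumes X: "X \<in> tangent_space M p"
  shows "vdifferential M (\<lambda>p. (\<xi> p, \<nu> p)) p X =
    (fderiv xt (snd c p) (X c), fderiv nt (snd c p) (X c))"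
proof (rule vdifferential_has_derivative[OF M c X])
  note y = charts_atD(5)[OF M c]
  show "((\<lambda>p. (\<xi> p, \<nu> p)) \<circ> chart_inv c has_derivative
      (\<lambda>u. (fderiv xt (snd c p) u, fderiv nt (snd c p) u))) (at (snd c p))"
    using has_derivative_Pair[OF smooth_on_has_derivative[OF coordinate_smooth(2) y]
        smooth_on_has_derivative[OF coordinate_smooth(3) y]]
    by (simp add: xt_def nt_def comp_def)
qed

lemma coordinates_at: "xt (snd c p) = \<xi> p" "nt (snd c p) = \<nu> p"
  using chart_inv_left[OF charts_atD(2,3)[OF M c]] by (simp_all add: xt_def nt_def)

lemma gauss_map_horizontal:
  assumes X: "X \<in> tangent_space M p"
  shows "vdifferential M (\<lambda>p. (\<xi> p, \<nu> p)) p X \<in> horizontal (\<xi> p, \<nu> p)"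
  using coordinate_equations(3) conormal_derivative_xi charts_atD(5)[OF M c]
  unfolding gauss_map_differential[OF X] by (simp add: horizontal_iff flip: coordinates_at)

text \<open>The sign in \<open>para_phi\<close> turns the sum in \<open>ghat\<close> into the
  difference of two values of a symmetric form.\<close>

lemma gauss_map_symplectic:
  assumes X: "X \<in> tangent_space M p" and Y: "Y \<in> tangent_space M p"
  shows "ghat (vdifferential M (\<lambda>p. (\<xi> p, \<nu> p)) p X) (para_phi (vdifferential M (\<lambda>p. (\<xi> p, \<nu> p)) p Y)) = 0"
  using conormal_derivative_symmetric[OF charts_atD(5)[OF M c], of "X c" "Y c"]
  unfolding gauss_map_differential[OF X] gauss_map_differential[OF Y] by (simp add: blinfun.minus_left)

text \<open>The two terms of \<open>ghat\<close> are equal, and the one with \<nu> differentiated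
  along \<open>Y\<close> is kept so that the shape operator falls on \<open>X\<close>. The minus
  sign in the equation for \<xi> cancels the one from differentiating the conormal condition on
  \<open>f\<close>.\<close>

lemma gauss_map_metric:
  assumes X: "X \<in> tangent_space M p" and Y: "Y \<in> tangent_space M p"
  shows "ghat (vdifferential M (\<lambda>p. (\<xi> p, \<nu> p)) p X) (vdifferential M (\<lambda>p. (\<xi> p, \<nu> p)) p Y) = h p (S p X) Y"
proof -
  note c' = charts_atD[OF M c]
  note y = c'(5)
  have SX: "S p X \<in> tangent_space M p" using struct c'(4) X by (auto simp: structure_equations_def)
  have dxi: "fderiv xt (snd c p) (X c) = - fderiv ft (snd c p) (S p X c)"
    using coordinate_equations(4)[OF y, of X] X by (simp add: chart_inv_left[OF c'(2,3)])
  have "ghat (vdifferential M (\<lambda>p. (\<xi> p, \<nu> p)) p X) (vdifferential M (\<lambda>p. (\<xi> p, \<nu> p)) p Y) =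
      blinfun_apply (fderiv nt (snd c p) (Y c)) (fderiv xt (snd c p) (X c))"
    using conormal_derivative_symmetric[OF y, of "X c" "Y c"]
    unfolding gauss_map_differential[OF X] gauss_map_differential[OF Y] by simp
  also have "\<dots> = blinfun_apply (nt (snd c p)) (second_derivative ft (snd c p) (Y c) (S p X c))"
    unfolding dxi by (simp add: blinfun.minus_right conormal_derivative_df[OF y])
  also have "\<dots> = blinfun_apply (\<nu> p) (second_derivative ft (snd c p) (S p X c) (Y c))"
    by (simp only: coordinates_at second_derivative_commute[OF open_coordinates[OF y] coordinate_smooth(1) y, of "Y c"])
  also have "\<dots> = h p (S p X) Y" by (rule fundamental_form_eq[OF SX Y, symmetric])
  finally show ?thesis .
qed

end

theorem theorem3p11:
  fixes M :: "('m, real ^ 'n) manifold"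
    and f \<xi> :: "'m \<Rightarrow> 'n aff"
    and \<nu> :: "'m \<Rightarrow> 'n aff_dual"
    and nabla :: "'m \<Rightarrow> ('m, real ^ 'n) tvec \<Rightarrow> ('m \<Rightarrow> ('m, real ^ 'n) tvec) \<Rightarrow> ('m, real ^ 'n) tvec"
    and h :: "('m, real ^ 'n) tensor2"
    and S :: "'m \<Rightarrow> ('m, real ^ 'n) tvec \<Rightarrow> ('m, real ^ 'n) tvec"
    and \<tau> :: "'m \<Rightarrow> ('m, real ^ 'n) tvec \<Rightarrow> real"
  assumes "smooth_manifold M" and "oriented M"
    and "affine_immersion M f \<xi>"
    and "structure_equations M f \<xi> nabla h S \<tau>"
    and "equiaffine M \<tau>"
    and "nondegenerate M h"
    and "conormal_map M f \<xi> \<nu>"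
    and "nondegenerate_immersion M pseudosphere sphere_metric (\<lambda>p. (\<xi> p, \<nu> p))"
  shows "let \<sigma>bar = proj_plus \<circ> (\<lambda>p. (\<xi> p, \<nu> p)) in
      lagrangian_immersion M para_hyperbolic hyperbolic_symplectic \<sigma>bar \<and>
      (\<forall>p\<in>points M. \<forall>X\<in>tangent_space M p. \<forall>Y\<in>tangent_space M p.
         pullback M para_hyperbolic hyperbolic_metric \<sigma>bar p X Y = h p (S p X) Y) \<and>
      (maximal_immersion M pseudosphere sphere_metric (\<lambda>p. (\<xi> p, \<nu> p)) \<longrightarrow>
         maximal_immersion M para_hyperbolic hyperbolic_metric \<sigma>bar)"
proof -
  let ?\<sigma> = "\<lambda>p. (\<xi> p, \<nu> p)"
  let ?\<sigma>bar = "proj_plus \<circ> ?\<sigma>"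
  have M: "smooth_atlas M" by (rule smooth_manifold_imp_smooth_atlas[OF assms(1)])
  have smooth: "smooth_map M pseudosphere ?\<sigma>"
    using assms(8) by (simp add: nondegenerate_immersion_def immersion_def)
  note chart = chart_at_in_charts_at[OF M]
  have hor: "vdifferential M ?\<sigma> p X \<in> horizontal (?\<sigma> p)" if "p \<in> points M" "X \<in> tangent_space M p" for p X
    by (rule gauss_map_horizontal[OF M assms(3,4,5,7) smooth chart[OF that(1)] that(2)])
  have symp: "pullback M para_hyperbolic hyperbolic_symplectic ?\<sigma>bar p X Y = 0"
    if "p \<in> points M" "X \<in> tangent_space M p" "Y \<in> tangent_space M p" for p X Y
    by (rule trans[OF pullback_hyperbolic_symplectic[OF M assms(8) hor that]
          gauss_map_symplectic[OF M assms(3,4,5,7) smooth chart[OF that(1)] that(2,3)]])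
  have met: "pullback M para_hyperbolic hyperbolic_metric ?\<sigma>bar p X Y = h p (S p X) Y"
    if p: "p \<in> points M" and X: "X \<in> tangent_space M p" and Y: "Y \<in> tangent_space M p" for p X Y
  proof -
    have "pullback M para_hyperbolic hyperbolic_metric ?\<sigma>bar p X Y = pullback M pseudosphere sphere_metric ?\<sigma> p X Y"
      by (rule pullback_hyperbolic_metric[OF M assms(8) hor p X Y])
    also have "\<dots> = h p (S p X) Y"
      using gauss_map_metric[OF M assms(3,4,5,7) smooth chart[OF p] X Y]
      unfolding pullback_def sphere_metric_def ambient_differential[OF M smooth p X]
        ambient_differential[OF M smooth p Y] .
    finally show ?thesis .
  qed
  have ndi: "nondegenerate_immersion M para_hyperbolic hyperbolic_metric ?\<sigma>bar"
    by (rule nondegenerate_immersion_proj[OF M assms(8) hor])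
  then have "lagrangian_immersion M para_hyperbolic hyperbolic_symplectic ?\<sigma>bar"
    using symp by (simp add: lagrangian_immersion_def nondegenerate_immersion_def)
  moreover have "maximal_immersion M para_hyperbolic hyperbolic_metric ?\<sigma>bar"
    if "maximal_immersion M pseudosphere sphere_metric ?\<sigma>"
    using that ndi mean_curvature_proj[OF M assms(8) hor] by (simp add: maximal_immersion_def)
  ultimately show ?thesis using met by (simp add: Let_def)
qed

end
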